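(* Let $n\ge1$ and $V=\mathbb{T}^n\times\mathbb{T}^n$. Let $\mathcal{V}$ and $\mathcal{T}$ be the groups of real-analytic vertical and horizontal shear maps of $V$, respectively. Then the group generated by $\mathcal{V}$ and $\mathcal{T}$ is dense in $\mathrm{Ham}^\infty(V)$ (for the $C^\infty$-topology).
   Context: $\mathbb{T}^n=\mathbb{R}^n/\mathbb{Z}^n$, and $V=\mathbb{T}^n\times\mathbb{T}^n$ has coordinates $(q,p)=(q_1,\dots,q_n,p_1,\dots,p_n)$ and symplectic form $\omega=\sum_i dp_i\wedge dq_i$. For a continuous family $(H_t)_{t\ge0}$ of functions in $C^\infty(V,\mathbb{R})$, the time-dependent Hamiltonian system is $(\dot q,\dot p)=(\partial_p H_t,-\partial_q H_t)$, and $\phi_H^{s,t}$ ($0\le s\le t$) is the map sending the initial condition at time $s$ to the value of the solution at time $t$. $\mathrm{Ham}^\infty(V)$ is the group of Hamiltonian $C^\infty$-diffeomorphisms, i.e. of maps $\phi_H^{0,1}$ for such $H$. $\mathcal{T}$ is the group of horizontal shears $(q,p)\mapsto(q+\nabla\tau(p),p)$ with $\tau\in C^\omega(\mathbb{T}^n,\mathbb{R})$; $\mathcal{V}$ is the group of vertical shears $(q,p)\mapsto(q,p-\nabla v(q))$ with $v\in C^\omega(\mathbb{T}^n,\mathbb{R})$, where $C^\omega$ means real-analytic. *)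

theory Defs
  imports "HOL-Analysis.Analysis" "HOL-Algebra.Bij" "HOL-Algebra.Generated_Groups"
begin

quotient_type (overloaded) 'n torus = "real ^ 'n::finite" / "\<lambda>x y. \<forall>i. x $ i - y $ i \<in> \<int>"
  morphisms rep_torus to_torus
proof (rule equivpI)
  show "reflp (\<lambda>x y :: real ^ 'n. \<forall>i. x $ i - y $ i \<in> \<int>)"
    by (simp add: reflp_def)
  show "symp (\<lambda>x y :: real ^ 'n. \<forall>i. x $ i - y $ i \<in> \<int>)"
  proof (rule sympI, rule allI)
    fix x y :: "real ^ 'n" and i
    assume "\<forall>i. x $ i - y $ i \<in> \<int>"
    then have "- (x $ i - y $ i) \<in> \<int>"
      by (intro Ints_minus) simp
    then show "y $ i - x $ i \<in> \<int>"
      by simp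
  qed
  show "transp (\<lambda>x y :: real ^ 'n. \<forall>i. x $ i - y $ i \<in> \<int>)"
  proof (rule transpI, rule allI)
    fix x y z :: "real ^ 'n" and i
    assume "\<forall>i. x $ i - y $ i \<in> \<int>" "\<forall>i. y $ i - z $ i \<in> \<int>"
    then have "(x $ i - y $ i) + (y $ i - z $ i) \<in> \<int>"
      by (intro Ints_add) auto
    then show "x $ i - z $ i \<in> \<int>"
      by simp
  qed
qed

text \<open>The phase space, with coordinates \<open>(q, p)\<close>, and its universal cover.\<close>

type_synonym 'n phase = "'n torus \<times> 'n torus"
type_synonym 'n cover = "(real ^ 'n) \<times> (real ^ 'n)"

definition to_phase :: "'n::finite cover \<Rightarrow> 'n phase" where
  "to_phase = (\<lambda>(q, p). (to_torus q, to_torus p))"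

definition is_lift :: "('n::finite cover \<Rightarrow> 'n cover) \<Rightarrow> ('n phase \<Rightarrow> 'n phase) \<Rightarrow> bool" where
  "is_lift F f \<longleftrightarrow> (\<forall>x. f (to_phase x) = to_phase (F x))"


primrec iter_deriv ::
  "'a::euclidean_space list \<Rightarrow> ('a \<Rightarrow> 'b::real_normed_vector) \<Rightarrow> 'a \<Rightarrow> 'b" where
  "iter_deriv [] f = f"
| "iter_deriv (v # vs) f = (\<lambda>x. frechet_derivative (iter_deriv vs f) (at x) v)"

definition smooth :: "('a::euclidean_space \<Rightarrow> 'b::real_normed_vector) \<Rightarrow> bool" where
  "smooth f \<longleftrightarrow> (\<forall>vs. set vs \<subseteq> Basis \<longrightarrow> (\<forall>x. iter_deriv vs f differentiable (at x)))"

definition gradient :: "('a::euclidean_space \<Rightarrow> real) \<Rightarrow> 'a \<Rightarrow> 'a" where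
  "gradient f x = (\<Sum>b\<in>Basis. frechet_derivative f (at x) b *\<^sub>R b)"

text \<open>Local expansion in a power series indexed by multi-indices; \<open>has_sum\<close> is unconditional,
  hence absolute, convergence.\<close>

definition real_analytic :: "(real ^ 'n::finite \<Rightarrow> real) \<Rightarrow> bool" where
  "real_analytic f \<longleftrightarrow>
     (\<forall>x0. \<exists>r>0. \<exists>a :: ('n \<Rightarrow> nat) \<Rightarrow> real. \<forall>x\<in>ball x0 r.
        ((\<lambda>\<alpha>. a \<alpha> * (\<Prod>i\<in>UNIV. (x $ i - x0 $ i) ^ \<alpha> i)) has_sum f x) UNIV)"


text \<open>\<open>C\<^sup>\<infinity>(V, \<real>)\<close>, and families \<open>(H\<^sub>t)\<close>, \<open>t \<ge> 0\<close>, that are continuous for the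
  \<open>C\<^sup>\<infinity>\<close>-topology. Values of \<open>H\<close> at negative times are irrelevant.\<close>

definition smooth_fun :: "('n::finite phase \<Rightarrow> real) \<Rightarrow> bool" where
  "smooth_fun h \<longleftrightarrow> smooth (h \<circ> to_phase)"

definition continuous_family :: "(real \<Rightarrow> 'n::finite phase \<Rightarrow> real) \<Rightarrow> bool" where
  "continuous_family H \<longleftrightarrow>
     (\<forall>t\<ge>0. smooth_fun (H t)) \<and>
     (\<forall>vs. set vs \<subseteq> Basis \<longrightarrow> (\<forall>t0\<ge>0.
        uniform_limit UNIV (\<lambda>t. iter_deriv vs (H t \<circ> to_phase))
          (iter_deriv vs (H t0 \<circ> to_phase)) (at t0 within {0..})))"

definition ham_field :: "('n::finite phase \<Rightarrow> real) \<Rightarrow> 'n cover \<Rightarrow> 'n cover" where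
  "ham_field h = (\<lambda>(q, p).
     (gradient (\<lambda>p'. h (to_phase (q, p'))) p, - gradient (\<lambda>q'. h (to_phase (q', p))) q))"

text \<open>The solutions on \<open>V\<close> are the projections of the solutions of the lifted system.\<close>

definition ham_solution ::
  "(real \<Rightarrow> 'n::finite phase \<Rightarrow> real) \<Rightarrow> real \<Rightarrow> real \<Rightarrow> (real \<Rightarrow> 'n cover) \<Rightarrow> bool" where
  "ham_solution H s t c \<longleftrightarrow>
     (\<forall>u\<in>{s..t}. (c has_vector_derivative ham_field (H u) (c u)) (at u within {s..t}))"

text \<open>\<open>ham_flow H s t f\<close> says that \<open>f\<close> is the map \<open>\<phi>\<^sub>H\<^sup>s\<^sup>,\<^sup>t\<close>. For a continuous family
  \<open>H\<close> the solution through a given point exists and is unique, so \<open>f\<close> is determined by \<open>H\<close>.\<close>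

definition ham_flow ::
  "(real \<Rightarrow> 'n::finite phase \<Rightarrow> real) \<Rightarrow> real \<Rightarrow> real \<Rightarrow> ('n phase \<Rightarrow> 'n phase) \<Rightarrow> bool" where
  "ham_flow H s t f \<longleftrightarrow>
     (\<forall>x. \<exists>c. ham_solution H s t c \<and> to_phase (c s) = x \<and> to_phase (c t) = f x)"

definition Ham_infinity :: "('n::finite phase \<Rightarrow> 'n phase) set" where
  "Ham_infinity = {f. \<exists>H. continuous_family H \<and> ham_flow H 0 1 f}"

definition horizontal_shears :: "('n::finite phase \<Rightarrow> 'n phase) set" where
  "horizontal_shears = {f. \<exists>\<tau> :: 'n torus \<Rightarrow> real. real_analytic (\<tau> \<circ> to_torus) \<and>
     is_lift (\<lambda>(q, p). (q + gradient (\<tau> \<circ> to_torus) p, p)) f}"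

definition vertical_shears :: "('n::finite phase \<Rightarrow> 'n phase) set" where
  "vertical_shears = {f. \<exists>v :: 'n torus \<Rightarrow> real. real_analytic (v \<circ> to_torus) \<and>
     is_lift (\<lambda>(q, p). (q, p - gradient (v \<circ> to_torus) q)) f}"

text \<open>\<open>BijGroup UNIV\<close> is the group of all bijections of \<open>V\<close> under composition.\<close>

definition shear_group :: "('n::finite phase \<Rightarrow> 'n phase) set" where
  "shear_group = generate (BijGroup UNIV) (vertical_shears \<union> horizontal_shears)"


text \<open>A map of \<open>V\<close> is smooth iff it has a smooth lift, since the cover is simply connected and
  \<open>to_phase\<close> is a local diffeomorphism. Two maps are \<open>C\<^sup>r\<close>-close iff they have lifts that are
  uniformly close together with their partial derivatives of order up to \<open>r\<close>.\<close>

definition smooth_map :: "('n::finite phase \<Rightarrow> 'n phase) \<Rightarrow> bool" where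
  "smooth_map f \<longleftrightarrow> (\<exists>F. is_lift F f \<and> smooth F)"

definition Cr_close ::
  "nat \<Rightarrow> real \<Rightarrow> ('n::finite phase \<Rightarrow> 'n phase) \<Rightarrow> ('n phase \<Rightarrow> 'n phase) \<Rightarrow> bool" where
  "Cr_close r \<epsilon> f g \<longleftrightarrow>
     (\<exists>F G. is_lift F f \<and> smooth F \<and> is_lift G g \<and> smooth G \<and>
        (\<forall>vs. set vs \<subseteq> Basis \<and> length vs \<le> r \<longrightarrow>
           (\<forall>x. norm (iter_deriv vs G x - iter_deriv vs F x) < \<epsilon>)))"

definition C_infinity_open :: "('n::finite phase \<Rightarrow> 'n phase) set \<Rightarrow> bool" where
  "C_infinity_open U \<longleftrightarrow> (\<forall>f\<in>U. smooth_map f) \<and>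
     (\<forall>f\<in>U. \<exists>r. \<exists>\<epsilon>>0. \<forall>g. smooth_map g \<and> Cr_close r \<epsilon> f g \<longrightarrow> g \<in> U)"

definition C_infinity_topology :: "('n::finite phase \<Rightarrow> 'n phase) topology" where
  "C_infinity_topology = topology C_infinity_open"

lemma Cr_close_mono:
  assumes "Cr_close r \<epsilon> f g" "r' \<le> r" "\<epsilon> \<le> \<epsilon>'"
  shows "Cr_close r' \<epsilon>' f g"
proof -
  obtain F G where *: "is_lift F f" "smooth F" "is_lift G g" "smooth G"
    "\<And>vs x. set vs \<subseteq> Basis \<Longrightarrow> length vs \<le> r \<Longrightarrow>
       norm (iter_deriv vs G x - iter_deriv vs F x) < \<epsilon>"
    using assms(1) unfolding Cr_close_def by blast
  have "norm (iter_deriv vs G x - iter_deriv vs F x) < \<epsilon>'"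
    if "set vs \<subseteq> Basis" "length vs \<le> r'" for vs x
    using *(5)[of vs x] that assms(2,3) by linarith
  with *(1-4) show ?thesis
    unfolding Cr_close_def by blast
qed

lemma istopology_C_infinity_open: "istopology C_infinity_open"
  unfolding istopology_def
proof (intro conjI allI impI)
  fix S T :: "('n::finite phase \<Rightarrow> 'n phase) set"
  assume S: "C_infinity_open S" and T: "C_infinity_open T"
  show "C_infinity_open (S \<inter> T)"
    unfolding C_infinity_open_def
  proof (intro conjI ballI)
    fix f assume f: "f \<in> S \<inter> T"
    then show "smooth_map f"
      using S unfolding C_infinity_open_def by blast
    obtain r1 \<epsilon>1 where 1: "\<epsilon>1 > 0" "\<And>g. smooth_map g \<Longrightarrow> Cr_close r1 \<epsilon>1 f g \<Longrightarrow> g \<in> S"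
      using S f unfolding C_infinity_open_def by blast
    obtain r2 \<epsilon>2 where 2: "\<epsilon>2 > 0" "\<And>g. smooth_map g \<Longrightarrow> Cr_close r2 \<epsilon>2 f g \<Longrightarrow> g \<in> T"
      using T f unfolding C_infinity_open_def by blast
    have "g \<in> S \<inter> T" if "smooth_map g" "Cr_close (max r1 r2) (min \<epsilon>1 \<epsilon>2) f g" for g
      using 1(2)[OF that(1)] 2(2)[OF that(1)] Cr_close_mono[OF that(2)] by simp
    then show "\<exists>r. \<exists>\<epsilon>>0. \<forall>g. smooth_map g \<and> Cr_close r \<epsilon> f g \<longrightarrow> g \<in> S \<inter> T"
      using 1(1) 2(1) by (intro exI[of _ "max r1 r2"] exI[of _ "min \<epsilon>1 \<epsilon>2"]) simp
  qed
next
  fix K :: "('n::finite phase \<Rightarrow> 'n phase) set set"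
  assume K: "\<forall>S\<in>K. C_infinity_open S"
  show "C_infinity_open (\<Union>K)"
    unfolding C_infinity_open_def
  proof (intro conjI ballI)
    fix f assume "f \<in> \<Union>K"
    then obtain S where S: "S \<in> K" "f \<in> S"
      by blast
    then have S': "C_infinity_open S"
      using K by blast
    then show "smooth_map f"
      using S(2) unfolding C_infinity_open_def by blast
    obtain r \<epsilon> where "\<epsilon> > 0" "\<And>g. smooth_map g \<Longrightarrow> Cr_close r \<epsilon> f g \<Longrightarrow> g \<in> S"
      using S' S(2) unfolding C_infinity_open_def by blast
    with S(1) show "\<exists>r. \<exists>\<epsilon>>0. \<forall>g. smooth_map g \<and> Cr_close r \<epsilon> f g \<longrightarrow> g \<in> \<Union>K"
      by (intro exI[of _ r] exI[of _ \<epsilon>]) auto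
  qed
qed

lemma openin_C_infinity_topology: "openin C_infinity_topology U \<longleftrightarrow> C_infinity_open U"
  unfolding C_infinity_topology_def topology_inverse'[OF istopology_C_infinity_open] ..

lemma topspace_C_infinity_topology: "topspace C_infinity_topology = {f. smooth_map f}"
proof
  show "topspace C_infinity_topology \<subseteq> {f. smooth_map f}"
    using openin_topspace[of C_infinity_topology]
    unfolding openin_C_infinity_topology C_infinity_open_def by blast
  have "C_infinity_open {f. smooth_map f}"
    unfolding C_infinity_open_def using zero_less_one by blast
  then show "{f. smooth_map f} \<subseteq> topspace C_infinity_topology"
    by (intro openin_subset) (simp only: openin_C_infinity_topology)
qed

end

theory Submission
  imports Defs
begin

text \<open>A map \<open>x \<mapsto> x + w x\<close> of the cover is handled through its displacement \<open>w\<close>, and all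
  estimates are uniform bounds on the partial derivatives of displacements up to a given order.

  Call a Hamiltonian approximable if, to first order in \<open>t\<close> and in every \<open>C\<^sup>r\<close> norm, its time-\<open>t\<close>
  map is a product of shears. Approximable Hamiltonians are closed under sums, nonnegative multiples
  and \<open>C\<^sup>\<infinity>\<close> limits. Conjugating a vertical shear by a horizontal one shows that
  \<open>cos (A \<bullet> q + s f(p))\<close> is approximable for \<open>f = A \<bullet> \<nabla>\<tau>\<close>; its first and second order terms in \<open>s\<close>
  produce all trigonometric monomials, and these are dense by convolution with powers of \<open>cos\<^sup>2\<close>.

  For a time-dependent Hamiltonian the Euler maps form a \<open>C\<^sup>r\<close>-Cauchy sequence for every \<open>r\<close>, whose
  limit is the flow, so the flow is smooth; replacing each Euler step by a product of shears with an
  error of smaller order changes the limit arbitrarily little, by a discrete Gronwall estimate.\<close>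

section \<open>Functions with bounded partial derivatives up to order r\<close>

text \<open>The obstacle is loss of derivatives: comparing \<open>u (x + w x)\<close> with
  \<open>u (x + w' x)\<close> in order \<open>r\<close> uses \<open>u\<close> in order
  \<open>Suc r\<close>, and a product of N maps must not lose N orders. The way out is that only the
  reference product, whose factors are Euler steps of a smooth field, is measured one order higher,
  while the factors that replace them are controlled in order \<open>r\<close> alone.
  Approximability concerns positive times only, so it defines a closed convex cone rather than a
  vector space; negative multiples come from shifting a phase by \<open>pi\<close>. The functions A
  . grad tau contain only frequencies B with A . B nonzero, so the first order term in s cannot
  produce the resonant monomials. The square of such a function can contain frequencies orthogonal
  to A, which is why the second order is taken. The flow is constructed as a limit of Euler maps and
  only afterwards identified with the solutions of the lifted system.\<close>

definition pd :: "'a::euclidean_space \<Rightarrow> ('a \<Rightarrow> 'b::real_normed_vector) \<Rightarrow> 'a \<Rightarrow> 'b" where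
  "pd b f = (\<lambda>x. frechet_derivative f (at x) b)"

lemma iter_deriv_Cons_pd: "iter_deriv (v # vs) f = pd v (iter_deriv vs f)"
  by (simp add: pd_def)

lemma iter_deriv_append: "iter_deriv (vs @ ws) f = iter_deriv vs (iter_deriv ws f)"
  by (induction vs) auto

text \<open>\<open>iter_deriv\<close> applies the head of the list last, whereas
  \<open>Cr_bounded\<close> differentiates the function itself first; lists of directions are
  therefore split at their end whenever the two are compared.\<close>

lemma iter_deriv_snoc: "iter_deriv (vs @ [b]) f = iter_deriv vs (pd b f)"
  by (simp add: iter_deriv_append pd_def)

lemma pd_eqI: "(f has_derivative D) (at x) \<Longrightarrow> pd b f x = D b"
  unfolding pd_def using frechet_derivative_at by metis

lemma has_derivative_pd':
  "f differentiable at x \<Longrightarrow> (f has_derivative (\<lambda>h. pd h f x)) (at x)"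
  by (simp add: pd_def frechet_derivative_works)

lemma has_derivative_pd:
  assumes "f differentiable at x"
  shows "(f has_derivative (\<lambda>v. \<Sum>b\<in>Basis. (v \<bullet> b) *\<^sub>R pd b f x)) (at x)"
proof -
  have D: "(f has_derivative frechet_derivative f (at x)) (at x)"
    using assms frechet_derivative_works by blast
  then interpret bounded_linear "frechet_derivative f (at x)"
    by (rule has_derivative_bounded_linear)
  have "frechet_derivative f (at x) v = (\<Sum>b\<in>Basis. (v \<bullet> b) *\<^sub>R pd b f x)" for v
  proof -
    have "frechet_derivative f (at x) v = frechet_derivative f (at x) (\<Sum>b\<in>Basis. (v \<bullet> b) *\<^sub>R b)"
      by (simp add: euclidean_representation)
    also have "\<dots> = (\<Sum>b\<in>Basis. (v \<bullet> b) *\<^sub>R pd b f x)"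
      by (simp add: sum scaleR pd_def)
    finally show ?thesis .
  qed
  then have "frechet_derivative f (at x) = (\<lambda>v. \<Sum>b\<in>Basis. (v \<bullet> b) *\<^sub>R pd b f x)"
    by blast
  with D show ?thesis by simp
qed

text \<open>One constant bounds all iterated partial derivatives up to order \<open>r\<close>.
  Differentiability is demanded below order \<open>r\<close>, because
  \<open>frechet_derivative\<close> is an arbitrary choice where no derivative exists; order
  \<open>r\<close> itself is merely bounded. The recursion through \<open>pd b f\<close> makes the
  estimates inductions on \<open>r\<close> with \<open>f\<close> arbitrary.\<close>

primrec Cr_bounded :: "nat \<Rightarrow> real \<Rightarrow> ('a::euclidean_space \<Rightarrow> 'b::real_normed_vector) \<Rightarrow> bool" where
  "Cr_bounded 0 M f \<longleftrightarrow> (\<forall>x. norm (f x) \<le> M)"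
| "Cr_bounded (Suc r) M f \<longleftrightarrow>
     (\<forall>x. norm (f x) \<le> M) \<and> (\<forall>x. f differentiable (at x)) \<and> (\<forall>b\<in>Basis. Cr_bounded r M (pd b f))"

lemma Cr_bounded_norm: "Cr_bounded r M f \<Longrightarrow> norm (f x) \<le> M"
  by (cases r) auto

lemma Cr_bounded_nonneg: "Cr_bounded r M f \<Longrightarrow> 0 \<le> M"
  using Cr_bounded_norm[of r M f 0] norm_ge_zero order_trans by blast

lemma Cr_bounded_mono: "Cr_bounded r M f \<Longrightarrow> M \<le> M' \<Longrightarrow> Cr_bounded r M' f"
proof (induction r arbitrary: f)
  case 0 then show ?case by (auto intro: order_trans)
next
  case (Suc r) then show ?case by (auto intro: order_trans)
qed

lemma Cr_bounded_SucD: "Cr_bounded (Suc r) M f \<Longrightarrow> Cr_bounded r M f"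
  by (induction r arbitrary: f) auto

lemma Cr_bounded_le: "Cr_bounded r M f \<Longrightarrow> r' \<le> r \<Longrightarrow> Cr_bounded r' M f"
  by (induction r) (auto simp: le_Suc_eq dest: Cr_bounded_SucD simp del: Cr_bounded.simps)

lemma Cr_bounded_differentiable: "Cr_bounded (Suc r) M f \<Longrightarrow> f differentiable (at x)"
  by simp

lemma Cr_bounded_pd: "Cr_bounded (Suc r) M f \<Longrightarrow> b \<in> Basis \<Longrightarrow> Cr_bounded r M (pd b f)"
  by simp

lemma Cr_bounded_SucI:
  "(\<And>x. norm (f x) \<le> M) \<Longrightarrow> (\<And>x. f differentiable (at x)) \<Longrightarrow>
   (\<And>b. b \<in> Basis \<Longrightarrow> Cr_bounded r M (pd b f)) \<Longrightarrow> Cr_bounded (Suc r) M f"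
  by simp

declare Cr_bounded.simps(2) [simp del]

lemma Cr_bounded_const:
  fixes c :: "'b::real_normed_vector"
  shows "norm c \<le> M \<Longrightarrow> Cr_bounded r M (\<lambda>x :: 'a::euclidean_space. c)"
proof (induction r arbitrary: c)
  case (Suc r)
  have "pd b (\<lambda>x :: 'a. c) = (\<lambda>x. 0)" for b
    by (intro ext pd_eqI) simp
  with Suc.prems show ?case
    by (intro Cr_bounded_SucI) (auto intro!: Suc.IH intro: order_trans[OF norm_ge_zero])
qed auto

lemma pd_add:
  "f differentiable (at x) \<Longrightarrow> g differentiable (at x) \<Longrightarrow> pd b (\<lambda>x. f x + g x) x = pd b f x + pd b g x"
  using pd_eqI[OF has_derivative_add[OF has_derivative_pd' has_derivative_pd']] by blast

lemma pd_diff: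
  "f differentiable (at x) \<Longrightarrow> g differentiable (at x) \<Longrightarrow> pd b (\<lambda>x. f x - g x) x = pd b f x - pd b g x"
  using pd_eqI[OF has_derivative_diff[OF has_derivative_pd' has_derivative_pd']] by blast

lemma pd_linear:
  "f differentiable (at x) \<Longrightarrow> bounded_linear L \<Longrightarrow> pd b (\<lambda>x. L (f x)) x = L (pd b f x)"
  using pd_eqI[OF bounded_linear.has_derivative[OF _ has_derivative_pd']] by blast

lemma pd_scaleR:
  fixes f :: "'a::euclidean_space \<Rightarrow> real"
  assumes "f differentiable (at x)" "g differentiable (at x)"
  shows "pd b (\<lambda>x. f x *\<^sub>R g x) x = f x *\<^sub>R pd b g x + pd b f x *\<^sub>R g x"
  using pd_eqI[OF has_derivative_scaleR[OF has_derivative_pd' has_derivative_pd']] assms by blast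

lemma Cr_bounded_add: "Cr_bounded r A f \<Longrightarrow> Cr_bounded r B g \<Longrightarrow> Cr_bounded r (A + B) (\<lambda>x. f x + g x)"
proof (induction r arbitrary: f g)
  case 0 then show ?case by (auto intro: norm_triangle_mono)
next
  case (Suc r)
  have d: "f differentiable (at x)" "g differentiable (at x)" for x
    using Suc.prems Cr_bounded_differentiable by blast+
  have "pd b (\<lambda>x. f x + g x) = (\<lambda>x. pd b f x + pd b g x)" for b
    using d by (simp add: pd_add fun_eq_iff)
  moreover have "norm (f x + g x) \<le> A + B" for x
    using Cr_bounded_norm[OF Suc.prems(1)] Cr_bounded_norm[OF Suc.prems(2)] by (rule norm_triangle_mono)
  ultimately show ?case
    using Suc d by (intro Cr_bounded_SucI) (auto intro!: Suc.IH Cr_bounded_pd differentiable_add)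
qed

lemma Cr_bounded_linear:
  assumes "bounded_linear L" "\<And>y. norm (L y) \<le> K * norm y" "0 \<le> K"
  shows "Cr_bounded r M f \<Longrightarrow> Cr_bounded r (K * M) (\<lambda>x. L (f x))"
proof (induction r arbitrary: f)
  case 0 with assms show ?case
    using mult_left_mono order_trans by (simp, blast)
next
  case (Suc r)
  have d: "f differentiable (at x)" for x
    using Suc.prems Cr_bounded_differentiable by blast
  have e: "pd b (\<lambda>x. L (f x)) = (\<lambda>x. L (pd b f x))" for b
    using d assms(1) by (simp add: pd_linear fun_eq_iff)
  have "(\<lambda>x. L (f x)) differentiable (at x)" for x
    using bounded_linear.has_derivative[OF assms(1) has_derivative_pd'[OF d]]
    by (rule differentiableI)
  moreover have "norm (L (f x)) \<le> K * M" for x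
    using assms(2)[of "f x"] Cr_bounded_norm[OF Suc.prems, of x] assms(3)
    by (meson mult_left_mono order_trans)
  ultimately show ?case
    using Suc.prems by (intro Cr_bounded_SucI) (auto simp: e intro!: Suc.IH Cr_bounded_pd)
qed

lemma Cr_bounded_scaleR_const: "Cr_bounded r M f \<Longrightarrow> Cr_bounded r (\<bar>c\<bar> * M) (\<lambda>x. c *\<^sub>R f x)"
  by (rule Cr_bounded_linear[of "\<lambda>y. c *\<^sub>R y"]) (auto intro: bounded_linear_scaleR_right)

lemma Cr_bounded_scaled:
  assumes "Cr_bounded r M f" "0 \<le> h"
  shows "Cr_bounded r (M * h) (\<lambda>x. h *\<^sub>R f x)"
  using Cr_bounded_scaleR_const[OF assms(1), of h] assms(2) by (simp add: mult.commute)

lemma Cr_bounded_mult_const: "Cr_bounded r M f \<Longrightarrow> Cr_bounded r (\<bar>c\<bar> * M) (\<lambda>x. c * f x :: real)"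
  using Cr_bounded_scaleR_const[of r M f c] by simp

lemma Cr_bounded_minus: "Cr_bounded r M f \<Longrightarrow> Cr_bounded r M (\<lambda>x. - f x)"
  using Cr_bounded_scaleR_const[of r M f "-1"] by simp

lemma Cr_bounded_diff: "Cr_bounded r A f \<Longrightarrow> Cr_bounded r B g \<Longrightarrow> Cr_bounded r (A + B) (\<lambda>x. f x - g x)"
  using Cr_bounded_add[OF _ Cr_bounded_minus, of r A f B g] by simp

lemma Cr_bounded_inner_Basis: "Cr_bounded r M f \<Longrightarrow> c \<in> Basis \<Longrightarrow> Cr_bounded r M (\<lambda>x. f x \<bullet> c)"
  using Cr_bounded_linear[of "\<lambda>y. y \<bullet> c" 1 r M f]
  by (simp add: bounded_linear_inner_left Basis_le_norm)

lemma Cr_bounded_sum: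
  assumes "finite I" "\<And>i. i \<in> I \<Longrightarrow> Cr_bounded r (A i) (f i)"
  shows "Cr_bounded r (sum A I) (\<lambda>x. \<Sum>i\<in>I. f i x)"
  using assms by (induction I rule: finite_induct) (auto intro: Cr_bounded_const Cr_bounded_add)

text \<open>Leibniz rule: each differentiation splits the product into two, so the constant doubles
  with each order.\<close>

lemma Cr_bounded_scaleR:
  fixes f :: "'a::euclidean_space \<Rightarrow> real"
  shows "Cr_bounded r A f \<Longrightarrow> Cr_bounded r B g \<Longrightarrow> Cr_bounded r (2 ^ r * A * B) (\<lambda>x. f x *\<^sub>R g x)"
proof (induction r arbitrary: f g)
  case 0 then show ?case
    using Cr_bounded_nonneg[OF 0(1)] by (auto intro!: mult_mono)
next
  case (Suc r)
  have d: "f differentiable (at x)" "g differentiable (at x)" for x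
    using Suc.prems Cr_bounded_differentiable by blast+
  have e: "pd b (\<lambda>x. f x *\<^sub>R g x) = (\<lambda>x. f x *\<^sub>R pd b g x + pd b f x *\<^sub>R g x)" for b
    using d by (simp add: pd_scaleR fun_eq_iff)
  have nn: "0 \<le> A" "0 \<le> B" using Suc.prems Cr_bounded_nonneg by blast+
  have "norm (f x *\<^sub>R g x) \<le> 2 ^ Suc r * A * B" for x
  proof -
    have "norm (f x *\<^sub>R g x) \<le> A * B"
      using Cr_bounded_norm[OF Suc.prems(1), of x] Cr_bounded_norm[OF Suc.prems(2), of x] nn
      by (auto intro!: mult_mono)
    also have "\<dots> \<le> 2 ^ Suc r * (A * B)"
      using nn mult_right_mono[of 1 "2 ^ Suc r" "A * B"] one_le_power[of "2::real" "Suc r"] by auto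
    finally show ?thesis by (simp add: mult.assoc)
  qed
  moreover have "Cr_bounded r (2 ^ Suc r * A * B) (pd b (\<lambda>x. f x *\<^sub>R g x))" if "b \<in> Basis" for b
  proof -
    have "Cr_bounded r (2 ^ r * A * B + 2 ^ r * A * B) (\<lambda>x. f x *\<^sub>R pd b g x + pd b f x *\<^sub>R g x)"
      using Suc.prems that by (intro Cr_bounded_add Suc.IH) (auto dest: Cr_bounded_SucD intro: Cr_bounded_pd)
    then show ?thesis by (simp add: e mult_ac)
  qed
  ultimately show ?case
    using d by (intro Cr_bounded_SucI) (auto intro: differentiable_scaleR)
qed

lemma Cr_bounded_mult:
  fixes f g :: "'a::euclidean_space \<Rightarrow> real"
  shows "Cr_bounded r A f \<Longrightarrow> Cr_bounded r B g \<Longrightarrow> Cr_bounded r (2 ^ r * A * B) (\<lambda>x. f x * g x)"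
  using Cr_bounded_scaleR[of r A f B g] by simp

lemma Cr_bounded_iter_deriv:
  "Cr_bounded r M f \<Longrightarrow> length vs \<le> r \<Longrightarrow> set vs \<subseteq> Basis \<Longrightarrow> norm (iter_deriv vs f x) \<le> M"
proof (induction vs arbitrary: f r rule: rev_induct)
  case Nil then show ?case by (simp add: Cr_bounded_norm)
next
  case (snoc b vs)
  then obtain r' where "r = Suc r'" by (cases r) auto
  with snoc show ?case by (auto simp: iter_deriv_snoc intro!: snoc.IH[of r'] Cr_bounded_pd)
qed

lemma Cr_bounded_iter_deriv_differentiable:
  "Cr_bounded r M f \<Longrightarrow> length vs < r \<Longrightarrow> set vs \<subseteq> Basis \<Longrightarrow> iter_deriv vs f differentiable (at x)"
proof (induction vs arbitrary: f r rule: rev_induct)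
  case Nil then show ?case by (cases r) (auto intro: Cr_bounded_differentiable)
next
  case (snoc b vs)
  then obtain r' where "r = Suc r'" by (cases r) auto
  with snoc show ?case by (auto simp: iter_deriv_snoc intro!: snoc.IH[of r'] Cr_bounded_pd)
qed

lemma smooth_pd: "smooth f \<Longrightarrow> b \<in> Basis \<Longrightarrow> smooth (pd b f)"
  unfolding smooth_def by (metis iter_deriv_snoc bot.extremum empty_set insert_subset le_sup_iff
      list.simps(15) set_append)

lemma smooth_differentiable: "smooth f \<Longrightarrow> f differentiable (at x)"
  unfolding smooth_def by (metis iter_deriv.simps(1) empty_set empty_subsetI)

lemma Cr_bounded_imp_smooth: "(\<And>r. \<exists>M. Cr_bounded r M f) \<Longrightarrow> smooth f"
  unfolding smooth_def using Cr_bounded_iter_deriv_differentiable by (metis lessI)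

section \<open>Composition with maps given by a displacement\<close>

lemma differentiable_displaced:
  fixes w :: "'a::euclidean_space \<Rightarrow> 'a" and u :: "'a::euclidean_space \<Rightarrow> 'b::real_normed_vector"
  assumes "\<And>x. u differentiable (at x)" "w differentiable (at x)"
  shows "(\<lambda>x. u (x + w x)) differentiable (at x)"
  using assms differentiable_chain_at[of "\<lambda>x. x + w x" x u]
  by (simp add: o_def differentiable_add)

lemma pd_displaced:
  fixes w :: "'a::euclidean_space \<Rightarrow> 'a" and u :: "'a::euclidean_space \<Rightarrow> 'b::real_normed_vector"
  assumes "\<And>x. u differentiable (at x)" "w differentiable (at x)"
  shows "pd b (\<lambda>x. u (x + w x)) x = (\<Sum>c\<in>Basis. ((b + pd b w x) \<bullet> c) *\<^sub>R pd c u (x + w x))"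
proof -
  have "((\<lambda>x. x + w x) has_derivative (\<lambda>h. h + frechet_derivative w (at x) h)) (at x)"
    using assms(2) by (auto intro!: derivative_eq_intros simp: frechet_derivative_works)
  from has_derivative_compose[OF this has_derivative_pd[OF assms(1)]]
  show ?thesis by (auto dest: pd_eqI[of _ _ _ b] simp: pd_def)
qed

text \<open>Linear in the top-order bound \<open>S\<close> with a constant depending only on the lower-order
  bound \<open>R\<close>; this is what makes the discrete Gronwall argument for long products work.\<close>

lemma Cr_bounded_displaced_aux:
  assumes 0: "0 \<le> C" and C: "\<And>(u :: 'a::euclidean_space \<Rightarrow> 'b::real_normed_vector) M w.
      Cr_bounded r M u \<Longrightarrow> Cr_bounded r R w \<Longrightarrow> Cr_bounded r (C * M) (\<lambda>x. u (x + w x))"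
    and u: "Cr_bounded (Suc r) M (u :: 'a \<Rightarrow> 'b)" and w: "Cr_bounded r R w" "Cr_bounded (Suc r) S w"
  shows "Cr_bounded (Suc r) ((1 + real DIM('a) * 2 ^ r * C) * M * (1 + S)) (\<lambda>x. u (x + w x))"
proof -
  have d: "u differentiable (at x)" "w differentiable (at x)" for x
    using u w Cr_bounded_differentiable by blast+
  have nn: "0 \<le> M" "0 \<le> S" using u w Cr_bounded_nonneg by blast+
  let ?K = "(1 + real DIM('a) * 2 ^ r * C) * M * (1 + S)"
  have K: "?K = M + M * S + real DIM('a) * 2 ^ r * C * M * (1 + S)"
    by (simp add: algebra_simps)
  have "Cr_bounded r ?K (pd b (\<lambda>x. u (x + w x)))" if b: "b \<in> Basis" for b
  proof -
    have e: "pd b (\<lambda>x. u (x + w x)) =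
        (\<lambda>x. \<Sum>c\<in>Basis. ((b + pd b w x) \<bullet> c) *\<^sub>R pd c u (x + w x))"
      using pd_displaced[OF d(1) d(2)] by (simp add: fun_eq_iff)
    \<comment> \<open>Only the factor \<open>b + pd b w x\<close> sees order \<open>Suc r\<close> of
      \<open>w\<close>; the factor \<open>pd c u (x + w x)\<close> is estimated in order
      \<open>r\<close> with the constant \<open>C\<close>, which belongs to the bound
      \<open>R\<close>.\<close>
    have "Cr_bounded r (2 ^ r * (1 + S) * (C * M)) (\<lambda>x. ((b + pd b w x) \<bullet> c) *\<^sub>R pd c u (x + w x))"
      if c: "c \<in> Basis" for c
      using b c u w by (intro Cr_bounded_scaleR Cr_bounded_inner_Basis Cr_bounded_add Cr_bounded_const C Cr_bounded_pd) auto
    then have "Cr_bounded r (\<Sum>c\<in>(Basis::'a set). 2 ^ r * (1 + S) * (C * M)) (pd b (\<lambda>x. u (x + w x)))"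
      unfolding e by (intro Cr_bounded_sum) auto
    then show ?thesis
      using nn by (elim Cr_bounded_mono) (simp add: K algebra_simps)
  qed
  moreover have "norm (u (x + w x)) \<le> ?K" for x
    using Cr_bounded_norm[OF u, of "x + w x"] nn 0 unfolding K
    by (smt (verit) mult_nonneg_nonneg of_nat_0_le_iff zero_le_power)
  ultimately show ?thesis
    using differentiable_displaced[OF d(1) d(2)] by (intro Cr_bounded_SucI) auto
qed

text \<open>The constant is chosen before \<open>u\<close>, \<open>M\<close> and \<open>w\<close>,
  and the bound is linear in \<open>M\<close>: small maps stay small under composition, up to a
  fixed factor.\<close>

lemma Cr_bounded_displaced:
  assumes "0 \<le> R"
  shows "\<exists>C\<ge>0. \<forall>(u :: 'a::euclidean_space \<Rightarrow> 'b::real_normed_vector) M w.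
      Cr_bounded r M u \<longrightarrow> Cr_bounded r R w \<longrightarrow> Cr_bounded r (C * M) (\<lambda>x. u (x + w x))"
proof (induction r)
  case 0 show ?case by (rule exI[of _ 1]) auto
next
  case (Suc r)
  then obtain C where C: "C \<ge> 0" "\<And>(u :: 'a \<Rightarrow> 'b) M w.
      Cr_bounded r M u \<Longrightarrow> Cr_bounded r R w \<Longrightarrow> Cr_bounded r (C * M) (\<lambda>x. u (x + w x))" by blast
  show ?case
  proof (intro exI[of _ "(1 + real DIM('a) * 2 ^ r * C) * (1 + R)"] conjI allI impI)
    fix u :: "'a \<Rightarrow> 'b" and M and w :: "'a \<Rightarrow> 'a" assume "Cr_bounded (Suc r) M u" "Cr_bounded (Suc r) R w"
    then have "Cr_bounded (Suc r) ((1 + real DIM('a) * 2 ^ r * C) * M * (1 + R)) (\<lambda>x. u (x + w x))"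
      by (intro Cr_bounded_displaced_aux[where R = R] C) (auto dest: Cr_bounded_SucD)
    then show "Cr_bounded (Suc r) ((1 + real DIM('a) * 2 ^ r * C) * (1 + R) * M) (\<lambda>x. u (x + w x))"
      by (simp add: mult_ac)
  qed (use C assms in auto)
qed

lemma Cr_bounded_displaced_linear:
  assumes "0 \<le> R"
  shows "\<exists>C\<ge>0. \<forall>(u :: 'a::euclidean_space \<Rightarrow> 'b::real_normed_vector) M w S.
      Cr_bounded (Suc r) M u \<longrightarrow> Cr_bounded r R w \<longrightarrow> Cr_bounded (Suc r) S w \<longrightarrow> Cr_bounded (Suc r) (C * M * (1 + S)) (\<lambda>x. u (x + w x))"
proof -
  obtain C where C: "C \<ge> 0" "\<And>(u :: 'a \<Rightarrow> 'b) M w.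
      Cr_bounded r M u \<Longrightarrow> Cr_bounded r R w \<Longrightarrow> Cr_bounded r (C * M) (\<lambda>x. u (x + w x))"
    using Cr_bounded_displaced[OF assms] by blast
  show ?thesis
    using Cr_bounded_displaced_aux[OF C] C(1)
    by (intro exI[of _ "1 + real DIM('a) * 2 ^ r * C"]) auto
qed

lemma norm_sum_pd_le:
  fixes v :: "'a::euclidean_space"
  assumes "Cr_bounded (Suc 0) M u"
  shows "norm (\<Sum>b\<in>Basis. (v \<bullet> b) *\<^sub>R pd b u x) \<le> real DIM('a) * M * norm v"
proof -
  have "norm ((v \<bullet> b) *\<^sub>R pd b u x) \<le> M * norm v" if "b \<in> Basis" for b
    using Cr_bounded_norm[OF Cr_bounded_pd[OF assms that], of x] Basis_le_norm[OF that, of v]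
    by (simp add: mult.commute[of M]) (intro mult_mono, auto)
  from sum_norm_le[OF this] show ?thesis by (simp add: mult_ac)
qed

lemma Cr_bounded_lipschitz:
  assumes "Cr_bounded (Suc 0) M (u :: 'a::euclidean_space \<Rightarrow> 'b::real_normed_vector)"
  shows "norm (u x - u y) \<le> real DIM('a) * M * norm (x - y)"
proof (rule differentiable_bound[of UNIV])
  fix x
  show "(u has_derivative (\<lambda>v. \<Sum>b\<in>Basis. (v \<bullet> b) *\<^sub>R pd b u x)) (at x within UNIV)"
    using has_derivative_pd[OF Cr_bounded_differentiable[OF assms]] by simp
  show "onorm (\<lambda>v. \<Sum>b\<in>Basis. (v \<bullet> b) *\<^sub>R pd b u x) \<le> real DIM('a) * M"
    using norm_sum_pd_le[OF assms] by (intro onorm_le) auto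
qed auto

text \<open>The difference of two displaced copies is linear in the distance of the displacements,
  at the price of one more derivative of \<open>u\<close>. Order zero is the Lipschitz bound; higher
  orders follow from the chain rule after a mixed term is added and subtracted.\<close>

lemma Cr_bounded_displaced_diff:
  assumes R: "0 \<le> R"
  shows "\<exists>C\<ge>0. \<forall>(u :: 'a::euclidean_space \<Rightarrow> 'b::real_normed_vector) M (w :: 'a \<Rightarrow> 'a) w' d.
      Cr_bounded (Suc r) M u \<longrightarrow> Cr_bounded r R w \<longrightarrow> Cr_bounded r R w' \<longrightarrow> Cr_bounded r d (\<lambda>x. w x - w' x) \<longrightarrow>
      Cr_bounded r (C * M * d) (\<lambda>x. u (x + w x) - u (x + w' x))"
proof (induction r)
  case 0
  show ?case
  proof (intro exI[of _ "real DIM('a)"] conjI allI impI)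
    fix u :: "'a \<Rightarrow> 'b" and M and w w' :: "'a \<Rightarrow> 'a" and d
    assume *: "Cr_bounded (Suc 0) M u" "Cr_bounded 0 d (\<lambda>x. w x - w' x)"
    have "norm (u (x + w x) - u (x + w' x)) \<le> real DIM('a) * M * d" for x
    proof -
      have "norm (u (x + w x) - u (x + w' x)) \<le> real DIM('a) * M * norm (x + w x - (x + w' x))"
        by (rule Cr_bounded_lipschitz[OF *(1)])
      also have "\<dots> \<le> real DIM('a) * M * d"
        using Cr_bounded_norm[OF *(2), of x] Cr_bounded_nonneg[OF *(1)] by (auto intro!: mult_left_mono)
      finally show ?thesis .
    qed
    then show "Cr_bounded 0 (real DIM('a) * M * d) (\<lambda>x. u (x + w x) - u (x + w' x))" by simp
  qed auto
next
  case (Suc r)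
  then obtain C where C: "C \<ge> 0" "\<And>(u :: 'a \<Rightarrow> 'b) M (w :: 'a \<Rightarrow> 'a) w' d.
      Cr_bounded (Suc r) M u \<Longrightarrow> Cr_bounded r R w \<Longrightarrow> Cr_bounded r R w' \<Longrightarrow> Cr_bounded r d (\<lambda>x. w x - w' x) \<Longrightarrow>
      Cr_bounded r (C * M * d) (\<lambda>x. u (x + w x) - u (x + w' x))" by blast
  obtain D where D: "D \<ge> 0" "\<And>(u :: 'a \<Rightarrow> 'b) M w.
      Cr_bounded r M u \<Longrightarrow> Cr_bounded r R w \<Longrightarrow> Cr_bounded r (D * M) (\<lambda>x. u (x + w x))"
    using Cr_bounded_displaced[OF R] by blast
  define K where "K = real DIM('a) * (1 + 2 ^ r * (1 + R) * C + 2 ^ r * D)"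
  have K: "0 \<le> K" using R C D by (simp add: K_def)
  show ?case
  proof (intro exI[of _ K] conjI allI impI)
    fix u :: "'a \<Rightarrow> 'b" and M and w w' :: "'a \<Rightarrow> 'a" and d
    assume u: "Cr_bounded (Suc (Suc r)) M u" and w: "Cr_bounded (Suc r) R w" "Cr_bounded (Suc r) R w'"
      and d: "Cr_bounded (Suc r) d (\<lambda>x. w x - w' x)"
    have nn: "0 \<le> M" "0 \<le> d" using u d Cr_bounded_nonneg by blast+
    have diff: "u differentiable (at x)" "w differentiable (at x)" "w' differentiable (at x)" for x
      using u w Cr_bounded_differentiable by blast+
    have "norm (u (x + w x) - u (x + w' x)) \<le> K * M * d" for x
    proof -
      have "norm (u (x + w x) - u (x + w' x)) \<le> real DIM('a) * M * norm (x + w x - (x + w' x))"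
        by (rule Cr_bounded_lipschitz) (rule Cr_bounded_le[OF u], simp)
      also have "\<dots> \<le> real DIM('a) * M * d"
        using Cr_bounded_norm[OF d, of x] nn by (auto intro!: mult_left_mono)
      also have "\<dots> \<le> K * M * d"
        using nn R C D unfolding K_def by (intro mult_right_mono) (auto simp: distrib_left)
      finally show ?thesis .
    qed
    moreover have "Cr_bounded r (K * M * d) (pd b (\<lambda>x. u (x + w x) - u (x + w' x)))" if b: "b \<in> Basis" for b
    proof -
      have pdd: "pd b (\<lambda>x. w x - w' x) x = pd b w x - pd b w' x" for x
        using diff by (simp add: pd_diff)
      have "pd b (\<lambda>x. u (x + w x) - u (x + w' x)) x =
          pd b (\<lambda>x. u (x + w x)) x - pd b (\<lambda>x. u (x + w' x)) x" for x
        using differentiable_displaced[OF diff(1) diff(2), of x]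
          differentiable_displaced[OF diff(1) diff(3), of x] by (rule pd_diff)
      \<comment> \<open>The first summand falls under the induction hypothesis applied to
        \<open>pd c u\<close>; the second is small because the derivative of
        \<open>w x - w' x\<close> is.\<close>
      then have e: "pd b (\<lambda>x. u (x + w x) - u (x + w' x)) =
        (\<lambda>x. \<Sum>c\<in>Basis. ((b + pd b w x) \<bullet> c) *\<^sub>R (pd c u (x + w x) - pd c u (x + w' x))
           + (pd b (\<lambda>x. w x - w' x) x \<bullet> c) *\<^sub>R pd c u (x + w' x))"
        by (simp add: fun_eq_iff pd_displaced[OF diff(1) diff(2)] pd_displaced[OF diff(1) diff(3)] pdd
            sum_subtractf[symmetric] algebra_simps)
      have "Cr_bounded r (2 ^ r * (1 + R) * (C * M * d) + 2 ^ r * d * (D * M))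
         (\<lambda>x. ((b + pd b w x) \<bullet> c) *\<^sub>R (pd c u (x + w x) - pd c u (x + w' x))
           + (pd b (\<lambda>x. w x - w' x) x \<bullet> c) *\<^sub>R pd c u (x + w' x))"
        if c: "c \<in> Basis" for c
        using b c u w d Cr_bounded_SucD[OF u] Cr_bounded_SucD[OF w(1)] Cr_bounded_SucD[OF w(2)] Cr_bounded_SucD[OF d] Cr_bounded_SucD[OF Cr_bounded_pd[OF u c]]
        by (intro Cr_bounded_add Cr_bounded_scaleR Cr_bounded_inner_Basis Cr_bounded_const C D Cr_bounded_pd) (auto intro: Cr_bounded_pd)
      then have "Cr_bounded r (\<Sum>c\<in>(Basis::'a set). 2 ^ r * (1 + R) * (C * M * d) + 2 ^ r * d * (D * M))
          (pd b (\<lambda>x. u (x + w x) - u (x + w' x)))"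
        unfolding e by (intro Cr_bounded_sum) auto
      then show ?thesis
        using nn by (elim Cr_bounded_mono) (simp add: K_def algebra_simps)
    qed
    ultimately show "Cr_bounded (Suc r) (K * M * d) (\<lambda>x. u (x + w x) - u (x + w' x))"
      using differentiable_displaced[OF diff(1) diff(2)] differentiable_displaced[OF diff(1) diff(3)]
      by (intro Cr_bounded_SucI differentiable_diff) auto
  qed (rule K)
qed

section \<open>Long products of maps close to the identity\<close>

text \<open>\<open>x + displacement_prod u n x\<close> is the image of \<open>x\<close> under the
  maps \<open>x \<mapsto> x + u k x\<close> for \<open>k = 0, ..., n - 1\<close>, with
  \<open>u 0\<close> acting first.\<close>

primrec displacement_prod :: "(nat \<Rightarrow> 'a::euclidean_space \<Rightarrow> 'a) \<Rightarrow> nat \<Rightarrow> 'a \<Rightarrow> 'a" where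
  "displacement_prod u 0 = (\<lambda>x. 0)"
| "displacement_prod u (Suc k) = (\<lambda>x. displacement_prod u k x + u k (x + displacement_prod u k x))"

lemma displacement_prod_add: "displacement_prod u (m + n) x = displacement_prod u m x + displacement_prod (\<lambda>i. u (m + i)) n (x + displacement_prod u m x)"
  by (induction n) (auto simp: add.assoc)

text \<open>Regrouping the factors into blocks of length \<open>m\<close> allows a fine Euler
  subdivision to be compared block by block with a coarse one.\<close>

lemma displacement_prod_blocks: "displacement_prod u (j * m) = displacement_prod (\<lambda>j. displacement_prod (\<lambda>i. u (j * m + i)) m) j"
  by (induction j) (auto simp: fun_eq_iff displacement_prod_add add.commute[of m])

lemma exp_times_one_plus_le: "exp (a::real) * (1 + b) \<le> exp (a + b)"
  by (simp add: exp_add)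

text \<open>Products of many small maps, with \<open>R\<close> chosen before \<open>u\<close>,
  \<open>h\<close> and \<open>n\<close>. Once the product is bounded in order \<open>r\<close>, its
  bound \<open>S k\<close> in order \<open>Suc r\<close> satisfies
  \<open>S (Suc k) \<le> S k + C * M * h * (1 + S k)\<close> with a fixed \<open>C\<close>, so
  \<open>1 + S k\<close> grows at most exponentially in \<open>k * h\<close>, which stays below or
  at 1.\<close>

lemma displacement_prod_bound:
  assumes M: "0 \<le> M"
  shows "\<exists>R\<ge>0. \<forall>(u :: nat \<Rightarrow> 'a::euclidean_space \<Rightarrow> 'a) h n.
    0 \<le> h \<longrightarrow> real n * h \<le> 1 \<longrightarrow> (\<forall>k<n. Cr_bounded r (M * h) (u k)) \<longrightarrow>
    (\<forall>k\<le>n. Cr_bounded r (R * (real k * h)) (displacement_prod u k))"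
proof (induction r)
  case 0
  have "norm (displacement_prod u k x) \<le> M * (real k * h)"
    if "\<forall>k<n. Cr_bounded 0 (M * h) (u k)" "k \<le> n" for u h n k and x :: 'a
    using that(2)
  proof (induction k)
    case (Suc k)
    have "norm (displacement_prod u k x + u k (x + displacement_prod u k x)) \<le> M * (real k * h) + M * h"
      using Suc that(1) by (intro norm_triangle_mono) auto
    then show ?case by (simp add: algebra_simps)
  qed auto
  with M show ?case by (intro exI[of _ M]) auto
next
  case (Suc r)
  then obtain R where R: "R \<ge> 0" "\<And>(u :: nat \<Rightarrow> 'a \<Rightarrow> 'a) h n k.
    0 \<le> h \<Longrightarrow> real n * h \<le> 1 \<Longrightarrow> (\<And>k. k < n \<Longrightarrow> Cr_bounded r (M * h) (u k)) \<Longrightarrow> k \<le> n \<Longrightarrow>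
    Cr_bounded r (R * (real k * h)) (displacement_prod u k)" by metis
  obtain C where C: "C \<ge> 0" "\<And>(u :: 'a \<Rightarrow> 'a) M w S. Cr_bounded (Suc r) M u \<Longrightarrow> Cr_bounded r R w \<Longrightarrow> Cr_bounded (Suc r) S w \<Longrightarrow>
     Cr_bounded (Suc r) (C * M * (1 + S)) (\<lambda>x. u (x + w x))"
    using Cr_bounded_displaced_linear[OF R(1)] by blast
  show ?case
  proof (intro exI[of _ "C * M * exp (C * M)"] conjI allI impI)
    fix u :: "nat \<Rightarrow> 'a \<Rightarrow> 'a" and h n k
    assume h: "0 \<le> h" "real n * h \<le> 1" and u: "\<forall>k<n. Cr_bounded (Suc r) (M * h) (u k)" and kn: "k \<le> n"
    have kh: "real k * h \<le> 1" if "k \<le> n" for k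
      using that h mult_right_mono[of "real k" "real n" h] by linarith
    have low: "Cr_bounded r R (displacement_prod u k)" if "k \<le> n" for k
    proof -
      have "Cr_bounded r (R * (real k * h)) (displacement_prod u k)"
        using h u that by (intro R(2)[where n = n]) (auto dest: Cr_bounded_SucD)
      moreover have "R * (real k * h) \<le> R"
        using R(1) kh[OF that] mult_left_mono[of "real k * h" 1 R] by simp
      ultimately show ?thesis by (rule Cr_bounded_mono)
    qed
    have e: "Cr_bounded (Suc r) (exp (C * M * (real k * h)) - 1) (displacement_prod u k)" if "k \<le> n" for k
      using that
    proof (induction k)
      case 0 show ?case by (simp add: Cr_bounded_const)
    next
      case (Suc k)
      let ?e = "exp (C * M * (real k * h))"
      have "Cr_bounded (Suc r) (?e - 1 + C * (M * h) * (1 + (?e - 1))) (displacement_prod u (Suc k))"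
        unfolding displacement_prod.simps using Suc u low by (intro Cr_bounded_add C(2)) auto
      moreover have "?e - 1 + C * (M * h) * (1 + (?e - 1)) \<le> exp (C * M * (real (Suc k) * h)) - 1"
        using exp_times_one_plus_le[of "C * M * (real k * h)" "C * M * h"] by (simp add: algebra_simps)
      ultimately show ?case by (rule Cr_bounded_mono)
    qed
    have e': "Cr_bounded (Suc r) (exp (C * M) - 1) (displacement_prod u k)" if "k \<le> n" for k
    proof (rule Cr_bounded_mono[OF e[OF that]])
      show "exp (C * M * (real k * h)) - 1 \<le> exp (C * M) - 1"
        using kh[OF that] C(1) M mult_left_mono[of "real k * h" 1 "C * M"] by simp
    qed
    \<comment> \<open>A second pass: the crude bound \<open>exp (C * M)\<close> for the factor
      \<open>1 + S\<close> turns the exponential estimate into one linear in \<open>k * h\<close>,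
      the form in which short products are small.\<close>
    show "Cr_bounded (Suc r) (C * M * exp (C * M) * (real k * h)) (displacement_prod u k)"
      using kn
    proof (induction k)
      case 0 show ?case by (simp add: Cr_bounded_const)
    next
      case (Suc k)
      have "Cr_bounded (Suc r) (C * M * exp (C * M) * (real k * h) + C * (M * h) * (1 + (exp (C * M) - 1)))
              (displacement_prod u (Suc k))"
        unfolding displacement_prod.simps using Suc u low[of k] e'[of k] by (intro Cr_bounded_add C(2)) auto
      then show ?case by (simp add: algebra_simps)
    qed
  qed (use C M in auto)
qed

text \<open>Discrete Gronwall estimate. The loss of one derivative always falls on \<open>v\<close>,
  which is bounded in order \<open>Suc r\<close>; \<open>u\<close> is controlled in order
  \<open>r\<close> only, and no induction on \<open>r\<close> takes place.\<close>

lemma displacement_prod_compare: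
  assumes M: "0 \<le> M"
  shows "\<exists>C\<ge>0. \<forall>(u :: nat \<Rightarrow> 'a::euclidean_space \<Rightarrow> 'a) v h n e.
    0 \<le> h \<longrightarrow> real n * h \<le> 1 \<longrightarrow> 0 \<le> e \<longrightarrow> (\<forall>k<n. Cr_bounded r (M * h) (u k)) \<longrightarrow>
    (\<forall>k<n. Cr_bounded (Suc r) (M * h) (v k)) \<longrightarrow> (\<forall>k<n. Cr_bounded r (e * h) (\<lambda>x. u k x - v k x)) \<longrightarrow>
    Cr_bounded r (C * e) (\<lambda>x. displacement_prod u n x - displacement_prod v n x)"
proof -
  obtain R where R: "R \<ge> 0" "\<And>(u :: nat \<Rightarrow> 'a \<Rightarrow> 'a) h n k.
    0 \<le> h \<Longrightarrow> real n * h \<le> 1 \<Longrightarrow> (\<And>k. k < n \<Longrightarrow> Cr_bounded r (M * h) (u k)) \<Longrightarrow> k \<le> n \<Longrightarrow>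
    Cr_bounded r (R * (real k * h)) (displacement_prod u k)" using displacement_prod_bound[OF M] by metis
  obtain A where A: "A \<ge> 0" "\<And>(u :: 'a \<Rightarrow> 'a) M w.
      Cr_bounded r M u \<Longrightarrow> Cr_bounded r R w \<Longrightarrow> Cr_bounded r (A * M) (\<lambda>x. u (x + w x))"
    using Cr_bounded_displaced[OF R(1)] by blast
  obtain B where B: "B \<ge> 0" "\<And>(u :: 'a \<Rightarrow> 'a) M (w :: 'a \<Rightarrow> 'a) w' d.
      Cr_bounded (Suc r) M u \<Longrightarrow> Cr_bounded r R w \<Longrightarrow> Cr_bounded r R w' \<Longrightarrow> Cr_bounded r d (\<lambda>x. w x - w' x) \<Longrightarrow>
      Cr_bounded r (B * M * d) (\<lambda>x. u (x + w x) - u (x + w' x))"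
    using Cr_bounded_displaced_diff[OF R(1), of r] by blast
  show ?thesis
  proof (intro exI[of _ "exp (B * M) * A"] conjI allI impI)
    fix u v :: "nat \<Rightarrow> 'a \<Rightarrow> 'a" and h n e
    assume h: "0 \<le> h" "real n * h \<le> 1" and e: "0 \<le> (e::real)"
      and u: "\<forall>k<n. Cr_bounded r (M * h) (u k)" and v: "\<forall>k<n. Cr_bounded (Suc r) (M * h) (v k)"
      and uv: "\<forall>k<n. Cr_bounded r (e * h) (\<lambda>x. u k x - v k x)"
    have kh: "real k * h \<le> 1" if "k \<le> n" for k
      using that h mult_right_mono[of "real k" "real n" h] by linarith
    have low: "Cr_bounded r R (displacement_prod u k)" "Cr_bounded r R (displacement_prod v k)" if "k \<le> n" for k
    proof -
      have "R * (real k * h) \<le> R"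
        using R(1) kh[OF that] mult_left_mono[of "real k * h" 1 R] by simp
      moreover have "Cr_bounded r (R * (real k * h)) (displacement_prod u k)"
        using h u that by (intro R(2)[where n = n]) auto
      moreover have "Cr_bounded r (R * (real k * h)) (displacement_prod v k)"
        using h v that by (intro R(2)[where n = n]) (auto dest: Cr_bounded_SucD)
      ultimately show "Cr_bounded r R (displacement_prod u k)" "Cr_bounded r R (displacement_prod v k)" by (blast intro: Cr_bounded_mono)+
    qed
    \<comment> \<open>\<open>A\<close> transports the local error between \<open>u k\<close> and
      \<open>v k\<close> along the first product; \<open>B * M\<close> measures how one step of
      \<open>v\<close> magnifies the distance already accumulated, hence the exponential.\<close>
    have "Cr_bounded r (exp (B * M * (real k * h)) * (A * e * (real k * h))) (\<lambda>x. displacement_prod u k x - displacement_prod v k x)"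
      if "k \<le> n" for k
      using that
    proof (induction k)
      case 0 show ?case by (simp add: Cr_bounded_const)
    next
      case (Suc k)
      let ?d = "exp (B * M * (real k * h)) * (A * e * (real k * h))"
      let ?P = "displacement_prod u k" and ?Q = "displacement_prod v k"
      have "Cr_bounded r (?d + (A * (e * h) + B * (M * h) * ?d))
        (\<lambda>x. (?P x - ?Q x) + ((u k (x + ?P x) - v k (x + ?P x)) + (v k (x + ?P x) - v k (x + ?Q x))))"
        using Suc u v uv low[of k] by (intro Cr_bounded_add A(2)[of _ "\<lambda>x. u k x - v k x"] B(2)) auto
      moreover have "?d + (A * (e * h) + B * (M * h) * ?d)
          \<le> exp (B * M * (real (Suc k) * h)) * (A * e * (real (Suc k) * h))"
      proof -
        have "?d + B * (M * h) * ?d = exp (B * M * (real k * h)) * (1 + B * M * h) * (A * e * (real k * h))"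
          by (simp add: algebra_simps)
        also have "\<dots> \<le> exp (B * M * (real k * h) + B * M * h) * (A * e * (real k * h))"
          using h e A by (intro mult_right_mono exp_times_one_plus_le) auto
        also have "B * M * (real k * h) + B * M * h = B * M * (real (Suc k) * h)"
          by (simp add: algebra_simps)
        finally have 1: "?d + B * (M * h) * ?d \<le> exp (B * M * (real (Suc k) * h)) * (A * e * (real k * h))" .
        have "1 * (A * (e * h)) \<le> exp (B * M * (real (Suc k) * h)) * (A * (e * h))"
          using h e A B M by (intro mult_right_mono) auto
        with 1 show ?thesis by (simp add: algebra_simps)
      qed
      ultimately show ?case
        by (auto elim!: Cr_bounded_mono[rotated] simp: algebra_simps)
    qed
    from this[of n] have "Cr_bounded r (exp (B * M * (real n * h)) * (A * e * (real n * h)))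
        (\<lambda>x. displacement_prod u n x - displacement_prod v n x)" by simp
    moreover have "exp (B * M * (real n * h)) * (A * e * (real n * h)) \<le> exp (B * M * 1) * (A * e * 1)"
      using h e A B M by (intro mult_mono) (auto simp: mult_left_le)
    ultimately show "Cr_bounded r (exp (B * M) * A * e) (\<lambda>x. displacement_prod u n x - displacement_prod v n x)"
      by (auto elim: Cr_bounded_mono simp: mult_ac)
  qed (use A in auto)
qed

section \<open>Completeness: limits of sequences together with all their derivatives\<close>

definition C_infinity_limit :: "(nat \<Rightarrow> 'a::euclidean_space \<Rightarrow> 'b::real_normed_vector) \<Rightarrow> ('a \<Rightarrow> 'b) \<Rightarrow> bool" where
  "C_infinity_limit f g \<longleftrightarrow> (\<forall>r. \<forall>e>0. \<forall>\<^sub>F n in sequentially. Cr_bounded r e (\<lambda>x. f n x - g x))"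

text \<open>The bound on each single \<open>f n\<close> supplies its differentiability, which the
  condition on differences alone would not give.\<close>

definition C_infinity_Cauchy :: "(nat \<Rightarrow> 'a::euclidean_space \<Rightarrow> 'b::real_normed_vector) \<Rightarrow> bool" where
  "C_infinity_Cauchy f \<longleftrightarrow> (\<forall>n r. \<exists>M. Cr_bounded r M (f n)) \<and>
     (\<forall>r. \<forall>e>0. \<exists>N. \<forall>m\<ge>N. \<forall>n\<ge>N. Cr_bounded r e (\<lambda>x. f m x - f n x))"

lemma C_infinity_Cauchy_differentiable: "C_infinity_Cauchy f \<Longrightarrow> f n differentiable (at x)"
  unfolding C_infinity_Cauchy_def by (meson Cr_bounded_differentiable)

lemma pd_diff_fun:
  "(\<And>x. f differentiable (at x)) \<Longrightarrow> (\<And>x. g differentiable (at x)) \<Longrightarrow>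
   pd b (\<lambda>x. f x - g x) = (\<lambda>x. pd b f x - pd b g x)"
  by (simp add: fun_eq_iff pd_diff)

lemma C_infinity_Cauchy_pd:
  assumes "C_infinity_Cauchy f" "b \<in> Basis"
  shows "C_infinity_Cauchy (\<lambda>n. pd b (f n))"
proof -
  have "Cr_bounded r e (\<lambda>x. pd b (f m) x - pd b (f n) x)"
    if "Cr_bounded (Suc r) e (\<lambda>x. f m x - f n x)" for r e m n
    using Cr_bounded_pd[OF that assms(2)] C_infinity_Cauchy_differentiable[OF assms(1)] by (simp add: pd_diff_fun)
  then show ?thesis
    using assms unfolding C_infinity_Cauchy_def by (meson Cr_bounded_pd)
qed

lemma C_infinity_Cauchy_tendsto:
  fixes f :: "nat \<Rightarrow> 'a::euclidean_space \<Rightarrow> 'b::banach"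
  assumes "C_infinity_Cauchy f"
  shows "(\<lambda>n. f n x) \<longlonglongrightarrow> lim (\<lambda>n. f n x)"
proof -
  have "Cauchy (\<lambda>n. f n x)"
  proof (rule CauchyI)
    fix e :: real assume "0 < e"
    then obtain N where N: "\<forall>m\<ge>N. \<forall>n\<ge>N. Cr_bounded 0 (e / 2) (\<lambda>x. f m x - f n x)"
      using assms unfolding C_infinity_Cauchy_def by (meson half_gt_zero)
    have "norm (f m x - f n x) < e" if "m \<ge> N" "n \<ge> N" for m n
    proof -
      have "norm (f m x - f n x) \<le> e / 2" using N that by auto
      with \<open>0 < e\<close> show ?thesis by linarith
    qed
    then show "\<exists>M. \<forall>m\<ge>M. \<forall>n\<ge>M. norm (f m x - f n x) < e" by blast
  qed
  then show ?thesis using Cauchy_convergent convergent_LIMSEQ_iff by blast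
qed

lemma C_infinity_Cauchy_uniform:
  fixes f :: "nat \<Rightarrow> 'a::euclidean_space \<Rightarrow> 'b::banach"
  assumes "C_infinity_Cauchy f" "0 < e"
  shows "\<forall>\<^sub>F n in sequentially. \<forall>x. norm (f n x - lim (\<lambda>n. f n x)) \<le> e"
proof -
  obtain N where N: "\<forall>m\<ge>N. \<forall>n\<ge>N. Cr_bounded 0 e (\<lambda>x. f m x - f n x)"
    using assms unfolding C_infinity_Cauchy_def by blast
  have "norm (f n x - lim (\<lambda>n. f n x)) \<le> e" if "n \<ge> N" for n x
  proof (rule Lim_bounded)
    show "(\<lambda>m. norm (f n x - f m x)) \<longlonglongrightarrow> norm (f n x - lim (\<lambda>n. f n x))"
      using C_infinity_Cauchy_tendsto[OF assms(1)] by (intro tendsto_intros)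
    show "\<forall>m\<ge>N. norm (f n x - f m x) \<le> e" using N that by auto
  qed
  then show ?thesis unfolding eventually_sequentially by blast
qed

text \<open>The partial derivatives converge uniformly, which permits differentiation under the
  limit; the derivative is assembled from the limits of the partial derivatives.\<close>

lemma C_infinity_Cauchy_has_derivative:
  fixes f :: "nat \<Rightarrow> 'a::euclidean_space \<Rightarrow> 'b::banach"
  assumes "C_infinity_Cauchy f"
  shows "((\<lambda>x. lim (\<lambda>n. f n x)) has_derivative
    (\<lambda>h. \<Sum>b\<in>Basis. (h \<bullet> b) *\<^sub>R lim (\<lambda>n. pd b (f n) x))) (at x)"
proof -
  let ?g' = "\<lambda>x h. \<Sum>b\<in>Basis. (h \<bullet> b) *\<^sub>R lim (\<lambda>n. pd b (f n) x)"
  have "\<exists>g. \<forall>x\<in>UNIV. (\<lambda>n. f n x) \<longlonglongrightarrow> g x \<and> (g has_derivative ?g' x) (at x within UNIV)"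
  proof (rule has_derivative_sequence[where f' = "\<lambda>n x h. \<Sum>b\<in>Basis. (h \<bullet> b) *\<^sub>R pd b (f n) x" and ?x0.0 = x])
    show "(f n has_derivative (\<lambda>h. \<Sum>b\<in>Basis. (h \<bullet> b) *\<^sub>R pd b (f n) x)) (at x within UNIV)" for n x
      using has_derivative_pd[OF C_infinity_Cauchy_differentiable[OF assms]] by simp
    fix e :: real assume "0 < e"
    then have "\<forall>\<^sub>F n in sequentially. \<forall>b\<in>Basis. \<forall>x. norm (pd b (f n) x - lim (\<lambda>n. pd b (f n) x)) \<le> e / real DIM('a)"
      by (intro eventually_ball_finite ballI C_infinity_Cauchy_uniform C_infinity_Cauchy_pd assms) auto
    then show "\<forall>\<^sub>F n in sequentially. \<forall>x\<in>UNIV. \<forall>h.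
        norm ((\<Sum>b\<in>Basis. (h \<bullet> b) *\<^sub>R pd b (f n) x) - ?g' x h) \<le> e * norm h"
    proof (rule eventually_mono, intro ballI allI)
      fix n x and h :: 'a
      assume *: "\<forall>b\<in>Basis. \<forall>x. norm (pd b (f n) x - lim (\<lambda>n. pd b (f n) x)) \<le> e / real DIM('a)"
      have "norm ((\<Sum>b\<in>Basis. (h \<bullet> b) *\<^sub>R pd b (f n) x) - ?g' x h)
          = norm (\<Sum>b\<in>Basis. (h \<bullet> b) *\<^sub>R (pd b (f n) x - lim (\<lambda>n. pd b (f n) x)))"
        by (simp add: sum_subtractf scaleR_diff_right)
      also have "\<dots> \<le> (\<Sum>b\<in>(Basis::'a set). norm h * (e / real DIM('a)))"
      proof (rule sum_norm_le)
        fix b :: 'a assume "b \<in> Basis"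
        with * show "norm ((h \<bullet> b) *\<^sub>R (pd b (f n) x - lim (\<lambda>n. pd b (f n) x))) \<le> norm h * (e / real DIM('a))"
          unfolding norm_scaleR by (intro mult_mono) (auto simp: Basis_le_norm)
      qed
      also have "\<dots> = e * norm h" by simp
      finally show "norm ((\<Sum>b\<in>Basis. (h \<bullet> b) *\<^sub>R pd b (f n) x) - ?g' x h) \<le> e * norm h" .
    qed
  qed (use C_infinity_Cauchy_tendsto[OF assms, of x] in auto)
  then obtain g where g: "\<And>x. (\<lambda>n. f n x) \<longlonglongrightarrow> g x" "\<And>x. (g has_derivative ?g' x) (at x)" by auto
  have "g = (\<lambda>x. lim (\<lambda>n. f n x))"
    by (intro ext) (simp add: limI[OF g(1)])
  with g(2) show ?thesis by simp
qed

text \<open>The partial derivatives form Cauchy sequences again and their limits are the partial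
  derivatives of the limit; hence the induction on \<open>r\<close> runs over all sequences at
  once.\<close>

lemma Ccauchy_imp_C_infinity_limit:
  fixes f :: "nat \<Rightarrow> 'a::euclidean_space \<Rightarrow> 'b::banach"
  assumes "C_infinity_Cauchy f"
  shows "C_infinity_limit f (\<lambda>x. lim (\<lambda>n. f n x))"
proof -
  have "\<forall>\<^sub>F n in sequentially. Cr_bounded r e (\<lambda>x. f n x - lim (\<lambda>n. f n x))"
    if "C_infinity_Cauchy f" "0 < e" for r e and f :: "nat \<Rightarrow> 'a::euclidean_space \<Rightarrow> 'b"
    using that
  proof (induction r arbitrary: f)
    case 0 then show ?case by (simp add: C_infinity_Cauchy_uniform)
  next
    case (Suc r)
    let ?g = "\<lambda>x. lim (\<lambda>n. f n x)"
    have dg: "?g differentiable (at x)" for x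
      using C_infinity_Cauchy_has_derivative[OF Suc.prems(1)] by (rule differentiableI)
    have pg: "pd b ?g x = lim (\<lambda>n. pd b (f n) x)" if "b \<in> Basis" for b x
      using that by (subst pd_eqI[OF C_infinity_Cauchy_has_derivative[OF Suc.prems(1)]])
        (simp add: inner_Basis if_distrib if_distribR cong: if_cong)
    have "\<forall>\<^sub>F n in sequentially. \<forall>b\<in>Basis. Cr_bounded r e (\<lambda>x. pd b (f n) x - lim (\<lambda>n. pd b (f n) x))"
      by (intro eventually_ball_finite ballI Suc.IH C_infinity_Cauchy_pd Suc.prems) auto
    with C_infinity_Cauchy_uniform[OF Suc.prems] show ?case
    proof eventually_elim
      case (elim n)
      have "pd b (\<lambda>x. f n x - ?g x) = (\<lambda>x. pd b (f n) x - lim (\<lambda>n. pd b (f n) x))"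
        if "b \<in> Basis" for b
        using that dg C_infinity_Cauchy_differentiable[OF Suc.prems(1)] by (simp add: fun_eq_iff pd_diff pg)
      with elim show ?case
        using dg C_infinity_Cauchy_differentiable[OF Suc.prems(1)]
        by (intro Cr_bounded_SucI differentiable_diff) auto
    qed
  qed
  with assms show ?thesis unfolding C_infinity_limit_def by blast
qed

section \<open>Euler maps and the flow of a time-dependent vector field\<close>

text \<open>A vector field on the time interval [0, 1], with bounds and a modulus of continuity that
  are uniform in time but may depend on the order \<open>r\<close>.\<close>

locale field_family =
  fixes X :: "real \<Rightarrow> 'a::euclidean_space \<Rightarrow> 'a"
  assumes bounded_family: "\<And>r. \<exists>M. \<forall>t\<in>{0..1}. Cr_bounded r M (X t)"
    and ucont_family: "\<And>r e. 0 < e \<Longrightarrow>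
      \<exists>d>0. \<forall>s\<in>{0..1}. \<forall>t\<in>{0..1}. \<bar>s - t\<bar> < d \<longrightarrow> Cr_bounded r e (\<lambda>x. X s x - X t x)"
begin

definition euler :: "nat \<Rightarrow> 'a \<Rightarrow> 'a" where
  "euler N = displacement_prod (\<lambda>k x. (1 / real N) *\<^sub>R X (real k / real N) x) N"

lemma bounded_family_nonneg: "\<exists>M\<ge>0. \<forall>t\<in>{0..1}. Cr_bounded r M (X t)"
proof -
  obtain M where "\<forall>t\<in>{0..1}. Cr_bounded r M (X t)" using bounded_family by blast
  moreover then have "0 \<le> M" using Cr_bounded_nonneg[of r M "X 0"] by simp
  ultimately show ?thesis by blast
qed

text \<open>A block of \<open>m\<close> fine steps against one long step with the field frozen at
  time \<open>s\<close>. The error rate has two parts: \<open>C * M * R * (m * h)\<close> because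
  the base point drifts by at most \<open>R * (m * h)\<close>, and \<open>om\<close> because the
  field changes with time. The constants are hypotheses so that the caller can use the same ones for
  every block.\<close>

lemma euler_block:
  assumes R: "0 \<le> R" "\<And>(u :: nat \<Rightarrow> 'a \<Rightarrow> 'a) h n k.
    0 \<le> h \<Longrightarrow> real n * h \<le> 1 \<Longrightarrow> (\<And>k. k < n \<Longrightarrow> Cr_bounded r (M * h) (u k)) \<Longrightarrow> k \<le> n \<Longrightarrow>
    Cr_bounded r (R * (real k * h)) (displacement_prod u k)"
    and C: "0 \<le> C" "\<And>(u :: 'a \<Rightarrow> 'a) M (w :: 'a \<Rightarrow> 'a) w' d.
      Cr_bounded (Suc r) M u \<Longrightarrow> Cr_bounded r R w \<Longrightarrow> Cr_bounded r R w' \<Longrightarrow> Cr_bounded r d (\<lambda>x. w x - w' x) \<Longrightarrow>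
      Cr_bounded r (C * M * d) (\<lambda>x. u (x + w x) - u (x + w' x))"
    and M: "0 \<le> M" "\<And>t. t \<in> {0..1} \<Longrightarrow> Cr_bounded (Suc r) M (X t)"
    and h: "0 < h" "real m * h \<le> 1" and om: "0 \<le> om"
    and t: "\<And>i. i < m \<Longrightarrow> s + real i * h \<in> {0..1}" "s \<in> {0..1}"
      "\<And>i. i < m \<Longrightarrow> Cr_bounded r om (\<lambda>x. X (s + real i * h) x - X s x)"
    and i: "i \<le> m"
  shows "Cr_bounded r ((C * M * R * (real m * h) + om) * (real i * h))
    (\<lambda>x. displacement_prod (\<lambda>i x. h *\<^sub>R X (s + real i * h) x) i x - (real i * h) *\<^sub>R X s x)"
    and "Cr_bounded r (R * (real i * h)) (displacement_prod (\<lambda>i x. h *\<^sub>R X (s + real i * h) x) i)"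
proof -
  let ?u = "\<lambda>i x. h *\<^sub>R X (s + real i * h) x"
  have Q: "Cr_bounded r (R * (real i * h)) (displacement_prod ?u i)" if "i \<le> m" for i
    using h that by (intro R(2)[where n = m] Cr_bounded_scaled Cr_bounded_SucD[OF M(2)] t) auto
  have mono: "R * (real i * h) \<le> R * (real m * h)" "R * (real m * h) \<le> R * 1" if "i \<le> m" for i
    using R(1) h that by (intro mult_left_mono mult_right_mono; simp)+
  have QR: "Cr_bounded r (R * (real m * h)) (displacement_prod ?u i)" "Cr_bounded r R (displacement_prod ?u i)" if "i \<le> m" for i
  proof -
    show 1: "Cr_bounded r (R * (real m * h)) (displacement_prod ?u i)" using Cr_bounded_mono[OF Q[OF that] mono(1)[OF that]] .
    show "Cr_bounded r R (displacement_prod ?u i)" using Cr_bounded_mono[OF 1] mono(2)[OF that] by simp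
  qed
  show "Cr_bounded r (R * (real i * h)) (displacement_prod ?u i)" using Q i .
  show "Cr_bounded r ((C * M * R * (real m * h) + om) * (real i * h)) (\<lambda>x. displacement_prod ?u i x - (real i * h) *\<^sub>R X s x)"
    using i
  proof (induction i)
    case 0 show ?case by (simp add: Cr_bounded_const)
  next
    case (Suc i)
    let ?P = "displacement_prod ?u i"
    have "Cr_bounded r (C * M * (R * (real m * h)) + om)
        (\<lambda>x. (X (s + real i * h) (x + ?P x) - X (s + real i * h) (x + 0)) + (X (s + real i * h) x - X s x))"
    proof (rule Cr_bounded_add)
      show "Cr_bounded r (C * M * (R * (real m * h)))
          (\<lambda>x. X (s + real i * h) (x + ?P x) - X (s + real i * h) (x + 0))"
      proof (rule C(2))
        show "Cr_bounded (Suc r) M (X (s + real i * h))" using Suc.prems by (intro M t) simp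
        show "Cr_bounded r R ?P" using QR Suc.prems by simp
        show "Cr_bounded r R (\<lambda>x. 0)" using R(1) by (intro Cr_bounded_const) simp
        show "Cr_bounded r (R * (real m * h)) (\<lambda>x. ?P x - 0)" using QR Suc.prems by simp
      qed
      show "Cr_bounded r om (\<lambda>x. X (s + real i * h) x - X s x)"
        using Suc.prems by (intro t(3)) simp
    qed
    from Cr_bounded_scaled[OF this, of h] h have
      "Cr_bounded r ((C * M * (R * (real m * h)) + om) * h) (\<lambda>x. h *\<^sub>R (X (s + real i * h) (x + ?P x) - X s x))"
      by simp
    from Cr_bounded_add[OF Suc.IH this] Suc(2)
    show ?case
      by (simp add: algebra_simps)
  qed
qed

text \<open>Dividing every step into \<open>m\<close> parts changes the Euler map little, uniformly
  in \<open>m\<close>: each of the \<open>N\<close> blocks is off by at most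
  \<open>2 * om / N\<close>, and the Gronwall estimate adds these errors up.\<close>

lemma euler_refine:
  assumes "0 < e"
  shows "\<exists>N0>0. \<forall>N\<ge>N0. \<forall>m>0. Cr_bounded r e (\<lambda>x. euler (N * m) x - euler N x)"
proof -
  obtain M where M: "0 \<le> M" "\<And>t. t \<in> {0..1} \<Longrightarrow> Cr_bounded (Suc r) M (X t)"
    using bounded_family_nonneg[of "Suc r"] by blast
  obtain R where R: "0 \<le> R" "\<And>(u :: nat \<Rightarrow> 'a \<Rightarrow> 'a) h n k.
    0 \<le> h \<Longrightarrow> real n * h \<le> 1 \<Longrightarrow> (\<And>k. k < n \<Longrightarrow> Cr_bounded r (M * h) (u k)) \<Longrightarrow> k \<le> n \<Longrightarrow>
    Cr_bounded r (R * (real k * h)) (displacement_prod u k)" using displacement_prod_bound[OF M(1), of r] by metis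
  obtain C where C: "0 \<le> C" "\<And>(u :: 'a \<Rightarrow> 'a) M (w :: 'a \<Rightarrow> 'a) w' d.
      Cr_bounded (Suc r) M u \<Longrightarrow> Cr_bounded r R w \<Longrightarrow> Cr_bounded r R w' \<Longrightarrow> Cr_bounded r d (\<lambda>x. w x - w' x) \<Longrightarrow>
      Cr_bounded r (C * M * d) (\<lambda>x. u (x + w x) - u (x + w' x))"
    using Cr_bounded_displaced_diff[OF R(1), of r] by blast
  \<comment> \<open>The blocks are bounded through \<open>R\<close>, the coarse steps through
    \<open>M\<close>; the comparison wants one constant for both.\<close>
  define M' where "M' = max M R"
  have M': "0 \<le> M'" "M \<le> M'" "R \<le> M'" using M(1) by (auto simp: M'_def)
  obtain D where D: "0 \<le> D" "\<And>(u :: nat \<Rightarrow> 'a \<Rightarrow> 'a) v h n e.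
    0 \<le> h \<Longrightarrow> real n * h \<le> 1 \<Longrightarrow> 0 \<le> e \<Longrightarrow> (\<And>k. k < n \<Longrightarrow> Cr_bounded r (M' * h) (u k)) \<Longrightarrow>
    (\<And>k. k < n \<Longrightarrow> Cr_bounded (Suc r) (M' * h) (v k)) \<Longrightarrow> (\<And>k. k < n \<Longrightarrow> Cr_bounded r (e * h) (\<lambda>x. u k x - v k x)) \<Longrightarrow>
    Cr_bounded r (D * e) (\<lambda>x. displacement_prod u n x - displacement_prod v n x)"
    using displacement_prod_compare[OF M'(1), of r] by blast
  \<comment> \<open>The total error will be \<open>D * (2 * om)\<close>; the \<open>+ 1\<close>
    covers \<open>D = 0\<close>.\<close>
  define om where "om = e / (2 * (D + 1))"
  have om: "0 < om" using assms D by (simp add: om_def)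
  obtain d where d: "d > 0" "\<And>s t. s \<in> {0..1} \<Longrightarrow> t \<in> {0..1} \<Longrightarrow> \<bar>s - t\<bar> < d \<Longrightarrow> Cr_bounded r om (\<lambda>x. X s x - X t x)"
    using ucont_family[OF om] by blast
  \<comment> \<open>The bound by \<open>1 / d\<close> keeps all times of a block within the modulus
    \<open>d\<close>; the other one makes the drift term \<open>C * M * R / N\<close> at most
    \<open>om\<close>.\<close>
  obtain N0 where N0: "N0 > 0" "1 / d < real N0" "C * M * R / om < real N0"
  proof -
    obtain N1 where "max (1 / d) (C * M * R / om) < real N1" using reals_Archimedean2 by blast
    then show ?thesis using that[of "Suc N1"] by auto
  qed
  have "Cr_bounded r e (\<lambda>x. euler (N * m) x - euler N x)" if N: "N \<ge> N0" and m: "m > 0" for N m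
  proof -
    have Npos: "0 < N" and Nd: "1 / real N < d" and NC: "C * M * R / real N \<le> om"
    proof -
      show "0 < N" using N N0 by simp
      have "real N0 \<le> real N" using N by simp
      then have 1: "1 / d < real N" "C * M * R / om < real N" using N0 by linarith+
      show "1 / real N < d" using 1(1) \<open>0 < N\<close> d(1) by (simp add: field_simps)
      show "C * M * R / real N \<le> om" using 1(2) \<open>0 < N\<close> om by (simp add: field_simps)
    qed
    define h where "h = 1 / real (N * m)"
    have h: "0 < h" "real m * h = 1 / real N" using Npos m by (auto simp: h_def)
    define v where "v = (\<lambda>k x. h *\<^sub>R X (real k * h) x)"
    define u where "u = (\<lambda>j. displacement_prod (\<lambda>i x. h *\<^sub>R X (real j / real N + real i * h) x) m)"
    have vj: "(\<lambda>i. v (j * m + i)) = (\<lambda>i x. h *\<^sub>R X (real j / real N + real i * h) x)" for j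
    proof -
      have "real (j * m + i) * h = real j / real N + real i * h" for i
      proof -
        have "real (j * m + i) * h = real j * (real m * h) + real i * h" by (simp add: algebra_simps)
        then show ?thesis by (simp add: h(2))
      qed
      then show ?thesis by (simp add: v_def)
    qed
    have eu: "euler (N * m) = displacement_prod u N"
    proof -
      have "euler (N * m) = displacement_prod v (N * m)"
        by (simp only: euler_def v_def h_def times_divide_eq_right mult_1_right)
      also have "\<dots> = displacement_prod (\<lambda>j. displacement_prod (\<lambda>i. v (j * m + i)) m) N" by (rule displacement_prod_blocks)
      finally show ?thesis unfolding u_def by (simp only: vj)
    qed
    have blk: "Cr_bounded r ((C * M * R * (real m * h) + om) * (real m * h))
          (\<lambda>x. u j x - (real m * h) *\<^sub>R X (real j / real N) x)" "Cr_bounded r (R * (real m * h)) (u j)"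
      if j: "j < N" for j
    proof -
      have r: "real j / real N + real i * h \<in> {0..1}" "real i * h < 1 / real N" if "i < m" for i
      proof -
        show *: "real i * h < 1 / real N" using that h by (metis mult_less_cancel_right_pos of_nat_less_iff)
        have "real j + 1 \<le> real N" using j by linarith
        then have "real j / real N + 1 / real N \<le> 1" using Npos by (simp add: field_simps)
        with * h show "real j / real N + real i * h \<in> {0..1}" by simp
      qed
      have s: "real j / real N \<in> {0..1}" using j by auto
      have o: "Cr_bounded r om (\<lambda>x. X (real j / real N + real i * h) x - X (real j / real N) x)" if "i < m" for i
        using r[OF that] s Nd h by (intro d) auto
      have mh: "real m * h \<le> 1" using h Npos by simp
      show "Cr_bounded r ((C * M * R * (real m * h) + om) * (real m * h))
          (\<lambda>x. u j x - (real m * h) *\<^sub>R X (real j / real N) x)"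
        unfolding u_def
        by (rule euler_block(1)[where M = M and R = R and C = C and om = om and m = m])
          (fact R C M h(1) mh less_imp_le[OF om] r(1) s o order_refl)+
      show "Cr_bounded r (R * (real m * h)) (u j)"
        unfolding u_def
        by (rule euler_block(2)[where M = M and R = R and C = C and om = om and m = m])
          (fact R C M h(1) mh less_imp_le[OF om] r(1) s o order_refl)+
    qed
    have "Cr_bounded r (D * (2 * om)) (\<lambda>x. displacement_prod u N x - displacement_prod (\<lambda>j x. (1 / real N) *\<^sub>R X (real j / real N) x) N x)"
    proof (rule D(2)[where h = "1 / real N"])
      fix j assume j: "j < N"
      show "Cr_bounded r (M' * (1 / real N)) (u j)"
        using blk(2)[OF j] M' by (auto simp: h elim!: Cr_bounded_mono intro!: divide_right_mono)
      have "Cr_bounded (Suc r) (M * (1 / real N)) (\<lambda>x. (1 / real N) *\<^sub>R X (real j / real N) x)"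
        using j by (intro Cr_bounded_scaled M) auto
      then show "Cr_bounded (Suc r) (M' * (1 / real N)) (\<lambda>x. (1 / real N) *\<^sub>R X (real j / real N) x)"
        using M' by (auto elim!: Cr_bounded_mono intro!: divide_right_mono)
      have "(C * M * R * (1 / real N) + om) * (1 / real N) \<le> 2 * om * (1 / real N)"
        using NC by (intro mult_right_mono) auto
      with blk(1)[OF j] show "Cr_bounded r (2 * om * (1 / real N)) (\<lambda>x. u j x - (1 / real N) *\<^sub>R X (real j / real N) x)"
        unfolding h by (rule Cr_bounded_mono)
    qed (use om Npos in auto)
    moreover have "D * (2 * om) \<le> e"
      using D assms by (simp add: om_def field_simps)
    ultimately show ?thesis
      unfolding eu by (auto simp: euler_def elim: Cr_bounded_mono)
  qed
  with N0(1) show ?thesis by blast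
qed

lemma euler_bounded: "\<exists>M. Cr_bounded r M (euler N)"
proof (cases "N = 0")
  case True then show ?thesis by (auto simp: euler_def intro!: exI[of _ 0] Cr_bounded_const)
next
  case False
  obtain M where M: "0 \<le> M" "\<And>t. t \<in> {0..1} \<Longrightarrow> Cr_bounded r M (X t)"
    using bounded_family_nonneg[of r] by blast
  obtain R where R: "0 \<le> R" "\<And>(u :: nat \<Rightarrow> 'a \<Rightarrow> 'a) h n k.
    0 \<le> h \<Longrightarrow> real n * h \<le> 1 \<Longrightarrow> (\<And>k. k < n \<Longrightarrow> Cr_bounded r (M * h) (u k)) \<Longrightarrow> k \<le> n \<Longrightarrow>
    Cr_bounded r (R * (real k * h)) (displacement_prod u k)" using displacement_prod_bound[OF M(1), of r] by metis
  have "Cr_bounded r (R * (real N * (1 / real N))) (euler N)"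
    unfolding euler_def using False by (intro R(2)[where n = N] Cr_bounded_scaled M) auto
  then show ?thesis by blast
qed

text \<open>Step numbers \<open>m\<close> and \<open>n\<close> are compared through their common
  refinement \<open>m * n\<close>.\<close>

lemma C_infinity_Cauchy_euler: "C_infinity_Cauchy euler"
  unfolding C_infinity_Cauchy_def
proof (intro conjI allI impI)
  fix r and e :: real assume "0 < e"
  then obtain N0 where N0: "N0 > 0" "\<And>N m. N \<ge> N0 \<Longrightarrow> m > 0 \<Longrightarrow> Cr_bounded r (e / 2) (\<lambda>x. euler (N * m) x - euler N x)"
    using euler_refine[of "e / 2" r] by auto
  have "Cr_bounded r e (\<lambda>x. euler m x - euler n x)" if "m \<ge> N0" "n \<ge> N0" for m n
  proof -
    have "Cr_bounded r (e / 2 + e / 2)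
      (\<lambda>x. (euler (n * m) x - euler n x) - (euler (m * n) x - euler m x))"
      using that N0 by (intro Cr_bounded_diff) auto
    then show ?thesis by (simp add: mult.commute)
  qed
  then show "\<exists>N. \<forall>m\<ge>N. \<forall>n\<ge>N. Cr_bounded r e (\<lambda>x. euler m x - euler n x)" by blast
qed (rule euler_bounded)

definition flow :: "'a \<Rightarrow> 'a" where "flow x = lim (\<lambda>n. euler n x)"

lemma C_infinity_limit_flow: "C_infinity_limit euler flow"
  using Ccauchy_imp_C_infinity_limit[OF C_infinity_Cauchy_euler] by (simp add: flow_def[abs_def])

lemma flow_bounded: "\<exists>M. Cr_bounded r M flow"
proof -
  have "\<forall>\<^sub>F n in sequentially. Cr_bounded r 1 (\<lambda>x. euler n x - flow x)"
    using C_infinity_limit_flow unfolding C_infinity_limit_def by simp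
  then obtain n where n: "Cr_bounded r 1 (\<lambda>x. euler n x - flow x)"
    by (meson eventually_happens sequentially_bot)
  obtain M where "Cr_bounded r M (euler n)" using euler_bounded by blast
  from Cr_bounded_diff[OF this n] show ?thesis by auto
qed

text \<open>An error \<open>e * s\<close> in a step of length \<open>s\<close> accumulates to a
  multiple of \<open>e\<close> over unit time. The predicate \<open>P\<close> stays abstract: only
  membership of each factor is recorded, and products are dealt with where \<open>P\<close> is
  known.\<close>

lemma flow_approx:
  assumes approx: "\<And>r e. 0 < e \<Longrightarrow> \<exists>t0>0. \<forall>t\<in>{0..1}. \<forall>s. 0 < s \<longrightarrow> s \<le> t0 \<longrightarrow>
      (\<exists>g. P g \<and> Cr_bounded r (e * s) (\<lambda>x. g x - s *\<^sub>R X t x))"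
    and "0 < e"
  shows "\<exists>u n. (\<forall>k<n. P (u k)) \<and> Cr_bounded r e (\<lambda>x. displacement_prod u n x - flow x)"
proof -
  obtain M where M: "0 \<le> M" "\<And>t. t \<in> {0..1} \<Longrightarrow> Cr_bounded (Suc r) M (X t)"
    using bounded_family_nonneg[of "Suc r"] by blast
  define M' where "M' = M + 1"
  have M': "0 \<le> M'" "M \<le> M'" using M(1) by (auto simp: M'_def)
  obtain D where D: "0 \<le> D" "\<And>(u :: nat \<Rightarrow> 'a \<Rightarrow> 'a) v h n e.
    0 \<le> h \<Longrightarrow> real n * h \<le> 1 \<Longrightarrow> 0 \<le> e \<Longrightarrow> (\<And>k. k < n \<Longrightarrow> Cr_bounded r (M' * h) (u k)) \<Longrightarrow>
    (\<And>k. k < n \<Longrightarrow> Cr_bounded (Suc r) (M' * h) (v k)) \<Longrightarrow> (\<And>k. k < n \<Longrightarrow> Cr_bounded r (e * h) (\<lambda>x. u k x - v k x)) \<Longrightarrow>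
    Cr_bounded r (D * e) (\<lambda>x. displacement_prod u n x - displacement_prod v n x)"
    using displacement_prod_compare[OF M'(1), of r] by blast
  \<comment> \<open>The cap 1 keeps the replacing factors within \<open>M' = M + 1\<close> times the
    step length; the other bound limits the Gronwall error to \<open>e / 2\<close>, and the other
    half is spent on the distance from the Euler map to the flow.\<close>
  define d where "d = min 1 (e / (2 * (D + 1)))"
  have d: "0 < d" "d \<le> 1" "D * d \<le> e / 2"
  proof -
    have "D * d \<le> D * (e / (2 * (D + 1)))" using D by (intro mult_left_mono) (auto simp: d_def)
    also have "\<dots> \<le> e / 2" using D assms(2) by (simp add: field_simps)
    finally show "D * d \<le> e / 2" .
  qed (use D assms(2) in \<open>auto simp: d_def\<close>)
  obtain t0 where t0: "t0 > 0" "\<And>t s. t \<in> {0..1} \<Longrightarrow> 0 < s \<Longrightarrow> s \<le> t0 \<Longrightarrow>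
      (\<exists>g. P g \<and> Cr_bounded r (d * s) (\<lambda>x. g x - s *\<^sub>R X t x))"
    using approx[OF d(1)] by blast
  have "\<forall>\<^sub>F n in sequentially. Cr_bounded r (e / 2) (\<lambda>x. euler n x - flow x)"
    using C_infinity_limit_flow assms(2) unfolding C_infinity_limit_def by simp
  moreover have "\<forall>\<^sub>F n in sequentially. 1 / real n < t0"
    using t0(1) by (metis order_tendstoD(2) lim_1_over_n)
  moreover have "\<forall>\<^sub>F n in sequentially. n > 0" by (rule eventually_gt_at_top)
  ultimately have "\<forall>\<^sub>F n in sequentially. Cr_bounded r (e / 2) (\<lambda>x. euler n x - flow x) \<and> 1 / real n < t0 \<and> n > 0"
    by eventually_elim auto
  then obtain n where n: "Cr_bounded r (e / 2) (\<lambda>x. euler n x - flow x)" "1 / real n < t0" "n > 0"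
    using eventually_happens'[OF sequentially_bot] by blast
  have "\<exists>g. P g \<and> Cr_bounded r (d * (1 / real n)) (\<lambda>x. g x - (1 / real n) *\<^sub>R X (real k / real n) x)" if "k < n" for k
    using that n by (intro t0) auto
  then obtain u where u: "\<And>k. k < n \<Longrightarrow> P (u k)"
    "\<And>k. k < n \<Longrightarrow> Cr_bounded r (d * (1 / real n)) (\<lambda>x. u k x - (1 / real n) *\<^sub>R X (real k / real n) x)"
    by metis
  let ?v = "\<lambda>k x. (1 / real n) *\<^sub>R X (real k / real n) x"
  have v: "Cr_bounded (Suc r) (M * (1 / real n)) (?v k)" if "k < n" for k
    using that by (intro Cr_bounded_scaled M) auto
  have "Cr_bounded r (D * d) (\<lambda>x. displacement_prod u n x - displacement_prod ?v n x)"
  proof (rule D(2)[where h = "1 / real n"])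
    fix k assume k: "k < n"
    show "Cr_bounded (Suc r) (M' * (1 / real n)) (?v k)"
      using M' v[OF k] by (auto elim!: Cr_bounded_mono intro!: divide_right_mono)
    have "Cr_bounded r (d * (1 / real n) + M * (1 / real n)) (\<lambda>x. (u k x - ?v k x) + ?v k x)"
      using k by (intro Cr_bounded_add u Cr_bounded_SucD[OF v]) auto
    moreover have "d * (1 / real n) + M * (1 / real n) \<le> M' * (1 / real n)"
      using d n(3) by (simp add: M'_def divide_right_mono add_divide_distrib[symmetric])
    ultimately show "Cr_bounded r (M' * (1 / real n)) (u k)" by (simp add: Cr_bounded_mono)
  qed (use d n u in auto)
  from Cr_bounded_add[OF Cr_bounded_mono[OF this d(3)] n(1)[unfolded euler_def]] u(1) show ?thesis by auto
qed

text \<open>The classical error estimate of the Euler polygon against a given solution: a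
  consistency error of \<open>2 * om * h\<close> per step, amplified by at most
  \<open>exp L\<close>. Only norms at a point enter, as the smoothness of the limit is settled
  separately.\<close>

lemma euler_tendsto:
  assumes c: "\<And>u. u \<in> {0..1} \<Longrightarrow> (c has_vector_derivative X u (c u)) (at u within {0..1})"
  shows "(\<lambda>N. euler N (c 0)) \<longlonglongrightarrow> c 1 - c 0"
proof (rule LIMSEQ_I)
  fix e :: real assume e: "0 < e"
  obtain M where M: "0 \<le> M" "\<And>t. t \<in> {0..1} \<Longrightarrow> Cr_bounded (Suc 0) M (X t)"
    using bounded_family_nonneg[of "Suc 0"] by blast
  define L where "L = real DIM('a) * M"
  have L: "0 \<le> L" "\<And>t x y. t \<in> {0..1} \<Longrightarrow> norm (X t x - X t y) \<le> L * norm (x - y)"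
    using M(1) Cr_bounded_lipschitz[OF M(2)] unfolding L_def by auto
  \<comment> \<open>The final error is \<open>exp L * (2 * om)\<close>, that is
    \<open>e / 2\<close>.\<close>
  define om where "om = e / (4 * exp L)"
  have om: "0 < om" using e by (simp add: om_def)
  obtain d where d: "d > 0" "\<And>s t x. s \<in> {0..1} \<Longrightarrow> t \<in> {0..1} \<Longrightarrow> \<bar>s - t\<bar> < d \<Longrightarrow> norm (X s x - X t x) \<le> om"
    using ucont_family[OF om, of 0] by auto
  have lip: "norm (c s - c t) \<le> M * \<bar>s - t\<bar>" if "s \<in> {0..1}" "t \<in> {0..1}" for s t
  proof -
    have "norm (c s - c t) \<le> M * norm (s - t)"
    proof (rule differentiable_bound[of "{0..1}"])
      fix u :: real assume u: "u \<in> {0..1}"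
      show "(c has_derivative (\<lambda>h. h *\<^sub>R X u (c u))) (at u within {0..1})"
        using c[OF u] by (simp add: has_vector_derivative_def)
      show "onorm (\<lambda>h. h *\<^sub>R X u (c u)) \<le> M"
        using Cr_bounded_norm[OF M(2)[OF u], of "c u"] M(1)
        by (intro onorm_le) (simp add: mult.commute[of M] mult_left_mono)
    qed (use that in auto)
    then show ?thesis by simp
  qed
  obtain N0 where N0: "1 / d < real N0" "L * M / om < real N0"
  proof -
    obtain N1 where "max (1 / d) (L * M / om) < real N1" using reals_Archimedean2 by blast
    then show ?thesis using that[of N1] by auto
  qed
  have "norm (euler N (c 0) - (c 1 - c 0)) < e" if "N \<ge> N0" for N
  proof -
    have Npos: "0 < N" and Nd: "1 / real N < d" and NC: "L * M * (1 / real N) \<le> om"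
    proof -
      have 0: "real N0 \<le> real N" using that by simp
      then have 1: "1 / d < real N" "L * M / om < real N" using N0 by linarith+
      moreover have "0 < 1 / d" using d by simp
      ultimately show "0 < N" by (metis less_trans of_nat_0_less_iff)
      show "1 / real N < d" using 1(1) \<open>0 < N\<close> d(1) by (simp add: field_simps)
      show "L * M * (1 / real N) \<le> om" using 1(2) \<open>0 < N\<close> om by (simp add: field_simps)
    qed
    define h where "h = 1 / real N"
    have h: "0 < h" "real N * h = 1" using Npos by (auto simp: h_def)
    let ?v = "\<lambda>k x. (1 / real N) *\<^sub>R X (real k / real N) x"
    have step: "norm (c (real (Suc k) * h) - c (real k * h) - h *\<^sub>R X (real k * h) (c (real k * h))) \<le> h * (2 * om)"
      if "k < N" for k
    proof -
      let ?a = "real k * h" and ?b = "real (Suc k) * h"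
      have "real (Suc k) * h \<le> real N * h" using that h by (intro mult_right_mono) auto
      then have ab: "0 \<le> ?a" "?a \<le> ?b" "?b \<le> 1" "?b - ?a = h" using h by (auto simp: algebra_simps)
      have "norm (c ?b - c ?a - (?b - ?a) *\<^sub>R X ?a (c ?a)) \<le> norm (?b - ?a) * (2 * om)"
      proof (rule vector_differentiable_bound_linearization[of "{?a..?b}"])
        fix u assume u: "u \<in> {?a..?b}"
        then have u01: "u \<in> {0..1}" using ab unfolding atLeastAtMost_iff by linarith
        show "(c has_vector_derivative X u (c u)) (at u within {?a..?b})"
          by (rule has_vector_derivative_within_subset[OF c[OF u01]]) (use ab in auto)
        have "norm (X u (c u) - X ?a (c u)) \<le> om"
          using u u01 ab Nd by (intro d) (auto simp: h_def)
        moreover have "norm (X ?a (c u) - X ?a (c ?a)) \<le> L * (M * \<bar>u - ?a\<bar>)"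
          using order_trans[OF L(2) mult_left_mono[OF lip L(1)]] u01 ab by auto
        moreover have "L * (M * \<bar>u - ?a\<bar>) \<le> L * (M * h)"
          using L(1) M(1) u ab by (intro mult_left_mono) auto
        moreover have "L * (M * h) \<le> om" using NC by (simp add: h_def)
        ultimately show "norm (X u (c u) - X ?a (c ?a)) \<le> 2 * om"
          by (smt (verit) norm_triangle_ineq4 norm_diff_triangle_le)
      qed (use ab in \<open>auto simp: closed_segment_eq_real_ivl\<close>)
      then show ?thesis using ab h by simp
    qed
    have "norm (c (real k * h) - (c 0 + displacement_prod ?v k (c 0))) \<le> exp (L * (real k * h)) * (2 * om * (real k * h))"
      if "k \<le> N" for k
      using that
    proof (induction k)
      case (Suc k)
      let ?a = "real k * h" and ?b = "real (Suc k) * h"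
      let ?y = "c 0 + displacement_prod ?v k (c 0)"
      let ?E = "exp (L * ?a) * (2 * om * ?a)"
      have a01: "?a \<in> {0..1}"
        using Suc.prems h mult_right_mono[of "real k" "real N" h] by auto
      have "c ?b - (c 0 + displacement_prod ?v (Suc k) (c 0)) =
          (c ?b - c ?a - h *\<^sub>R X ?a (c ?a)) + ((c ?a - ?y) + h *\<^sub>R (X ?a (c ?a) - X ?a ?y))"
        by (simp add: h_def algebra_simps)
      moreover have "norm (h *\<^sub>R (X ?a (c ?a) - X ?a ?y)) \<le> h * (L * ?E)"
      proof -
        have "norm (X ?a (c ?a) - X ?a ?y) \<le> L * ?E"
          using order_trans[OF L(2)[OF a01] mult_left_mono[OF Suc.IH L(1)]] Suc.prems by simp
        then show ?thesis using h by simp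
      qed
      ultimately have "norm (c ?b - (c 0 + displacement_prod ?v (Suc k) (c 0))) \<le> h * (2 * om) + (?E + h * (L * ?E))"
      proof (simp only:, intro norm_triangle_mono)
        show "norm (c ?b - c ?a - h *\<^sub>R X ?a (c ?a)) \<le> h * (2 * om)" using step Suc.prems by simp
        show "norm (c ?a - ?y) \<le> ?E" using Suc by simp
      qed
      also have "\<dots> \<le> exp (L * ?b) * (2 * om * ?b)"
      proof -
        have "?E + h * (L * ?E) = exp (L * ?a) * (1 + L * h) * (2 * om * ?a)" by (simp add: algebra_simps)
        also have "\<dots> \<le> exp (L * ?a + L * h) * (2 * om * ?a)"
          using h om by (intro mult_right_mono exp_times_one_plus_le) auto
        also have "L * ?a + L * h = L * ?b" by (simp add: algebra_simps)
        finally have 1: "?E + h * (L * ?E) \<le> exp (L * ?b) * (2 * om * ?a)" .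
        have "1 * (2 * om * h) \<le> exp (L * ?b) * (2 * om * h)"
          using h om L by (intro mult_right_mono) auto
        with 1 show ?thesis by (simp add: algebra_simps)
      qed
      finally show ?case .
    qed auto
    from this[of N] have "norm (c 1 - (c 0 + displacement_prod ?v N (c 0))) \<le> exp L * (2 * om)" using h by simp
    also have "\<dots> < e" using e by (simp add: om_def)
    finally show ?thesis
      unfolding euler_def by (simp add: norm_minus_commute algebra_simps)
  qed
  then show "\<exists>N0. \<forall>N\<ge>N0. norm (euler N (c 0) - (c 1 - c 0)) < e" by blast
qed

text \<open>Uniqueness of limits: the Euler maps converge to \<open>flow\<close> by construction and
  to the displacement of every solution by consistency.\<close>

lemma flow_solution:
  assumes "\<And>u. u \<in> {0..1} \<Longrightarrow> (c has_vector_derivative X u (c u)) (at u within {0..1})"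
  shows "c 1 = c 0 + flow (c 0)"
  using euler_tendsto[OF assms] C_infinity_Cauchy_tendsto[OF C_infinity_Cauchy_euler, of "c 0"] LIMSEQ_unique
  unfolding flow_def by fastforce

end

section \<open>Expansions in a small parameter\<close>

definition bounded_smooth :: "('a::euclidean_space \<Rightarrow> 'b::real_normed_vector) \<Rightarrow> bool" where
  "bounded_smooth f \<longleftrightarrow> (\<forall>r. \<exists>M. Cr_bounded r M f)"

text \<open>The notion O(t^j) in order \<open>r\<close> for t tending to 0, taken on [0, 1] so that
  a higher power of \<open>t\<close> implies a lower one.\<close>

definition Cr_big_O :: "nat \<Rightarrow> nat \<Rightarrow> (real \<Rightarrow> 'a::euclidean_space \<Rightarrow> 'b::real_normed_vector) \<Rightarrow> bool" where
  "Cr_big_O r j F \<longleftrightarrow> (\<exists>K\<ge>0. \<forall>t\<in>{0..1}. Cr_bounded r (K * t ^ j) (F t))"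

lemma bounded_smooth_differentiable: "bounded_smooth f \<Longrightarrow> f differentiable (at x)"
  unfolding bounded_smooth_def by (meson Cr_bounded_differentiable)

lemma bounded_smooth_smooth: "bounded_smooth f \<Longrightarrow> smooth f"
  unfolding bounded_smooth_def by (rule Cr_bounded_imp_smooth) (erule spec)

lemma bounded_smooth_pd: "bounded_smooth f \<Longrightarrow> b \<in> Basis \<Longrightarrow> bounded_smooth (pd b f)"
  unfolding bounded_smooth_def by (meson Cr_bounded_pd)

lemma bounded_smooth_const: "bounded_smooth (\<lambda>x. c)"
  unfolding bounded_smooth_def using Cr_bounded_const by blast

lemma bounded_smooth_add: "bounded_smooth f \<Longrightarrow> bounded_smooth g \<Longrightarrow> bounded_smooth (\<lambda>x. f x + g x)"
  unfolding bounded_smooth_def using Cr_bounded_add by blast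

lemma bounded_smooth_diff: "bounded_smooth f \<Longrightarrow> bounded_smooth g \<Longrightarrow> bounded_smooth (\<lambda>x. f x - g x)"
  unfolding bounded_smooth_def using Cr_bounded_diff by blast

lemma bounded_smooth_minus: "bounded_smooth f \<Longrightarrow> bounded_smooth (\<lambda>x. - f x)"
  unfolding bounded_smooth_def using Cr_bounded_minus by blast

lemma bounded_smooth_mult: "bounded_smooth f \<Longrightarrow> bounded_smooth g \<Longrightarrow> bounded_smooth (\<lambda>x. f x * g x :: real)"
  unfolding bounded_smooth_def using Cr_bounded_mult by blast

lemma bounded_smooth_scaleR: "bounded_smooth f \<Longrightarrow> bounded_smooth g \<Longrightarrow> bounded_smooth (\<lambda>x. f x *\<^sub>R g x)"
  unfolding bounded_smooth_def using Cr_bounded_scaleR by blast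

lemma bounded_smooth_sum: "finite I \<Longrightarrow> (\<And>i. i \<in> I \<Longrightarrow> bounded_smooth (f i)) \<Longrightarrow> bounded_smooth (\<lambda>x. \<Sum>i\<in>I. f i x)"
  by (induction I rule: finite_induct) (auto intro: bounded_smooth_const bounded_smooth_add)

lemma bounded_smooth_displaced:
  fixes u :: "'a::euclidean_space \<Rightarrow> 'b::real_normed_vector"
  assumes "bounded_smooth u" "bounded_smooth w" shows "bounded_smooth (\<lambda>x. u (x + w x))"
  unfolding bounded_smooth_def
proof
  fix r
  obtain M R where "Cr_bounded r M u" "Cr_bounded r R w" using assms unfolding bounded_smooth_def by blast
  moreover then have "0 \<le> R" using Cr_bounded_nonneg by blast
  ultimately show "\<exists>M. Cr_bounded r M (\<lambda>x. u (x + w x))"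
    using Cr_bounded_displaced[of R, where r = r and 'b = 'b and 'a = 'a] by blast
qed

lemma bounded_smooth_cos_inner: "bounded_smooth (\<lambda>x :: 'a::euclidean_space. cos (l \<bullet> x + c))"
proof -
  \<comment> \<open>The phase \<open>c\<close> has to vary: differentiating a cosine shifts it by
    \<open>pi / 2\<close>.\<close>
  have "Cr_bounded r ((1 + norm l) ^ r) (\<lambda>x :: 'a. cos (l \<bullet> x + c))" for r c
  proof (induction r arbitrary: c)
    case (Suc r)
    have d: "((\<lambda>x. cos (l \<bullet> x + c)) has_derivative (\<lambda>h. - sin (l \<bullet> x + c) * (l \<bullet> h))) (at x)" for x
      by (auto intro!: derivative_eq_intros)
    have dd: "(\<lambda>x. cos (l \<bullet> x + c)) differentiable (at x)" for x
      using d by (rule differentiableI)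
    have p: "pd b (\<lambda>x. cos (l \<bullet> x + c)) = (\<lambda>x. (l \<bullet> b) * cos (l \<bullet> x + (c + pi / 2)))" for b
    proof
      fix x show "pd b (\<lambda>x. cos (l \<bullet> x + c)) x = (l \<bullet> b) * cos (l \<bullet> x + (c + pi / 2))"
        using pd_eqI[OF d[of x], of b] by (simp add: minus_sin_cos_eq add.assoc)
    qed
    have "Cr_bounded r (\<bar>l \<bullet> b\<bar> * (1 + norm l) ^ r) (pd b (\<lambda>x. cos (l \<bullet> x + c)))" for b
      unfolding p by (intro Cr_bounded_mult_const Suc.IH)
    moreover have "\<bar>l \<bullet> b\<bar> * (1 + norm l) ^ r \<le> (1 + norm l) ^ Suc r" if "b \<in> Basis" for b
      using Basis_le_norm[OF that, of l] by (auto intro!: mult_right_mono)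
    moreover have "\<bar>cos (l \<bullet> x + c)\<bar> \<le> (1 + norm l) ^ Suc r" for x
      by (rule order_trans[OF abs_cos_le_one]) (simp del: power_Suc)
    ultimately show ?case
      by (intro Cr_bounded_SucI dd) (auto intro: Cr_bounded_mono simp del: power_Suc)
  qed auto
  then show ?thesis unfolding bounded_smooth_def by blast
qed

lemma bounded_smooth_sin_inner: "bounded_smooth (\<lambda>x :: 'a::euclidean_space. sin (l \<bullet> x + c))"
proof -
  have "sin (l \<bullet> x + c) = cos (l \<bullet> x + (c - pi / 2))" for x
    using cos_diff[of "l \<bullet> x + c" "pi / 2"] by (simp add: add_diff_eq)
  then show ?thesis using bounded_smooth_cos_inner[of l "c - pi / 2"] by simp
qed

lemma Cr_big_OI: "0 \<le> K \<Longrightarrow> (\<And>t. 0 \<le> t \<Longrightarrow> t \<le> 1 \<Longrightarrow> Cr_bounded r (K * t ^ j) (F t)) \<Longrightarrow> Cr_big_O r j F"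
  unfolding Cr_big_O_def by auto

lemma Cr_big_OE:
  "Cr_big_O r j F \<Longrightarrow> \<exists>K\<ge>0. \<forall>t. 0 \<le> t \<longrightarrow> t \<le> 1 \<longrightarrow> Cr_bounded r (K * t ^ j) (F t)"
  unfolding Cr_big_O_def by auto

text \<open>Each direction brings a constant of its own; their sum together with \<open>K\<close>
  serves all of them.\<close>

lemma Cr_big_O_SucI:
  fixes F :: "real \<Rightarrow> 'a::euclidean_space \<Rightarrow> 'b::real_normed_vector"
  assumes "0 \<le> K" "\<And>t x. 0 \<le> t \<Longrightarrow> t \<le> 1 \<Longrightarrow> norm (F t x) \<le> K * t ^ j"
    and "\<And>t x. F t differentiable (at x)"
    and "\<And>b. b \<in> Basis \<Longrightarrow> Cr_big_O r j (\<lambda>t. pd b (F t))"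
  shows "Cr_big_O (Suc r) j F"
proof -
  have "\<exists>K. \<forall>b\<in>Basis. 0 \<le> K b \<and> (\<forall>t\<in>{0..1}. Cr_bounded r (K b * t ^ j) (pd b (F t)))"
    using assms(4) unfolding Cr_big_O_def by (intro bchoice) blast
  then obtain Kb where Kb: "\<And>b. b \<in> Basis \<Longrightarrow> 0 \<le> Kb b"
    "\<And>b t. b \<in> Basis \<Longrightarrow> t \<in> {0..1} \<Longrightarrow> Cr_bounded r (Kb b * t ^ j) (pd b (F t))" by blast
  let ?K = "K + (\<Sum>b\<in>Basis. Kb b)"
  have le: "Kb b \<le> ?K" if "b \<in> Basis" for b
    using member_le_sum[of b Basis Kb] that Kb(1) assms(1) by auto
  have 0: "0 \<le> (\<Sum>b\<in>Basis. Kb b)" using Kb(1) by (simp add: sum_nonneg)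
  show ?thesis
  proof (rule Cr_big_OI[of ?K])
    fix t :: real assume t: "0 \<le> t" "t \<le> 1"
    show "Cr_bounded (Suc r) (?K * t ^ j) (F t)"
    proof (rule Cr_bounded_SucI)
      show "norm (F t x) \<le> ?K * t ^ j" for x
        using order_trans[OF assms(2)[OF t] mult_right_mono[of K ?K "t ^ j"]] 0 t by simp
      show "Cr_bounded r (?K * t ^ j) (pd b (F t))" if "b \<in> Basis" for b
      proof (rule Cr_bounded_mono)
        show "Cr_bounded r (Kb b * t ^ j) (pd b (F t))" using t by (intro Kb(2) that) simp
        show "Kb b * t ^ j \<le> ?K * t ^ j" using t le[OF that] by (intro mult_right_mono) auto
      qed
    qed (rule assms(3))
  qed (use 0 assms(1) in simp)
qed

lemma Cbig_bounded_smooth: "bounded_smooth h \<Longrightarrow> Cr_big_O r 0 (\<lambda>t. h)"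
proof -
  assume "bounded_smooth h"
  then obtain M where "Cr_bounded r M h" unfolding bounded_smooth_def by blast
  moreover from this have "0 \<le> M" by (rule Cr_bounded_nonneg)
  ultimately show ?thesis by (intro Cr_big_OI[of M]) auto
qed

lemma Cr_big_O_cmult:
  assumes "Cr_big_O r j F"
  shows "Cr_big_O r (Suc j) (\<lambda>t x. t *\<^sub>R F t x)"
proof -
  obtain K where K: "0 \<le> K" "\<And>t. 0 \<le> t \<Longrightarrow> t \<le> 1 \<Longrightarrow> Cr_bounded r (K * t ^ j) (F t)"
    using Cr_big_OE[OF assms] by blast
  show ?thesis
  proof (rule Cr_big_OI[OF K(1)])
    fix t :: real assume t: "0 \<le> t" "t \<le> 1"
    show "Cr_bounded r (K * t ^ Suc j) (\<lambda>x. t *\<^sub>R F t x)"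
      using Cr_bounded_scaleR_const[OF K(2)[OF t], of t] t by (simp add: mult_ac)
  qed
qed

lemma Cr_big_O_scaleR:
  fixes F :: "real \<Rightarrow> 'a::euclidean_space \<Rightarrow> real"
  assumes "Cr_big_O r i F" "Cr_big_O r j G"
  shows "Cr_big_O r (i + j) (\<lambda>t x. F t x *\<^sub>R G t x)"
proof -
  obtain K where K: "0 \<le> K" "\<And>t. 0 \<le> t \<Longrightarrow> t \<le> 1 \<Longrightarrow> Cr_bounded r (K * t ^ i) (F t)"
    using Cr_big_OE[OF assms(1)] by blast
  obtain L where L: "0 \<le> L" "\<And>t. 0 \<le> t \<Longrightarrow> t \<le> 1 \<Longrightarrow> Cr_bounded r (L * t ^ j) (G t)"
    using Cr_big_OE[OF assms(2)] by blast
  show ?thesis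
  proof (rule Cr_big_OI[of "2 ^ r * K * L"])
    fix t :: real assume t: "0 \<le> t" "t \<le> 1"
    show "Cr_bounded r (2 ^ r * K * L * t ^ (i + j)) (\<lambda>x. F t x *\<^sub>R G t x)"
      using Cr_bounded_scaleR[OF K(2)[OF t] L(2)[OF t]] by (simp add: power_add mult_ac)
  qed (use K L in auto)
qed

lemma Cr_big_O_mult:
  fixes F :: "real \<Rightarrow> 'a::euclidean_space \<Rightarrow> real"
  shows "Cr_big_O r i F \<Longrightarrow> Cr_big_O r j G \<Longrightarrow> Cr_big_O r (i + j) (\<lambda>t x. F t x * G t x)"
  using Cr_big_O_scaleR[of r i F j G] by simp

lemma Cr_big_O_add:
  assumes "Cr_big_O r j F" "Cr_big_O r j G"
  shows "Cr_big_O r j (\<lambda>t x. F t x + G t x)"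
proof -
  obtain K where K: "0 \<le> K" "\<And>t. 0 \<le> t \<Longrightarrow> t \<le> 1 \<Longrightarrow> Cr_bounded r (K * t ^ j) (F t)"
    using Cr_big_OE[OF assms(1)] by blast
  obtain L where L: "0 \<le> L" "\<And>t. 0 \<le> t \<Longrightarrow> t \<le> 1 \<Longrightarrow> Cr_bounded r (L * t ^ j) (G t)"
    using Cr_big_OE[OF assms(2)] by blast
  show ?thesis
  proof (rule Cr_big_OI[of "K + L"])
    fix t :: real assume t: "0 \<le> t" "t \<le> 1"
    show "Cr_bounded r ((K + L) * t ^ j) (\<lambda>x. F t x + G t x)"
      using Cr_bounded_add[OF K(2)[OF t] L(2)[OF t]] by (simp add: algebra_simps)
  qed (use K L in auto)
qed

lemma Cr_big_O_minus: "Cr_big_O r j F \<Longrightarrow> Cr_big_O r j (\<lambda>t x. - F t x)"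
  unfolding Cr_big_O_def using Cr_bounded_minus by blast

lemma Cr_big_O_sum:
  "finite I \<Longrightarrow> (\<And>i. i \<in> I \<Longrightarrow> Cr_big_O r j (F i)) \<Longrightarrow> Cr_big_O r j (\<lambda>t x. \<Sum>i\<in>I. F i t x)"
proof (induction I rule: finite_induct)
  case empty
  show ?case by (rule Cr_big_OI[of 0]) (auto intro: Cr_bounded_const)
qed (auto intro: Cr_big_O_add)

lemma Cr_big_O_le:
  assumes "Cr_big_O r (Suc j) F"
  shows "Cr_big_O r j F"
proof -
  obtain K where K: "0 \<le> K" "\<And>t. 0 \<le> t \<Longrightarrow> t \<le> 1 \<Longrightarrow> Cr_bounded r (K * t ^ Suc j) (F t)"
    using Cr_big_OE[OF assms] by blast
  show "Cr_big_O r j F"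
  proof (rule Cr_big_OI[OF K(1)])
    fix t :: real assume t: "0 \<le> t" "t \<le> 1"
    show "Cr_bounded r (K * t ^ j) (F t)"
      using t K(1) by (intro Cr_bounded_mono[OF K(2)[OF t]] mult_left_mono power_decreasing) auto
  qed
qed

section \<open>Taylor remainders of sine and cosine in every order\<close>

lemma abs_cos_minus_one_le: "\<bar>cos u - 1\<bar> \<le> u\<^sup>2" for u :: real
proof -
  have "cos u = 1 - 2 * (sin (u / 2))\<^sup>2" using cos_double_sin[of "u / 2"] by simp
  moreover have "(sin (u / 2))\<^sup>2 \<le> (u / 2)\<^sup>2"
    by (rule abs_le_square_iff[THEN iffD1, OF abs_sin_x_le_abs_x])
  moreover have "(u / 2)\<^sup>2 = u\<^sup>2 / 4" by (simp add: power_divide)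
  moreover have "0 \<le> u\<^sup>2" "0 \<le> (sin (u / 2))\<^sup>2" by simp_all
  ultimately show ?thesis by linarith
qed

lemma abs_sin_minus_le: "\<bar>sin u - u\<bar> \<le> u\<^sup>2" for u :: real
proof -
  have "(\<Sum>m<2. sin_coeff m * u ^ m) = u" by (simp add: numeral_2_eq_2 sin_coeff_def)
  then have "\<bar>sin u - u\<bar> \<le> u\<^sup>2 / 2" using Maclaurin_sin_bound[of u 2] by simp
  then show ?thesis by (smt (verit) zero_le_power2 field_sum_of_halves)
qed

lemma abs_cos_quadratic_le: "\<bar>cos u - 1 + u\<^sup>2 / 2\<bar> \<le> \<bar>u\<bar> ^ 3" for u :: real
proof -
  let ?s = "sin (u / 2)"
  \<comment> \<open>The half-angle formula leaves a difference of squares, whose factors are of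
    second and of first order in \<open>u\<close>.\<close>
  have "cos u - 1 + u\<^sup>2 / 2 = 2 * ((u / 2 - ?s) * (u / 2 + ?s))"
    using cos_double_sin[of "u / 2"] by (simp add: algebra_simps power2_eq_square)
  moreover have "\<bar>u / 2 - ?s\<bar> \<le> (u / 2)\<^sup>2" using abs_sin_minus_le[of "u / 2"] by (simp add: abs_minus_commute)
  moreover have "\<bar>u / 2 + ?s\<bar> \<le> \<bar>u\<bar>"
    using abs_triangle_ineq[of "u / 2" ?s] abs_sin_x_le_abs_x[of "u / 2"] by simp
  ultimately have "\<bar>cos u - 1 + u\<^sup>2 / 2\<bar> \<le> 2 * ((u / 2)\<^sup>2 * \<bar>u\<bar>)"
    by (simp add: abs_mult mult_mono)
  also have "\<dots> = \<bar>u\<bar> ^ 3 / 2"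
  proof -
    have "\<bar>u\<bar> ^ 3 = u\<^sup>2 * \<bar>u\<bar>" by (simp add: power3_eq_cube power2_eq_square)
    then show ?thesis by (simp add: power_divide)
  qed
  also have "\<dots> \<le> \<bar>u\<bar> ^ 3" by simp
  finally show ?thesis .
qed

context
  fixes z :: "'a::euclidean_space \<Rightarrow> real"
  assumes z: "bounded_smooth z"
begin

lemma bounded_smooth_abs_le: "\<exists>K\<ge>0. \<forall>x. \<bar>z x\<bar> \<le> K"
  using z unfolding bounded_smooth_def by (metis Cr_bounded_nonneg Cr_bounded_norm real_norm_def)

lemma bounded_smooth_power_le: "\<exists>K\<ge>0. \<forall>t x. 0 \<le> t \<longrightarrow> \<bar>t * z x\<bar> ^ j \<le> K * t ^ j"
proof -
  obtain K where K: "K \<ge> 0" "\<And>x. \<bar>z x\<bar> \<le> K" using bounded_smooth_abs_le by blast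
  have "\<bar>t * z x\<bar> ^ j \<le> K ^ j * t ^ j" if "0 \<le> t" for t x
  proof -
    have "\<bar>t * z x\<bar> ^ j \<le> (t * K) ^ j"
      using that K by (intro power_mono) (auto simp: abs_mult intro: mult_left_mono)
    then show ?thesis by (simp add: power_mult_distrib mult.commute)
  qed
  with K(1) show ?thesis by (intro exI[of _ "K ^ j"]) auto
qed

lemma bounded_smooth_has_derivative: "(z has_derivative (\<lambda>h. pd h z x)) (at x)"
  using z by (intro has_derivative_pd' bounded_smooth_differentiable)

text \<open>Differentiating either function yields, up to sign, \<open>t\<close> times a derivative
  of \<open>z\<close> times the other one, so the two estimates share one induction.\<close>

lemma Cr_big_O_sin_cos_0: "Cr_big_O r (Suc 0) (\<lambda>t x. sin (t * z x)) \<and> Cr_big_O r 0 (\<lambda>t x. cos (t * z x))"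
proof (induction r)
  case 0
  obtain K where K: "K \<ge> 0" "\<And>t x. 0 \<le> t \<Longrightarrow> \<bar>t * z x\<bar> ^ 1 \<le> K * t ^ 1" using bounded_smooth_power_le[of 1] by blast
  have "\<bar>sin (t * z x)\<bar> \<le> K * t" if "0 \<le> t" for t x
    using order_trans[OF abs_sin_x_le_abs_x, of "t * z x"] K(2)[OF that, of x] by simp
  with K(1) have "Cr_big_O 0 (Suc 0) (\<lambda>t x. sin (t * z x))" by (intro Cr_big_OI[of K]) auto
  moreover have "Cr_big_O 0 0 (\<lambda>t x. cos (t * z x))" by (intro Cr_big_OI[of 1]) auto
  ultimately show ?case ..
next
  case (Suc r)
  obtain K where K: "K \<ge> 0" "\<And>t x. 0 \<le> t \<Longrightarrow> \<bar>t * z x\<bar> ^ 1 \<le> K * t ^ 1" using bounded_smooth_power_le[of 1] by blast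
  have "\<bar>sin (t * z x)\<bar> \<le> K * t" if "0 \<le> t" for t x
    using order_trans[OF abs_sin_x_le_abs_x, of "t * z x"] K(2)[OF that, of x] by simp
  have ds: "((\<lambda>x. sin (t * z x)) has_derivative (\<lambda>h. t *\<^sub>R (pd h z x * cos (t * z x)))) (at x)"
    and dc: "((\<lambda>x. cos (t * z x)) has_derivative (\<lambda>h. - t *\<^sub>R (pd h z x * sin (t * z x)))) (at x)" for t x
    by (auto intro!: derivative_eq_intros bounded_smooth_has_derivative)
  have ps: "pd b (\<lambda>x. sin (t * z x)) = (\<lambda>x. t *\<^sub>R (pd b z x * cos (t * z x)))"
    and pc: "pd b (\<lambda>x. cos (t * z x)) = (\<lambda>x. - (t *\<^sub>R (pd b z x * sin (t * z x))))" for b t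
    using pd_eqI[OF ds] pd_eqI[OF dc] by auto
  have "Cr_big_O (Suc r) (Suc 0) (\<lambda>t x. sin (t * z x))"
  proof (rule Cr_big_O_SucI[OF K(1)])
    fix t x show "0 \<le> t \<Longrightarrow> norm (sin (t * z x)) \<le> K * t ^ Suc 0"
      using order_trans[OF abs_sin_x_le_abs_x, of "t * z x"] K(2)[of t x] by simp
    show "(\<lambda>x. sin (t * z x)) differentiable (at x)" using ds by (rule differentiableI)
    fix b :: 'a assume "b \<in> Basis"
    then show "Cr_big_O r (Suc 0) (\<lambda>t. pd b (\<lambda>x. sin (t * z x)))"
      unfolding ps using Suc Cr_big_O_mult[OF Cbig_bounded_smooth[OF bounded_smooth_pd[OF z]], of b r 0 "\<lambda>t x. cos (t * z x)"]
      by (intro Cr_big_O_cmult) auto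
  qed
  moreover have "Cr_big_O (Suc r) 0 (\<lambda>t x. cos (t * z x))"
  proof (rule Cr_big_O_SucI[of 1])
    fix t x show "norm (cos (t * z x)) \<le> 1 * t ^ 0" by simp
    show "(\<lambda>x. cos (t * z x)) differentiable (at x)" using dc by (rule differentiableI)
    fix b :: 'a assume b: "b \<in> Basis"
    show "Cr_big_O r 0 (\<lambda>t. pd b (\<lambda>x. cos (t * z x)))"
      unfolding pc using Suc Cr_big_O_mult[OF Cbig_bounded_smooth[OF bounded_smooth_pd[OF z b]], of r "Suc 0" "\<lambda>t x. sin (t * z x)"]
      by (intro Cr_big_O_minus Cr_big_O_le[OF Cr_big_O_cmult[OF Cr_big_O_le]]) auto
  qed auto
  ultimately show ?case ..
qed

lemma Cr_big_O_sin: "Cr_big_O r (Suc 0) (\<lambda>t x. sin (t * z x))"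
  and Cr_big_O_cos: "Cr_big_O r 0 (\<lambda>t x. cos (t * z x))"
  using Cr_big_O_sin_cos_0 by blast+

text \<open>The remainders form a ladder: up to sign, the derivative of each is
  \<open>t * pd b z\<close> times the previous one, which raises the power of \<open>t\<close>. Only
  order zero calls for an elementary inequality, and a case split on \<open>r\<close> takes the
  place of an induction.\<close>

lemma Cr_big_O_cos_minus_one: "Cr_big_O r (Suc (Suc 0)) (\<lambda>t x. cos (t * z x) - 1)"
proof -
  obtain K where K: "K \<ge> 0" "\<And>t x. 0 \<le> t \<Longrightarrow> \<bar>t * z x\<bar> ^ 2 \<le> K * t ^ 2" using bounded_smooth_power_le[of 2] by blast
  have bd: "norm (cos (t * z x) - 1) \<le> K * t ^ Suc (Suc 0)" if "0 \<le> t" for t x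
    using order_trans[OF abs_cos_minus_one_le[of "t * z x"]] K(2)[OF that, of x] by (simp add: numeral_2_eq_2)
  have d: "((\<lambda>x. cos (t * z x) - 1) has_derivative (\<lambda>h. - t *\<^sub>R (pd h z x * sin (t * z x)))) (at x)" for t x
    by (auto intro!: derivative_eq_intros bounded_smooth_has_derivative)
  have p: "pd b (\<lambda>x. cos (t * z x) - 1) = (\<lambda>x. - (t *\<^sub>R (pd b z x * sin (t * z x))))" for b t
    using pd_eqI[OF d] by auto
  show ?thesis
  proof (cases r)
    case 0 with K(1) bd show ?thesis by (auto intro!: Cr_big_OI[of K])
  next
    case (Suc r')
    show ?thesis unfolding Suc
    proof (rule Cr_big_O_SucI[OF K(1) bd])
      show "(\<lambda>x. cos (t * z x) - 1) differentiable (at x)" for t x using d by (rule differentiableI)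
      show "Cr_big_O r' (Suc (Suc 0)) (\<lambda>t. pd b (\<lambda>x. cos (t * z x) - 1))" if b: "b \<in> Basis" for b
        unfolding p using Cr_big_O_mult[OF Cbig_bounded_smooth[OF bounded_smooth_pd[OF z b]] Cr_big_O_sin]
        by (intro Cr_big_O_minus Cr_big_O_cmult) auto
    qed
  qed
qed

lemma Cr_big_O_sin_minus: "Cr_big_O r (Suc (Suc 0)) (\<lambda>t x. sin (t * z x) - t * z x)"
proof -
  obtain K where K: "K \<ge> 0" "\<And>t x. 0 \<le> t \<Longrightarrow> \<bar>t * z x\<bar> ^ 2 \<le> K * t ^ 2" using bounded_smooth_power_le[of 2] by blast
  have bd: "norm (sin (t * z x) - t * z x) \<le> K * t ^ Suc (Suc 0)" if "0 \<le> t" for t x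
    using order_trans[OF abs_sin_minus_le[of "t * z x"]] K(2)[OF that, of x] by (simp add: numeral_2_eq_2)
  have d: "((\<lambda>x. sin (t * z x) - t * z x) has_derivative (\<lambda>h. t *\<^sub>R (pd h z x * (cos (t * z x) - 1)))) (at x)" for t x
    by (auto intro!: derivative_eq_intros bounded_smooth_has_derivative simp: algebra_simps)
  have p: "pd b (\<lambda>x. sin (t * z x) - t * z x) = (\<lambda>x. t *\<^sub>R (pd b z x * (cos (t * z x) - 1)))" for b t
    using pd_eqI[OF d] by auto
  show ?thesis
  proof (cases r)
    case 0 with K(1) bd show ?thesis by (auto intro!: Cr_big_OI[of K])
  next
    case (Suc r')
    show ?thesis unfolding Suc
    proof (rule Cr_big_O_SucI[OF K(1) bd])
      show "(\<lambda>x. sin (t * z x) - t * z x) differentiable (at x)" for t x using d by (rule differentiableI)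
      show "Cr_big_O r' (Suc (Suc 0)) (\<lambda>t. pd b (\<lambda>x. sin (t * z x) - t * z x))" if b: "b \<in> Basis" for b
        \<comment> \<open>The derivative is even of third order; it is lowered to match the value,
          which is estimated by \<open>u\<^sup>2\<close>.\<close>
        unfolding p using Cr_big_O_mult[OF Cbig_bounded_smooth[OF bounded_smooth_pd[OF z b]] Cr_big_O_cos_minus_one]
        by (intro Cr_big_O_le[OF Cr_big_O_cmult]) auto
    qed
  qed
qed

lemma Cr_big_O_cos_quadratic: "Cr_big_O r (Suc (Suc (Suc 0))) (\<lambda>t x. cos (t * z x) - 1 + (t * z x)\<^sup>2 / 2)"
proof -
  obtain K where K: "K \<ge> 0" "\<And>t x. 0 \<le> t \<Longrightarrow> \<bar>t * z x\<bar> ^ 3 \<le> K * t ^ 3" using bounded_smooth_power_le[of 3] by blast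
  have bd: "norm (cos (t * z x) - 1 + (t * z x)\<^sup>2 / 2) \<le> K * t ^ Suc (Suc (Suc 0))" if "0 \<le> t" for t x
    using order_trans[OF abs_cos_quadratic_le[of "t * z x"]] K(2)[OF that, of x] by (simp add: numeral_3_eq_3)
  have d: "((\<lambda>x. cos (t * z x) - 1 + (t * z x)\<^sup>2 / 2) has_derivative
      (\<lambda>h. - (t *\<^sub>R (pd h z x * (sin (t * z x) - t * z x))))) (at x)" for t x
    by (auto intro!: derivative_eq_intros bounded_smooth_has_derivative simp: algebra_simps power2_eq_square)
  have p: "pd b (\<lambda>x. cos (t * z x) - 1 + (t * z x)\<^sup>2 / 2) =
      (\<lambda>x. - (t *\<^sub>R (pd b z x * (sin (t * z x) - t * z x))))" for b t
    using pd_eqI[OF d] by auto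
  show ?thesis
  proof (cases r)
    case 0 with K(1) bd show ?thesis by (auto intro!: Cr_big_OI[of K])
  next
    case (Suc r')
    show ?thesis unfolding Suc
    proof (rule Cr_big_O_SucI[OF K(1) bd])
      show "(\<lambda>x. cos (t * z x) - 1 + (t * z x)\<^sup>2 / 2) differentiable (at x)" for t x using d by (rule differentiableI)
      show "Cr_big_O r' (Suc (Suc (Suc 0))) (\<lambda>t. pd b (\<lambda>x. cos (t * z x) - 1 + (t * z x)\<^sup>2 / 2))"
        if b: "b \<in> Basis" for b
        unfolding p using Cr_big_O_mult[OF Cbig_bounded_smooth[OF bounded_smooth_pd[OF z b]] Cr_big_O_sin_minus]
        by (intro Cr_big_O_minus Cr_big_O_cmult) auto
    qed
  qed
qed

text \<open>The expansion estimate at \<open>t = 1\<close>, where the power of \<open>t\<close>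
  disappears.\<close>

lemma bounded_smooth_sin: "bounded_smooth (\<lambda>x. sin (z x))"
proof -
  have "\<exists>M. Cr_bounded r M (\<lambda>x. sin (z x))" for r
  proof -
    obtain K where "\<forall>t. 0 \<le> t \<longrightarrow> t \<le> 1 \<longrightarrow> Cr_bounded r (K * t ^ Suc 0) (\<lambda>x. sin (t * z x))"
      using Cr_big_OE[OF Cr_big_O_sin] by blast
    from spec[OF this, of 1] show ?thesis by auto
  qed
  then show ?thesis unfolding bounded_smooth_def ..
qed

lemma bounded_smooth_cos: "bounded_smooth (\<lambda>x. cos (z x))"
proof -
  have "\<exists>M. Cr_bounded r M (\<lambda>x. cos (z x))" for r
  proof -
    obtain K where "\<forall>t. 0 \<le> t \<longrightarrow> t \<le> 1 \<longrightarrow> Cr_bounded r (K * t ^ 0) (\<lambda>x. cos (t * z x))"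
      using Cr_big_OE[OF Cr_big_O_cos] by blast
    from spec[OF this, of 1] show ?thesis by auto
  qed
  then show ?thesis unfolding bounded_smooth_def ..
qed

end

section \<open>Real-analytic functions\<close>

lemma has_sum_exp: "((\<lambda>k. z ^ k /\<^sub>R fact k) has_sum exp z) (UNIV :: nat set)" for z :: complex
  by (rule norm_summable_imp_has_sum[OF summable_norm_exp exp_converges])

lemma has_sum_exp_prod:
  fixes z :: "'n::finite \<Rightarrow> complex"
  shows "((\<lambda>\<alpha>. \<Prod>i\<in>UNIV. z i ^ \<alpha> i /\<^sub>R fact (\<alpha> i)) has_sum (\<Prod>i\<in>UNIV. exp (z i))) UNIV"
proof -
  let ?f = "\<lambda>i k. z i ^ k /\<^sub>R fact k"
  have abs: "(\<lambda>k. norm (?f i k)) summable_on UNIV" for i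
    using summable_norm_exp[of "z i"] by (intro norm_summable_imp_summable_on) simp
  have s: "infsum (\<lambda>\<alpha>. \<Prod>i\<in>UNIV. ?f i (\<alpha> i)) (PiE UNIV (\<lambda>_. UNIV)) = (\<Prod>i\<in>UNIV. infsum (?f i) UNIV)"
    by (rule infsum_prod_PiE_abs) (rule finite, rule abs)
  have e: "infsum (?f i) UNIV = exp (z i)" for i
    using has_sum_exp by (rule infsumI)
  have P: "PiE UNIV (\<lambda>_. UNIV) = (UNIV :: ('n \<Rightarrow> nat) set)" by auto
  have "(\<lambda>\<alpha>. \<Prod>i\<in>UNIV. ?f i (\<alpha> i)) summable_on UNIV"
  proof (rule ccontr)
    \<comment> \<open>the sum of a non-summable family is \<open>0\<close>, but the product of exponentials is not\<close>
    assume "\<not> ?thesis"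
    from infsum_not_exists[OF this] have "(\<Prod>i\<in>UNIV. exp (z i)) = 0" using s unfolding P e by simp
    then show False by simp
  qed
  from has_sum_infsum[OF this] show ?thesis using s unfolding P e by simp
qed

lemma real_analytic_zero: "real_analytic (\<lambda>x. 0)"
  unfolding real_analytic_def
  by (intro allI exI[of _ 1] conjI exI[of _ "\<lambda>_. 0"]) auto

lemma real_analytic_add:
  assumes "real_analytic f" "real_analytic g"
  shows "real_analytic (\<lambda>x. f x + g x)"
  unfolding real_analytic_def
proof
  fix x0
  obtain r a where r: "r > 0" "\<And>x. x \<in> ball x0 r \<Longrightarrow>
    ((\<lambda>\<alpha>. a \<alpha> * (\<Prod>i\<in>UNIV. (x $ i - x0 $ i) ^ \<alpha> i)) has_sum f x) UNIV"
    using assms(1) unfolding real_analytic_def by meson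
  obtain s b where s: "s > 0" "\<And>x. x \<in> ball x0 s \<Longrightarrow>
    ((\<lambda>\<alpha>. b \<alpha> * (\<Prod>i\<in>UNIV. (x $ i - x0 $ i) ^ \<alpha> i)) has_sum g x) UNIV"
    using assms(2) unfolding real_analytic_def by meson
  have "((\<lambda>\<alpha>. (a \<alpha> + b \<alpha>) * (\<Prod>i\<in>UNIV. (x $ i - x0 $ i) ^ \<alpha> i)) has_sum f x + g x) UNIV"
    if "x \<in> ball x0 (min r s)" for x
    using has_sum_add[OF r(2) s(2), of x] that by (simp add: distrib_right)
  then show "\<exists>r>0. \<exists>a. \<forall>x\<in>ball x0 r.
      ((\<lambda>\<alpha>. a \<alpha> * (\<Prod>i\<in>UNIV. (x $ i - x0 $ i) ^ \<alpha> i)) has_sum f x + g x) UNIV"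
    using r(1) s(1) by (intro exI[of _ "min r s"] conjI exI[of _ "\<lambda>\<alpha>. a \<alpha> + b \<alpha>"]) auto
qed

lemma real_analytic_sum:
  "finite I \<Longrightarrow> (\<And>i. i \<in> I \<Longrightarrow> real_analytic (f i)) \<Longrightarrow> real_analytic (\<lambda>x. \<Sum>i\<in>I. f i x)"
  by (induction I rule: finite_induct) (auto intro: real_analytic_zero real_analytic_add)

text \<open>The cosine is the real part of \<open>cis\<close>, which splits around \<open>x0\<close>
  into a product of one-variable exponentials. Since the monomials in \<open>x - x0\<close> are
  real, the real parts of the complex coefficients serve; the expansion is valid everywhere, so the
  radius 1 is arbitrary.\<close>

lemma real_analytic_cos:
  fixes B :: "real ^ 'n::finite"
  shows "real_analytic (\<lambda>x. s * cos (B \<bullet> x + d))"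
  unfolding real_analytic_def
proof
  fix x0 :: "real ^ 'n"
  let ?c = "\<lambda>\<alpha>. cis (B \<bullet> x0 + d) * (\<Prod>i\<in>UNIV. (\<i> * complex_of_real (B $ i)) ^ \<alpha> i /\<^sub>R fact (\<alpha> i))"
  have "((\<lambda>\<alpha>. (s * Re (?c \<alpha>)) * (\<Prod>i\<in>UNIV. (x $ i - x0 $ i) ^ \<alpha> i)) has_sum s * cos (B \<bullet> x + d)) UNIV" for x
  proof -
    let ?z = "\<lambda>i. (\<i> * complex_of_real (B $ i)) * complex_of_real (x $ i - x0 $ i)"
    have "B \<bullet> x + d = (B \<bullet> x0 + d) + (\<Sum>i\<in>UNIV. B $ i * (x $ i - x0 $ i))"
      by (simp add: inner_vec_def right_diff_distrib sum_subtractf)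
    then have "cis (B \<bullet> x + d) = cis (B \<bullet> x0 + d) * cis (\<Sum>i\<in>UNIV. B $ i * (x $ i - x0 $ i))"
      by (simp only: cis_mult)
    also have "cis (\<Sum>i\<in>UNIV. B $ i * (x $ i - x0 $ i)) = (\<Prod>i\<in>UNIV. exp (?z i))"
      by (simp add: cis_conv_exp exp_sum[symmetric] sum_distrib_left mult.assoc)
    finally have h: "((\<lambda>\<alpha>. cis (B \<bullet> x0 + d) * (\<Prod>i\<in>UNIV. ?z i ^ \<alpha> i /\<^sub>R fact (\<alpha> i))) has_sum cis (B \<bullet> x + d)) UNIV"
      using has_sum_cmult_right[OF has_sum_exp_prod[of ?z], of "cis (B \<bullet> x0 + d)"] by simp
    have eq: "cis (B \<bullet> x0 + d) * (\<Prod>i\<in>UNIV. ?z i ^ \<alpha> i /\<^sub>R fact (\<alpha> i)) =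
        ?c \<alpha> * complex_of_real (\<Prod>i\<in>UNIV. (x $ i - x0 $ i) ^ \<alpha> i)" for \<alpha>
      by (simp add: power_mult_distrib prod.distrib[symmetric] mult.assoc)
    have "((\<lambda>\<alpha>. ?c \<alpha> * complex_of_real (\<Prod>i\<in>UNIV. (x $ i - x0 $ i) ^ \<alpha> i)) has_sum cis (B \<bullet> x + d)) UNIV"
      using h unfolding eq .
    note h' = has_sum_cmult_right[OF has_sum_Re[OF this], of s]
    have re: "Re (c * complex_of_real u) = Re c * u" for c u by simp
    show ?thesis using h' unfolding re cis.sel mult.assoc[of s] .
  qed
  then show "\<exists>r>0. \<exists>a. \<forall>x\<in>ball x0 r.
      ((\<lambda>\<alpha>. a \<alpha> * (\<Prod>i\<in>UNIV. (x $ i - x0 $ i) ^ \<alpha> i)) has_sum s * cos (B \<bullet> x + d)) UNIV"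
    by (intro exI[of _ 1] conjI exI[of _ "\<lambda>\<alpha>. s * Re (?c \<alpha>)"]) auto
qed

lemma real_analytic_cos_sum:
  fixes B :: "'i \<Rightarrow> real ^ 'n::finite"
  assumes "finite I"
  shows "real_analytic (\<lambda>x. \<Sum>i\<in>I. s i * cos (B i \<bullet> x + d i))"
  by (intro real_analytic_sum assms real_analytic_cos)

text \<open>Termwise differentiation. Absolute convergence at the corner
  \<open>x0 + (R, ..., R)\<close> gives the summable majorant \<open>m\<close>, and on the ball of
  radius \<open>R / 2\<close> the differentiated terms are dominated by
  \<open>2 / R * m\<close>.\<close>

lemma real_analytic_local:
  fixes f :: "real ^ 'n::finite \<Rightarrow> real"
  assumes "r > 0" and f: "\<And>x. x \<in> ball x0 r \<Longrightarrow>
    ((\<lambda>\<alpha>. a \<alpha> * (\<Prod>i\<in>UNIV. (x $ i - x0 $ i) ^ \<alpha> i)) has_sum f x) UNIV"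
  shows "\<exists>\<rho>>0. \<forall>x\<in>ball x0 \<rho>. f differentiable (at x) \<and> (\<forall>j.
    ((\<lambda>\<alpha>. (real (\<alpha> j + 1) * a (\<alpha>(j := \<alpha> j + 1))) * (\<Prod>i\<in>UNIV. (x $ i - x0 $ i) ^ \<alpha> i)) has_sum
      pd (axis j 1) f x) UNIV)"
proof -
  \<comment> \<open>With \<open>R = r / N\<close> the vector all of whose components are
    \<open>R\<close> has norm at most \<open>CARD('n) * R < r\<close>, so the corner lies in the
    ball of convergence.\<close>
  define N where "N = real CARD('n) + 1"
  have N: "0 < N" by (simp add: N_def add_pos_pos)
  define R where "R = r / N"
  have R: "0 < R" using assms(1) N by (simp add: R_def)
  define m where "m = (\<lambda>\<alpha>. \<bar>a \<alpha>\<bar> * (\<Prod>i\<in>(UNIV :: 'n set). R ^ \<alpha> i))"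
  have msum: "m summable_on UNIV"
  proof -
    let ?x = "x0 + (\<chi> i. R)"
    have "norm ((\<chi> i. R) :: real ^ 'n) \<le> (\<Sum>i\<in>(UNIV :: 'n set). \<bar>R\<bar>)"
      using norm_le_l1_cart[of "(\<chi> i. R) :: real ^ 'n"] by simp
    also have "\<dots> < N * R" using R by (simp add: N_def distrib_right)
    also have "\<dots> = r" using N by (simp add: R_def)
    finally have "?x \<in> ball x0 r" by (simp add: dist_norm)
    from f[OF this] have "(\<lambda>\<alpha>. a \<alpha> * (\<Prod>i\<in>(UNIV :: 'n set). R ^ \<alpha> i)) summable_on UNIV"
      by (auto simp: summable_on_def)
    then have "(\<lambda>\<alpha>. norm (a \<alpha> * (\<Prod>i\<in>(UNIV :: 'n set). R ^ \<alpha> i))) summable_on UNIV"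
      by (rule iffD1[OF summable_on_iff_abs_summable_on_real])
    then show ?thesis using R by (simp add: m_def[abs_def] abs_mult abs_prod)
  qed
  \<comment> \<open>The theorems on differentiating a series concern sequences, so the multi-indices
    are enumerated; \<open>has_sum\<close> is insensitive to the enumeration.\<close>
  define e :: "nat \<Rightarrow> 'n \<Rightarrow> nat" where "e = from_nat_into UNIV"
  have inf: "infinite (UNIV :: ('n \<Rightarrow> nat) set)"
  proof
    assume "finite (UNIV :: ('n \<Rightarrow> nat) set)"
    moreover have "inj (\<lambda>k :: nat. (\<lambda>_ :: 'n. k))" by (auto simp: inj_def fun_eq_iff)
    ultimately have "finite (UNIV :: nat set)"
      using finite_imageD[of "\<lambda>k :: nat. (\<lambda>_ :: 'n. k)" UNIV] finite_subset by (metis subset_UNIV)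
    then show False by simp
  qed
  have e: "bij e" unfolding e_def by (rule bij_betw_from_nat_into[OF _ inf]) simp
  have me: "summable (\<lambda>n. m (e n))"
  proof -
    have "(m \<circ> e) summable_on UNIV"
      using msum summable_on_reindex_bij_betw[OF e, of m] by (simp add: o_def)
    then show ?thesis by (auto simp: o_def dest: summable_on_imp_summable)
  qed
  have has_sum_e: "(F has_sum suminf (\<lambda>n. F (e n))) UNIV" if "\<And>\<alpha>. \<bar>F \<alpha>\<bar> \<le> K * m \<alpha>" for F K
  proof -
    have S: "summable (\<lambda>n. norm (F (e n)))"
      by (rule summable_comparison_test'[of "\<lambda>n. K * m (e n)" 0]) (use that me in \<open>auto intro: summable_mult\<close>)
    have "((\<lambda>n. F (e n)) has_sum suminf (\<lambda>n. F (e n))) UNIV"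
      by (rule norm_summable_imp_has_sum[OF S summable_sums[OF summable_norm_cancel[OF S]]])
    then show ?thesis using has_sum_reindex_bij_betw[OF e, of F] by simp
  qed
  \<comment> \<open>The \<open>j\<close>-th partial derivative of the term with index
    \<open>\<alpha>\<close>. Where \<open>\<alpha> j = 0\<close> the truncated exponent is harmless,
    since the factor \<open>real (\<alpha> j)\<close> vanishes.\<close>
  define D where "D = (\<lambda>j \<alpha> (x :: real ^ 'n). a \<alpha> * (real (\<alpha> j) * (x $ j - x0 $ j) ^ (\<alpha> j - 1) *
      (\<Prod>i\<in>UNIV - {j}. (x $ i - x0 $ i) ^ \<alpha> i)))"
  let ?S = "ball x0 (R / 2)"
  have D: "\<bar>D j \<alpha> x\<bar> \<le> 2 / R * m \<alpha>" if x: "x \<in> ?S" for j \<alpha> x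
  proof -
    have c: "\<bar>x $ i - x0 $ i\<bar> \<le> R / 2" for i
      using component_le_norm_cart[of "x - x0" i] x by (simp add: dist_norm norm_minus_commute)
    have c': "\<bar>x $ i - x0 $ i\<bar> \<le> R" for i using c[of i] R by linarith
    have 1: "\<bar>\<Prod>i\<in>UNIV - {j}. (x $ i - x0 $ i) ^ \<alpha> i\<bar> \<le> (\<Prod>i\<in>UNIV - {j}. R ^ \<alpha> i)"
      unfolding abs_prod power_abs using c' by (intro prod_mono conjI power_mono) auto
    \<comment> \<open>The factor \<open>k + 1\<close> from differentiation is at most
      \<open>2 ^ (k + 1)\<close>, which is compensated by working in radius
      \<open>R / 2\<close>.\<close>
    have 2: "real (\<alpha> j) * \<bar>x $ j - x0 $ j\<bar> ^ (\<alpha> j - 1) \<le> 2 / R * R ^ \<alpha> j"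
    proof (cases "\<alpha> j")
      case (Suc k)
      have "real (\<alpha> j) * \<bar>x $ j - x0 $ j\<bar> ^ k \<le> 2 ^ Suc k * (R / 2) ^ k"
        using c[of j] of_nat_less_two_power[of "Suc k", where 'a = real] unfolding Suc
        by (intro mult_mono power_mono) auto
      also have "\<dots> = 2 / R * R ^ \<alpha> j" using R by (simp add: Suc power_divide)
      finally show ?thesis by (simp add: Suc)
    qed (use R in simp)
    have "\<bar>D j \<alpha> x\<bar> = \<bar>a \<alpha>\<bar> * ((real (\<alpha> j) * \<bar>x $ j - x0 $ j\<bar> ^ (\<alpha> j - 1)) *
        \<bar>\<Prod>i\<in>UNIV - {j}. (x $ i - x0 $ i) ^ \<alpha> i\<bar>)"
      by (simp add: D_def abs_mult power_abs)
    also have "\<dots> \<le> \<bar>a \<alpha>\<bar> * ((2 / R * R ^ \<alpha> j) * (\<Prod>i\<in>UNIV - {j}. R ^ \<alpha> i))"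
      by (rule mult_left_mono[OF mult_mono[OF 2 1]]) (use R in auto)
    also have "\<dots> = 2 / R * m \<alpha>"
      unfolding m_def by (simp add: prod.remove[of UNIV j "\<lambda>i. R ^ \<alpha> i"] mult_ac)
    finally show ?thesis .
  qed
  define g where "g = (\<lambda>j x. suminf (\<lambda>n. D j (e n) x))"
  let ?u = "\<lambda>n (x :: real ^ 'n). a (e n) * (\<Prod>i\<in>UNIV. (x $ i - x0 $ i) ^ e n i)"
  have x0S: "x0 \<in> ?S" using R by simp
  have sub: "?S \<subseteq> ball x0 r"
  proof -
    have "R \<le> r" using N assms(1) by (simp add: R_def N_def field_simps)
    then show ?thesis using R by (intro subset_ball) simp
  qed
  have fsum: "(\<lambda>n. ?u n x) sums f x" if "x \<in> ?S" for x
    using f[of x] that sub has_sum_reindex_bij_betw[OF e, of "\<lambda>\<alpha>. a \<alpha> * (\<Prod>i\<in>UNIV. (x $ i - x0 $ i) ^ \<alpha> i)"]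
    by (intro has_sum_imp_sums) auto
  have "\<exists>G. \<forall>x\<in>?S. (\<lambda>n. ?u n x) sums G x \<and> (G has_derivative (\<lambda>h. \<Sum>j\<in>UNIV. h $ j * g j x)) (at x within ?S)"
  proof (rule has_derivative_series[where f' = "\<lambda>n x h. \<Sum>j\<in>UNIV. h $ j * D j (e n) x"])
    show "convex ?S" by simp
    show "(?u n has_derivative (\<lambda>h. \<Sum>j\<in>UNIV. h $ j * D j (e n) x)) (at x within ?S)" for n x
    proof -
      have "((\<lambda>x. (x $ i - x0 $ i) ^ e n i) has_derivative
          (\<lambda>h. real (e n i) * h $ i * (x $ i - x0 $ i) ^ (e n i - 1))) (at x within ?S)" for i
        by (auto intro!: derivative_eq_intros bounded_linear.has_derivative[OF bounded_linear_vec_nth] simp: algebra_simps)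
      from has_derivative_mult_right[OF has_derivative_prod[of UNIV, OF this], of "a (e n)"]
      show ?thesis
        by (rule has_derivative_eq_rhs) (simp add: fun_eq_iff D_def sum_distrib_left mult_ac)
    qed
    show "x0 \<in> ?S" by (rule x0S)
    show "(\<lambda>n. ?u n x0) sums f x0" by (rule fsum[OF x0S])
    fix d :: real assume d: "0 < d"
    have "\<forall>\<^sub>F n in sequentially. \<forall>j\<in>UNIV. \<forall>x\<in>?S. dist (\<Sum>i<n. D j (e i) x) (g j x) < d / N"
    proof (rule eventually_ball_finite[OF finite], rule ballI)
      fix j
      have "uniform_limit ?S (\<lambda>n x. \<Sum>i<n. D j (e i) x) (g j) sequentially"
        unfolding g_def
        by (rule Weierstrass_m_test[where M = "\<lambda>n. 2 / R * m (e n)"]) (use D me in \<open>auto intro: summable_mult\<close>)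
      then show "\<forall>\<^sub>F n in sequentially. \<forall>x\<in>?S. dist (\<Sum>i<n. D j (e i) x) (g j x) < d / N"
        using d N by (intro uniform_limitD) auto
    qed
    then show "\<forall>\<^sub>F n in sequentially. \<forall>x\<in>?S. \<forall>h. norm ((\<Sum>i<n. \<Sum>j\<in>UNIV. h $ j * D j (e i) x) -
        (\<Sum>j\<in>UNIV. h $ j * g j x)) \<le> d * norm h"
    proof (rule eventually_mono, intro ballI allI)
      fix n x and h :: "real ^ 'n"
      assume *: "\<forall>j\<in>UNIV. \<forall>x\<in>?S. dist (\<Sum>i<n. D j (e i) x) (g j x) < d / N" and x: "x \<in> ?S"
      have "(\<Sum>i<n. \<Sum>j\<in>UNIV. h $ j * D j (e i) x) - (\<Sum>j\<in>UNIV. h $ j * g j x) =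
          (\<Sum>j\<in>UNIV. h $ j * ((\<Sum>i<n. D j (e i) x) - g j x))"
        by (subst sum.swap) (simp add: sum_distrib_left sum_subtractf right_diff_distrib)
      also have "norm \<dots> \<le> (\<Sum>j\<in>(UNIV :: 'n set). norm h * (d / N))"
      proof (rule sum_norm_le)
        fix j
        have "\<bar>(\<Sum>i<n. D j (e i) x) - g j x\<bar> \<le> d / N" using * x by (auto simp: dist_real_def less_imp_le)
        then show "norm (h $ j * ((\<Sum>i<n. D j (e i) x) - g j x)) \<le> norm h * (d / N)"
          unfolding real_norm_def abs_mult using component_le_norm_cart[of h j] d N by (intro mult_mono) auto
      qed
      also have "\<dots> = (real CARD('n) / N) * (d * norm h)" by simp
      also have "\<dots> \<le> 1 * (d * norm h)" using N d by (intro mult_right_mono) (auto simp: N_def)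
      finally show "norm ((\<Sum>i<n. \<Sum>j\<in>UNIV. h $ j * D j (e i) x) - (\<Sum>j\<in>UNIV. h $ j * g j x)) \<le> d * norm h" by simp
    qed
  qed
  then obtain G where G: "\<And>x. x \<in> ?S \<Longrightarrow> (\<lambda>n. ?u n x) sums G x"
    "\<And>x. x \<in> ?S \<Longrightarrow> (G has_derivative (\<lambda>h. \<Sum>j\<in>UNIV. h $ j * g j x)) (at x within ?S)" by blast
  have fd: "(f has_derivative (\<lambda>h. \<Sum>j\<in>UNIV. h $ j * g j x)) (at x)" if x: "x \<in> ?S" for x
  proof (rule has_derivative_transform_within_open)
    show "(G has_derivative (\<lambda>h. \<Sum>j\<in>UNIV. h $ j * g j x)) (at x)"
      using G(2)[OF x] x by (simp add: at_within_open[OF _ open_ball])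
    show "G y = f y" if "y \<in> ?S" for y using sums_unique2[OF G(1)[OF that] fsum[OF that]] .
  qed (use x in auto)
  have pdf: "pd (axis j 1) f x = g j x" if x: "x \<in> ?S" for x j
    using pd_eqI[OF fd[OF x], of "axis j 1"] by (simp add: axis_def if_distrib if_distribR cong: if_cong)
  have "((\<lambda>\<alpha>. (real (\<alpha> j + 1) * a (\<alpha>(j := \<alpha> j + 1))) * (\<Prod>i\<in>UNIV. (x $ i - x0 $ i) ^ \<alpha> i)) has_sum g j x) UNIV"
    if x: "x \<in> ?S" for x j
  proof -
    \<comment> \<open>Terms with \<open>\<alpha> j = 0\<close> vanish and the remaining indices are
      the image of the shift \<open>?s\<close>, which yields the usual coefficients.\<close>
    let ?s = "\<lambda>\<alpha> :: 'n \<Rightarrow> nat. \<alpha>(j := \<alpha> j + 1)"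
    have inj: "inj ?s"
    proof (rule injI, rule ext)
      fix \<alpha> \<beta> i assume "?s \<alpha> = ?s \<beta>"
      then have "?s \<alpha> i = ?s \<beta> i" by simp
      then show "\<alpha> i = \<beta> i" by (auto split: if_splits)
    qed
    have "((\<lambda>\<alpha>. D j \<alpha> x) has_sum g j x) UNIV"
      unfolding g_def using D[OF x] by (rule has_sum_e)
    moreover have "D j \<alpha> x = 0" if "\<alpha> \<notin> range ?s" for \<alpha>
    proof -
      have "\<alpha> j = 0"
      proof (rule ccontr)
        assume "\<alpha> j \<noteq> 0"
        then have "\<alpha> = ?s (\<alpha>(j := \<alpha> j - 1))" by auto
        with that show False by blast
      qed
      then show ?thesis by (simp add: D_def)
    qed
    ultimately have "((\<lambda>\<alpha>. D j \<alpha> x) has_sum g j x) (range ?s)"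
      using has_sum_cong_neutral[of "range ?s" UNIV "\<lambda>\<alpha>. D j \<alpha> x" "\<lambda>\<alpha>. D j \<alpha> x" "g j x"] by auto
    then have "((\<lambda>\<alpha>. D j (?s \<alpha>) x) has_sum g j x) UNIV"
      unfolding has_sum_reindex[OF inj] by (simp add: o_def)
    moreover have "D j (?s \<alpha>) x = (real (\<alpha> j + 1) * a (?s \<alpha>)) * (\<Prod>i\<in>UNIV. (x $ i - x0 $ i) ^ \<alpha> i)" for \<alpha>
      by (simp add: D_def prod.remove[of UNIV j "\<lambda>i. (x $ i - x0 $ i) ^ \<alpha> i"] mult_ac)
    ultimately show ?thesis by simp
  qed
  moreover have "f differentiable (at x)" if "x \<in> ?S" for x
    using fd[OF that] by (rule differentiableI)
  ultimately show ?thesis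
    using R pdf by (intro exI[of _ "R / 2"]) auto
qed

lemma real_analytic_differentiable:
  assumes "real_analytic f"
  shows "f differentiable (at x)"
proof -
  obtain r a where r: "r > 0" "\<And>y. y \<in> ball x r \<Longrightarrow>
    ((\<lambda>\<alpha>. a \<alpha> * (\<Prod>i\<in>UNIV. (y $ i - x $ i) ^ \<alpha> i)) has_sum f y) UNIV"
    using assms unfolding real_analytic_def by meson
  from real_analytic_local[OF this] obtain s where "s > 0" "\<forall>y\<in>ball x s. f differentiable (at y)" by blast
  then show ?thesis by simp
qed

lemma real_analytic_pd:
  fixes f :: "real ^ 'n::finite \<Rightarrow> real"
  assumes "real_analytic f" "b \<in> Basis"
  shows "real_analytic (pd b f)"
  unfolding real_analytic_def
proof
  fix x0
  obtain j where j: "b = axis j 1" using assms(2) by (auto simp: Basis_vec_def)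
  obtain r a where r: "r > 0" "\<And>x. x \<in> ball x0 r \<Longrightarrow>
    ((\<lambda>\<alpha>. a \<alpha> * (\<Prod>i\<in>UNIV. (x $ i - x0 $ i) ^ \<alpha> i)) has_sum f x) UNIV"
    using assms(1) unfolding real_analytic_def by meson
  from real_analytic_local[OF this] obtain s where "s > 0" "\<forall>x\<in>ball x0 s.
    ((\<lambda>\<alpha>. (real (\<alpha> j + 1) * a (\<alpha>(j := \<alpha> j + 1))) * (\<Prod>i\<in>UNIV. (x $ i - x0 $ i) ^ \<alpha> i)) has_sum pd b f x) UNIV"
    unfolding j by blast
  then show "\<exists>r>0. \<exists>a. \<forall>x\<in>ball x0 r.
      ((\<lambda>\<alpha>. a \<alpha> * (\<Prod>i\<in>UNIV. (x $ i - x0 $ i) ^ \<alpha> i)) has_sum pd b f x) UNIV"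
    by (intro exI[of _ s] conjI exI[of _ "\<lambda>\<alpha>. real (\<alpha> j + 1) * a (\<alpha>(j := \<alpha> j + 1))"]) auto
qed

text \<open>The generators of the group use arbitrary analytic potentials; their smoothness makes
  the corresponding Hamiltonians admissible in \<open>Ham_infinity\<close>.\<close>

lemma real_analytic_smooth:
  fixes f :: "real ^ 'n::finite \<Rightarrow> real"
  assumes "real_analytic f"
  shows "smooth f"
proof -
  have "real_analytic (iter_deriv vs f)" if "set vs \<subseteq> Basis" for vs
    using that
  proof (induction vs)
    case (Cons v vs)
    then show ?case unfolding iter_deriv_Cons_pd by (intro real_analytic_pd) auto
  qed (simp add: assms)
  then show ?thesis unfolding smooth_def by (blast intro: real_analytic_differentiable)
qed

section \<open>Lifts of shears\<close>

text \<open>The lattice 2 pi Z^n, whose elements are frequencies \<open>A\<close> for which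
  \<open>cos (A \<bullet> x + c)\<close> descends to the torus.\<close>

definition dual_lattice :: "real ^ 'n::finite \<Rightarrow> bool" where
  "dual_lattice v \<longleftrightarrow> (\<forall>i. \<exists>m::int. v $ i = 2 * pi * of_int m)"

lemma to_torus_eq_iff: "to_torus x = to_torus y \<longleftrightarrow> (\<forall>i. x $ i - y $ i \<in> \<int>)"
  by (rule torus.abs_eq_iff)

lemma to_torus_rep [simp]: "to_torus (rep_torus t) = t"
  by (rule Quotient3_abs_rep[OF Quotient3_torus])

lemma to_torus_add_cong: "to_torus x = to_torus y \<Longrightarrow> to_torus (x + w) = to_torus (y + w)"
  by (simp add: to_torus_eq_iff)

text \<open>An invariant function descends to the torus by evaluation at the chosen
  representatives.\<close>

lemma to_torus_factor:
  assumes "\<And>x y. to_torus x = to_torus y \<Longrightarrow> f x = f y"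
  shows "(\<lambda>t. f (rep_torus t)) \<circ> to_torus = f"
proof
  fix x show "((\<lambda>t. f (rep_torus t)) \<circ> to_torus) x = f x"
    unfolding o_def by (rule assms) simp
qed

lemma to_phase_eq_iff: "to_phase x = to_phase y \<longleftrightarrow> to_torus (fst x) = to_torus (fst y) \<and> to_torus (snd x) = to_torus (snd y)"
  by (simp add: to_phase_def split: prod.splits)

lemma to_phase_rep: "to_phase (rep_torus (fst z), rep_torus (snd z)) = z"
  by (simp add: to_phase_def)

lemma ex_is_lift:
  assumes "\<And>x y. to_phase x = to_phase y \<Longrightarrow> to_phase (F x) = to_phase (F y)"
  shows "\<exists>f. is_lift F f"
proof
  show "is_lift F (\<lambda>z. to_phase (F (rep_torus (fst z), rep_torus (snd z))))"
    unfolding is_lift_def by (auto intro!: assms simp: to_phase_rep)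
qed

lemma is_lift_unique: "is_lift F f \<Longrightarrow> is_lift F g \<Longrightarrow> f = g"
  unfolding is_lift_def by (metis to_phase_rep ext)

lemma is_lift_comp: "is_lift F f \<Longrightarrow> is_lift G g \<Longrightarrow> is_lift (F \<circ> G) (f \<circ> g)"
  unfolding is_lift_def by (metis comp_apply)

lemma is_lift_id: "is_lift (\<lambda>x. x) id"
  unfolding is_lift_def by simp

lemma dual_lattice_inner:
  assumes "dual_lattice A" "to_torus x = to_torus y"
  shows "\<exists>k::int. A \<bullet> x = A \<bullet> y + 2 * pi * of_int k"
proof -
  obtain m :: "'a \<Rightarrow> int" where m: "\<And>i. A $ i = 2 * pi * of_int (m i)"
    using assms(1) unfolding dual_lattice_def by metis
  have "\<forall>i. \<exists>k::int. x $ i - y $ i = of_int k"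
    using assms(2) unfolding to_torus_eq_iff by (auto elim: Ints_cases)
  then obtain k :: "'a \<Rightarrow> int" where k: "\<And>i. x $ i - y $ i = of_int (k i)" by metis
  have "A \<bullet> x - A \<bullet> y = (\<Sum>i\<in>UNIV. A $ i * (x $ i - y $ i))"
    by (simp add: inner_vec_def sum_subtractf right_diff_distrib)
  also have "\<dots> = 2 * pi * of_int (\<Sum>i\<in>UNIV. m i * k i)"
    by (simp add: m k sum_distrib_left mult.assoc)
  finally show ?thesis by (intro exI[of _ "\<Sum>i\<in>UNIV. m i * k i"]) linarith
qed

lemma dual_lattice_cos_cong:
  assumes "dual_lattice A" "to_torus x = to_torus y"
  shows "cos (A \<bullet> x + c) = cos (A \<bullet> y + c)"
proof -
  obtain k :: int where "A \<bullet> x = A \<bullet> y + 2 * pi * of_int k" using dual_lattice_inner[OF assms] by blast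
  then have k: "A \<bullet> x + c = (A \<bullet> y + c) + 2 * pi * of_int k" by simp
  show ?thesis
    unfolding k cos_add[of "A \<bullet> y + c"] sin_int_2pin cos_int_2pin by simp
qed

text \<open>As \<open>v\<close> is arbitrary, \<open>frechet_derivative\<close> may be a mere
  choice. Invariance under the period \<open>x - y\<close> shows that \<open>x\<close> and
  \<open>y\<close> have the same candidates for a derivative, and then the choice agrees as
  well.\<close>

lemma gradient_periodic:
  assumes "to_torus x = to_torus y"
  shows "gradient (v \<circ> to_torus) x = gradient (v \<circ> to_torus) y"
proof -
  have *: "((v \<circ> to_torus) has_derivative D) (at y)"
    if "to_torus x = to_torus y" "((v \<circ> to_torus) has_derivative D) (at x)" for x y D
  proof -
    have "to_torus z = to_torus (z + (x - y))" for z
      unfolding to_torus_eq_iff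
    proof
      fix i
      have "- (x $ i - y $ i) \<in> \<int>" using that(1) unfolding to_torus_eq_iff by (intro Ints_minus) blast
      then show "z $ i - (z + (x - y)) $ i \<in> \<int>" by simp
    qed
    then have e: "(v \<circ> to_torus) = (\<lambda>z. (v \<circ> to_torus) (z + (x - y)))" by auto
    have 1: "((\<lambda>z. z + (x - y)) has_derivative (\<lambda>h. h)) (at y)"
      by (auto intro!: derivative_eq_intros)
    have "((\<lambda>z. (v \<circ> to_torus) (z + (x - y))) has_derivative D) (at y)"
      using has_derivative_compose[OF 1, of "v \<circ> to_torus" D] that(2) by simp
    then show ?thesis using e by simp
  qed
  have "frechet_derivative (v \<circ> to_torus) (at x) = frechet_derivative (v \<circ> to_torus) (at y)"
    unfolding frechet_derivative_def using *[OF assms] *[OF assms[symmetric]]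
    by (intro arg_cong[where f = Eps] ext) blast
  then show ?thesis by (simp add: gradient_def)
qed

lemma Bij_UNIV: "Bij UNIV = {f. bij f}"
  by (auto simp: Bij_def extensional_def)

lemma ex_vertical:
  assumes "\<And>x y. to_torus x = to_torus y \<Longrightarrow> u x = u y"
  shows "\<exists>f. is_lift (\<lambda>(q, p). (q, p + u q)) f"
proof (rule ex_is_lift)
  fix x y :: "'a cover" assume "to_phase x = to_phase y"
  then show "to_phase ((\<lambda>(q, p). (q, p + u q)) x) = to_phase ((\<lambda>(q, p). (q, p + u q)) y)"
    using to_torus_add_cong[of "snd x" "snd y" "u (fst x)"] assms[of "fst x" "fst y"]
    by (auto simp: to_phase_eq_iff case_prod_unfold)
qed

lemma ex_horizontal:
  assumes "\<And>x y. to_torus x = to_torus y \<Longrightarrow> u x = u y"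
  shows "\<exists>f. is_lift (\<lambda>(q, p). (q + u p, p)) f"
proof (rule ex_is_lift)
  fix x y :: "'a cover" assume "to_phase x = to_phase y"
  then show "to_phase ((\<lambda>(q, p). (q + u p, p)) x) = to_phase ((\<lambda>(q, p). (q + u p, p)) y)"
    using to_torus_add_cong[of "fst x" "fst y" "u (snd x)"] assms[of "snd x" "snd y"]
    by (auto simp: to_phase_eq_iff case_prod_unfold)
qed

lemma vertical_lift_inverse:
  assumes "is_lift (\<lambda>(q, p). (q, p - u q)) f" "\<And>x y. to_torus x = to_torus y \<Longrightarrow> u x = u y"
  shows "\<exists>g. is_lift (\<lambda>(q, p). (q, p + u q)) g \<and> f \<circ> g = id \<and> g \<circ> f = id"
proof -
  obtain g where g: "is_lift (\<lambda>(q, p). (q, p + u q)) g" using ex_vertical[of u] assms(2) by blast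
  have "is_lift (\<lambda>x. x) (f \<circ> g)" "is_lift (\<lambda>x. x) (g \<circ> f)"
    using is_lift_comp[OF assms(1) g] is_lift_comp[OF g assms(1)] by (auto simp: o_def case_prod_unfold)
  then have "f \<circ> g = id" "g \<circ> f = id" using is_lift_unique is_lift_id by blast+
  with g show ?thesis by blast
qed

lemma horizontal_lift_inverse:
  assumes "is_lift (\<lambda>(q, p). (q + u p, p)) f" "\<And>x y. to_torus x = to_torus y \<Longrightarrow> u x = u y"
  shows "\<exists>g. is_lift (\<lambda>(q, p). (q - u p, p)) g \<and> f \<circ> g = id \<and> g \<circ> f = id"
proof -
  have "\<exists>g. is_lift (\<lambda>(q, p). (q + - u p, p)) g"
    by (rule ex_horizontal) (rule arg_cong[where f = uminus], rule assms(2))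
  then obtain g where g: "is_lift (\<lambda>(q, p). (q - u p, p)) g" by auto
  have "is_lift (\<lambda>x. x) (f \<circ> g)" "is_lift (\<lambda>x. x) (g \<circ> f)"
    using is_lift_comp[OF assms(1) g] is_lift_comp[OF g assms(1)] by (auto simp: o_def case_prod_unfold)
  then have "f \<circ> g = id" "g \<circ> f = id" using is_lift_unique is_lift_id by blast+
  with g show ?thesis by blast
qed

text \<open>The product of \<open>BijGroup\<close> is restricted to the carrier, so bijectivity is
  what identifies it with \<open>\<circ>\<close>.\<close>

lemma shears_Bij: "vertical_shears \<union> horizontal_shears \<subseteq> Bij (UNIV :: 'n::finite phase set)"
proof
  fix f :: "'n phase \<Rightarrow> 'n phase" assume "f \<in> vertical_shears \<union> horizontal_shears"
  then have "\<exists>g. f \<circ> g = id \<and> g \<circ> f = id"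
  proof
    assume "f \<in> vertical_shears"
    then obtain v :: "'n torus \<Rightarrow> real" where
      "is_lift (\<lambda>(q, p). (q, p - gradient (v \<circ> to_torus) q)) f"
      unfolding vertical_shears_def by blast
    from vertical_lift_inverse[OF this] show ?thesis using gradient_periodic by blast
  next
    assume "f \<in> horizontal_shears"
    then obtain v :: "'n torus \<Rightarrow> real" where
      "is_lift (\<lambda>(q, p). (q + gradient (v \<circ> to_torus) p, p)) f"
      unfolding horizontal_shears_def by blast
    from horizontal_lift_inverse[OF this] show ?thesis using gradient_periodic by blast
  qed
  then show "f \<in> Bij UNIV" unfolding Bij_UNIV using o_bij by blast
qed

lemma shear_group_Bij: "shear_group \<subseteq> Bij UNIV"
  using group.generate_incl[OF group_BijGroup, of "vertical_shears \<union> horizontal_shears" UNIV] shears_Bij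
  unfolding shear_group_def by (simp add: BijGroup_def)

lemma shear_group_comp: "f \<in> shear_group \<Longrightarrow> g \<in> shear_group \<Longrightarrow> f \<circ> g \<in> shear_group"
proof -
  assume fg: "f \<in> shear_group" "g \<in> shear_group"
  then have "f \<otimes>\<^bsub>BijGroup UNIV\<^esub> g \<in> shear_group"
    unfolding shear_group_def by (rule generate.eng)
  moreover have "f \<otimes>\<^bsub>BijGroup UNIV\<^esub> g = f \<circ> g"
    using fg shear_group_Bij by (auto simp: BijGroup_def compose_def fun_eq_iff subset_iff)
  ultimately show ?thesis by simp
qed

lemma shear_group_id: "id \<in> shear_group"
  using generate.one[of "BijGroup UNIV" "vertical_shears \<union> horizontal_shears"]
  by (simp add: shear_group_def BijGroup_def id_def restrict_def)

definition shear_displacement :: "('n::finite cover \<Rightarrow> 'n cover) \<Rightarrow> bool" where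
  "shear_displacement g \<longleftrightarrow> bounded_smooth g \<and> (\<exists>f\<in>shear_group. is_lift (\<lambda>x. x + g x) f)"

lemma shear_displacement_zero: "shear_displacement (\<lambda>x. 0)"
  unfolding shear_displacement_def using bounded_smooth_const shear_group_id is_lift_id by fastforce

lemma shear_displacement_comp:
  assumes "shear_displacement g" "shear_displacement g'"
  shows "shear_displacement (\<lambda>x. g x + g' (x + g x))"
proof -
  obtain f f' where f: "f \<in> shear_group" "is_lift (\<lambda>x. x + g x) f"
    and f': "f' \<in> shear_group" "is_lift (\<lambda>x. x + g' x) f'"
    using assms unfolding shear_displacement_def by blast
  have "is_lift (\<lambda>x. x + (g x + g' (x + g x))) (f' \<circ> f)"
    using is_lift_comp[OF f'(2) f(2)] by (simp add: o_def add.assoc)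
  then show ?thesis
    using assms shear_group_comp[OF f'(1) f(1)] unfolding shear_displacement_def
    by (intro conjI bounded_smooth_add bounded_smooth_displaced bexI[of _ "f' \<circ> f"]) auto
qed

lemma gradient_eqI:
  assumes "(f has_derivative (\<lambda>h. a \<bullet> h)) (at x)"
  shows "gradient f x = a"
  unfolding gradient_def frechet_derivative_at[OF assms, symmetric] by (simp add: euclidean_representation)

lemma gradient_cos_sum:
  fixes B :: "'i \<Rightarrow> real ^ 'n::finite"
  shows "gradient (\<lambda>x. \<Sum>i\<in>I. s i * cos (B i \<bullet> x + d i)) x = - (\<Sum>i\<in>I. (s i * sin (B i \<bullet> x + d i)) *\<^sub>R B i)"
  by (rule gradient_eqI) (auto intro!: derivative_eq_intros sum.cong simp: inner_sum_left sum_negf[symmetric])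

lemma bounded_smooth_sin_snd: "bounded_smooth (\<lambda>x :: 'n::finite cover. sin (B \<bullet> snd x + d))"
  and bounded_smooth_cos_snd: "bounded_smooth (\<lambda>x :: 'n::finite cover. cos (B \<bullet> snd x + d))"
  using bounded_smooth_sin_inner[of "(0, B)"] bounded_smooth_cos_inner[of "(0, B)"] by (simp_all add: inner_prod_def)

lemma bounded_smooth_sin_fst: "bounded_smooth (\<lambda>x :: 'n::finite cover. sin (A \<bullet> fst x + d))"
  and bounded_smooth_cos_fst: "bounded_smooth (\<lambda>x :: 'n::finite cover. cos (A \<bullet> fst x + d))"
  using bounded_smooth_sin_inner[of "(A, 0)"] bounded_smooth_cos_inner[of "(A, 0)"] by (simp_all add: inner_prod_def)

lemma shear_displacement_horizontal:
  fixes B :: "'i \<Rightarrow> real ^ 'n::finite"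
  assumes I: "finite I" "\<And>i. i \<in> I \<Longrightarrow> dual_lattice (B i)"
  shows "shear_displacement (\<lambda>x. (- (\<Sum>i\<in>I. (s i * sin (B i \<bullet> snd x + d i)) *\<^sub>R B i), 0))"
proof -
  let ?\<tau> = "\<lambda>x :: real ^ 'n. \<Sum>i\<in>I. s i * cos (B i \<bullet> x + d i)"
  let ?u = "\<lambda>p :: real ^ 'n. - (\<Sum>i\<in>I. (s i * sin (B i \<bullet> p + d i)) *\<^sub>R B i)"
  let ?t = "\<lambda>t. ?\<tau> (rep_torus t)"
  have t: "?t \<circ> to_torus = ?\<tau>"
    by (rule to_torus_factor) (auto intro!: sum.cong arg_cong2[where f = "(*)"] dual_lattice_cos_cong I)
  have u: "gradient (?t \<circ> to_torus) = ?u"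
    unfolding t by (rule ext) (rule gradient_cos_sum)
  have per: "?u x = ?u y" if "to_torus x = to_torus y" for x y
    using gradient_periodic[OF that, of ?t] unfolding u .
  have "\<exists>f. is_lift (\<lambda>(q, p). (q + ?u p, p)) f"
    by (rule ex_horizontal) (rule per)
  then obtain f where f: "is_lift (\<lambda>(q, p). (q + ?u p, p)) f" by blast
  then have "f \<in> horizontal_shears"
    unfolding horizontal_shears_def using real_analytic_cos_sum[OF I(1), of s B d] u t
    by (auto intro!: exI[of _ ?t])
  then have "f \<in> shear_group"
    unfolding shear_group_def by (intro generate.incl) simp
  moreover have "is_lift (\<lambda>x. x + (?u (snd x), 0)) f"
    using f by (simp add: case_prod_unfold plus_prod_def)
  moreover have "bounded_smooth (\<lambda>x :: 'n cover. (?u (snd x), 0 :: real ^ 'n))"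
  proof -
    have "bounded_smooth (\<lambda>x :: 'n cover. - (\<Sum>i\<in>I. (s i * sin (B i \<bullet> snd x + d i)) *\<^sub>R (B i, 0 :: real ^ 'n)))"
      by (intro bounded_smooth_minus bounded_smooth_sum bounded_smooth_scaleR bounded_smooth_mult bounded_smooth_const bounded_smooth_sin_snd I)
    then show ?thesis by (simp add: scaleR_prod_def sum_prod uminus_prod_def)
  qed
  ultimately show ?thesis unfolding shear_displacement_def by blast
qed

lemma shear_displacement_vertical:
  fixes A :: "real ^ 'n::finite"
  assumes A: "dual_lattice A"
  shows "shear_displacement (\<lambda>x. (0, (s * sin (A \<bullet> fst x + c)) *\<^sub>R A))"
proof -
  let ?v = "\<lambda>x :: real ^ 'n. s * cos (A \<bullet> x + c)"
  let ?u = "\<lambda>q :: real ^ 'n. - ((s * sin (A \<bullet> q + c)) *\<^sub>R A)"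
  let ?t = "\<lambda>t. ?v (rep_torus t)"
  have t: "?t \<circ> to_torus = ?v"
    by (rule to_torus_factor) (auto intro!: arg_cong2[where f = "(*)"] dual_lattice_cos_cong A)
  have u: "gradient (?t \<circ> to_torus) = ?u"
    unfolding t using gradient_cos_sum[of "\<lambda>_. s" "\<lambda>_. A" "\<lambda>_. c" "{0::nat}"] by (simp add: fun_eq_iff)
  have per: "?u x = ?u y" if "to_torus x = to_torus y" for x y
    using gradient_periodic[OF that, of ?t] unfolding u .
  have "\<exists>f. is_lift (\<lambda>(q, p). (q, p - ?u q)) f"
  proof -
    have "\<exists>f. is_lift (\<lambda>(q, p). (q, p + - ?u q)) f"
      by (rule ex_vertical) (rule arg_cong[where f = uminus], rule per)
    then show ?thesis by simp
  qed
  then obtain f where f: "is_lift (\<lambda>(q, p). (q, p - ?u q)) f" by blast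
  then have "f \<in> vertical_shears"
    unfolding vertical_shears_def using real_analytic_cos_sum[of "{0::nat}" "\<lambda>_. s" "\<lambda>_. A" "\<lambda>_. c"] u t
    by (auto intro!: exI[of _ ?t])
  then have "f \<in> shear_group"
    unfolding shear_group_def by (intro generate.incl) simp
  moreover have "is_lift (\<lambda>x. x + (0, (s * sin (A \<bullet> fst x + c)) *\<^sub>R A)) f"
    using f by (simp add: case_prod_unfold plus_prod_def)
  moreover have "bounded_smooth (\<lambda>x :: 'n cover. (0 :: real ^ 'n, (s * sin (A \<bullet> fst x + c)) *\<^sub>R A))"
  proof -
    have "bounded_smooth (\<lambda>x :: 'n cover. (s * sin (A \<bullet> fst x + c)) *\<^sub>R (0 :: real ^ 'n, A))"
      by (intro bounded_smooth_scaleR bounded_smooth_mult bounded_smooth_const bounded_smooth_sin_fst)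
    then show ?thesis by (simp add: scaleR_prod_def)
  qed
  ultimately show ?thesis unfolding shear_displacement_def by blast
qed

section \<open>Hamiltonians approximated by shears\<close>

definition ham_vf :: "('n::finite cover \<Rightarrow> real) \<Rightarrow> 'n cover \<Rightarrow> 'n cover" where
  "ham_vf k x = ((\<Sum>b\<in>Basis. pd (0, b) k x *\<^sub>R b), - (\<Sum>b\<in>Basis. pd (b, 0) k x *\<^sub>R b))"

lemma ham_vf_altdef:
  "ham_vf k x = (\<Sum>b\<in>Basis. pd (0, b) k x *\<^sub>R (b, 0)) - (\<Sum>b\<in>Basis. pd (b, 0) k x *\<^sub>R (0, b))"
  by (simp add: ham_vf_def scaleR_prod_def sum_prod minus_prod_def)

text \<open>One derivative is lost in passing to the field; the factor counts its summands.\<close>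

lemma Cr_bounded_hvf:
  fixes k :: "'n::finite cover \<Rightarrow> real"
  assumes "Cr_bounded (Suc r) M k"
  shows "Cr_bounded r (2 * real DIM(real ^ 'n) * M) (ham_vf k)"
proof -
  have L: "Cr_bounded r M (\<lambda>x. pd c k x *\<^sub>R v)" if "c \<in> Basis" "norm v = 1" for c v :: "'n cover"
    using Cr_bounded_linear[OF bounded_linear_scaleR_left, of v 1 r M "pd c k"] Cr_bounded_pd[OF assms that(1)] that(2) by simp
  have "Cr_bounded r ((\<Sum>b\<in>(Basis :: (real ^ 'n) set). M) + (\<Sum>b\<in>(Basis :: (real ^ 'n) set). M)) (ham_vf k)"
    unfolding ham_vf_altdef[abs_def]
    by (intro Cr_bounded_diff Cr_bounded_sum L) (auto simp: Basis_prod_def norm_prod_def)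
  then show ?thesis by (simp add: algebra_simps)
qed

lemma bounded_smooth_hvf: "bounded_smooth k \<Longrightarrow> bounded_smooth (ham_vf k)"
  unfolding bounded_smooth_def using Cr_bounded_hvf by blast

lemma ham_vf_eqI:
  assumes "(k has_derivative (\<lambda>h. a \<bullet> fst h + b \<bullet> snd h)) (at x)"
  shows "ham_vf k x = (b, - a)"
  unfolding ham_vf_def by (simp add: pd_eqI[OF assms] euclidean_representation)

lemma ham_vf_add:
  assumes "k differentiable (at x)" "l differentiable (at x)"
  shows "ham_vf (\<lambda>x. k x + l x) x = ham_vf k x + ham_vf l x"
  unfolding ham_vf_def by (simp add: pd_add[OF assms] sum.distrib scaleR_add_left)

lemma ham_vf_cmult:
  assumes "k differentiable (at x)"
  shows "ham_vf (\<lambda>x. c * k x) x = c *\<^sub>R ham_vf k x"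
  unfolding ham_vf_def
  by (simp add: pd_linear[OF assms bounded_linear_mult_right] scaleR_sum_right)

lemma ham_vf_diff:
  assumes "k differentiable (at x)" "l differentiable (at x)"
  shows "ham_vf (\<lambda>x. k x - l x) x = ham_vf k x - ham_vf l x"
  unfolding ham_vf_def by (simp add: pd_diff[OF assms] sum_subtractf scaleR_diff_left)

definition approximable :: "('n::finite cover \<Rightarrow> real) \<Rightarrow> bool" where
  "approximable k \<longleftrightarrow> bounded_smooth k \<and> (\<forall>r. \<forall>e>0. \<exists>t0>0. \<forall>t. 0 < t \<longrightarrow> t \<le> t0 \<longrightarrow>
     (\<exists>g. shear_displacement g \<and> Cr_bounded r (e * t) (\<lambda>x. g x - t *\<^sub>R ham_vf k x)))"

lemma gen_bounded_smooth: "approximable k \<Longrightarrow> bounded_smooth k"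
  by (simp add: approximable_def)

lemma approximableD: "approximable k \<Longrightarrow> 0 < e \<Longrightarrow> \<exists>t0>0. \<forall>t. 0 < t \<longrightarrow> t \<le> t0 \<longrightarrow>
     (\<exists>g. shear_displacement g \<and> Cr_bounded r (e * t) (\<lambda>x. g x - t *\<^sub>R ham_vf k x))"
  unfolding approximable_def by blast

lemma approximableI:
  assumes "bounded_smooth k" "\<And>r e. 0 < e \<Longrightarrow> \<exists>t0>0. \<forall>t. 0 < t \<longrightarrow> t \<le> t0 \<longrightarrow>
     (\<exists>g. shear_displacement g \<and> Cr_bounded r (e * t) (\<lambda>x. g x - t *\<^sub>R ham_vf k x))"
  shows "approximable k"
  using assms unfolding approximable_def by blast

text \<open>Approximants are composed. The error splits into that of \<open>g\<close>, that of
  \<open>h\<close> at the displaced point, and \<open>t\<close> times the change of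
  \<open>ham_vf l\<close> over the displacement \<open>g\<close>, which is itself of order
  \<open>t\<close>.\<close>

lemma approximable_add:
  fixes k l :: "'n::finite cover \<Rightarrow> real"
  assumes k: "approximable k" and l: "approximable l"
  shows "approximable (\<lambda>x. k x + l x)"
proof (rule approximableI)
  show "bounded_smooth (\<lambda>x. k x + l x)" using k l by (intro bounded_smooth_add gen_bounded_smooth)
  fix r and e :: real assume e: "0 < e"
  obtain M1 where M1: "Cr_bounded (Suc r) M1 (ham_vf k)" using bounded_smooth_hvf[OF gen_bounded_smooth[OF k]] unfolding bounded_smooth_def by blast
  obtain M2 where M2: "Cr_bounded (Suc r) M2 (ham_vf l)" using bounded_smooth_hvf[OF gen_bounded_smooth[OF l]] unfolding bounded_smooth_def by blast
  define M where "M = max M1 M2"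
  have M: "Cr_bounded (Suc r) M (ham_vf k)" "Cr_bounded (Suc r) M (ham_vf l)"
    using Cr_bounded_mono[OF M1, of M] Cr_bounded_mono[OF M2, of M] by (auto simp: M_def)
  have M0: "0 \<le> M" using Cr_bounded_nonneg[OF M(1)] .
  obtain A where A: "A \<ge> 0" "\<And>(u :: 'n cover \<Rightarrow> 'n cover) M w.
      Cr_bounded r M u \<Longrightarrow> Cr_bounded r 1 w \<Longrightarrow> Cr_bounded r (A * M) (\<lambda>x. u (x + w x))"
    using Cr_bounded_displaced[OF zero_le_one, of r, where 'a = "'n cover" and 'b = "'n cover"] by blast
  obtain B where B: "B \<ge> 0" "\<And>(u :: 'n cover \<Rightarrow> 'n cover) M (w :: 'n cover \<Rightarrow> 'n cover) w' d.
      Cr_bounded (Suc r) M u \<Longrightarrow> Cr_bounded r 1 w \<Longrightarrow> Cr_bounded r 1 w' \<Longrightarrow> Cr_bounded r d (\<lambda>x. w x - w' x) \<Longrightarrow>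
      Cr_bounded r (B * M * d) (\<lambda>x. u (x + w x) - u (x + w' x))"
    using Cr_bounded_displaced_diff[OF zero_le_one, of r, where 'a = "'n cover" and 'b = "'n cover"] by blast
  \<comment> \<open>The cap 1 bounds \<open>g\<close> by \<open>(1 + M) * t\<close>; the denominator
    of \<open>e2\<close> compensates the composition constant \<open>A\<close>.\<close>
  define e1 where "e1 = min 1 (e / 3)"
  define e2 where "e2 = e / (3 * (A + 1))"
  have e1: "0 < e1" "e1 \<le> 1" "e1 \<le> e / 3" and e2: "0 < e2" "A * e2 \<le> e / 3"
    using e A(1) by (auto simp: e1_def e2_def field_simps)
  obtain t1 where t1: "t1 > 0" "\<And>t. 0 < t \<Longrightarrow> t \<le> t1 \<Longrightarrow>
     (\<exists>g. shear_displacement g \<and> Cr_bounded r (e1 * t) (\<lambda>x. g x - t *\<^sub>R ham_vf k x))"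
    using approximableD[OF k e1(1), of r] by blast
  obtain t2 where t2: "t2 > 0" "\<And>t. 0 < t \<Longrightarrow> t \<le> t2 \<Longrightarrow>
     (\<exists>g. shear_displacement g \<and> Cr_bounded r (e2 * t) (\<lambda>x. g x - t *\<^sub>R ham_vf l x))"
    using approximableD[OF l e2(1), of r] by blast
  \<comment> \<open>The first bound keeps \<open>g\<close> at most 1, the radius for which
    \<open>A\<close> and \<open>B\<close> were obtained; the second makes the quadratic term at most
    \<open>e / 3 * t\<close>.\<close>
  define t3 where "t3 = min (1 / (1 + M)) (e / (3 * (B * M * (1 + M) + 1)))"
  have t3: "0 < t3" "(1 + M) * t3 \<le> 1" "B * M * (1 + M) * t3 \<le> e / 3"
  proof -
    have pos: "0 \<le> B * M * (1 + M)" using B(1) M0 by simp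
    show "0 < t3" using pos M0 e by (auto simp: t3_def intro!: divide_pos_pos)
    have "(1 + M) * t3 \<le> (1 + M) * (1 / (1 + M))" using M0 by (intro mult_left_mono) (auto simp: t3_def)
    then show "(1 + M) * t3 \<le> 1" using M0 by simp
    have "B * M * (1 + M) * t3 \<le> B * M * (1 + M) * (e / (3 * (B * M * (1 + M) + 1)))"
      using pos by (intro mult_left_mono) (auto simp: t3_def)
    also have "\<dots> \<le> e / 3" using pos e by (simp add: field_simps)
    finally show "B * M * (1 + M) * t3 \<le> e / 3" .
  qed
  have "\<exists>g. shear_displacement g \<and> Cr_bounded r (e * t) (\<lambda>x. g x - t *\<^sub>R ham_vf (\<lambda>x. k x + l x) x)"
    if t: "0 < t" "t \<le> min t1 (min t2 t3)" for t
  proof -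
    obtain g where g: "shear_displacement g" "Cr_bounded r (e1 * t) (\<lambda>x. g x - t *\<^sub>R ham_vf k x)" using t1(2)[of t] t by auto
    obtain h where h: "shear_displacement h" "Cr_bounded r (e2 * t) (\<lambda>x. h x - t *\<^sub>R ham_vf l x)" using t2(2)[of t] t by auto
    have "Cr_bounded r (e1 * t + M * t) (\<lambda>x. (g x - t *\<^sub>R ham_vf k x) + t *\<^sub>R ham_vf k x)"
      using t by (intro Cr_bounded_add g Cr_bounded_scaled Cr_bounded_SucD[OF M(1)]) auto
    moreover have "e1 * t + M * t \<le> (1 + M) * t"
      using e1 t by (simp add: algebra_simps)
    ultimately have gM: "Cr_bounded r ((1 + M) * t) g" using Cr_bounded_mono by auto
    have "(1 + M) * t \<le> (1 + M) * t3" using t M0 by (intro mult_left_mono) auto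
    with t3 have g1: "Cr_bounded r 1 g" by (intro Cr_bounded_mono[OF gM]) simp
    have a1: "Cr_bounded r (e1 * t + (A * (e2 * t) + B * M * ((1 + M) * t) * t))
      (\<lambda>x. (g x - t *\<^sub>R ham_vf k x) + ((h (x + g x) - t *\<^sub>R ham_vf l (x + g x)) +
        t *\<^sub>R (ham_vf l (x + g x) - ham_vf l (x + 0))))"
    proof (intro Cr_bounded_add)
      show "Cr_bounded r (A * (e2 * t)) (\<lambda>x. h (x + g x) - t *\<^sub>R ham_vf l (x + g x))"
        by (rule A(2)[OF h(2) g1])
      have "Cr_bounded r (B * M * ((1 + M) * t)) (\<lambda>x. ham_vf l (x + g x) - ham_vf l (x + 0))"
        by (rule B(2)[OF M(2) g1]) (auto intro: Cr_bounded_const gM)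
      then show "Cr_bounded r (B * M * ((1 + M) * t) * t) (\<lambda>x. t *\<^sub>R (ham_vf l (x + g x) - ham_vf l (x + 0)))"
        using t by (intro Cr_bounded_scaled) auto
    qed (rule g(2))
    have a2: "(g x - t *\<^sub>R ham_vf k x) + ((h (x + g x) - t *\<^sub>R ham_vf l (x + g x)) +
        t *\<^sub>R (ham_vf l (x + g x) - ham_vf l (x + 0))) = (g x + h (x + g x)) - t *\<^sub>R ham_vf (\<lambda>x. k x + l x) x" for x
      using k l by (simp add: ham_vf_add bounded_smooth_differentiable gen_bounded_smooth algebra_simps)
    have a3: "e1 * t + (A * (e2 * t) + B * M * ((1 + M) * t) * t) \<le> e * t"
    proof -
      have "B * M * ((1 + M) * t) \<le> B * M * ((1 + M) * t3)"
        using t B(1) M0 by (intro mult_left_mono) auto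
      then have "e1 + (A * e2 + B * M * ((1 + M) * t)) \<le> e"
        using e1(3) e2(2) t3(3) by (simp add: mult.assoc)
      from mult_right_mono[OF this, of t] t show ?thesis by (simp add: algebra_simps)
    qed
    have "Cr_bounded r (e * t) (\<lambda>x. (g x + h (x + g x)) - t *\<^sub>R ham_vf (\<lambda>x. k x + l x) x)"
      using Cr_bounded_mono[OF a1 a3] unfolding a2 .
    with shear_displacement_comp[OF g(1) h(1)] show ?thesis by blast
  qed
  then show "\<exists>t0>0. \<forall>t. 0 < t \<longrightarrow> t \<le> t0 \<longrightarrow>
     (\<exists>g. shear_displacement g \<and> Cr_bounded r (e * t) (\<lambda>x. g x - t *\<^sub>R ham_vf (\<lambda>x. k x + l x) x))"
    using t1(1) t2(1) t3(1) by (intro exI[of _ "min t1 (min t2 t3)"]) auto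
qed

lemma approximable_zero: "approximable (\<lambda>x :: 'n::finite cover. 0)"
proof (rule approximableI[OF bounded_smooth_const])
  fix r and e :: real assume "0 < e"
  have "ham_vf (\<lambda>x. 0) x = 0" for x :: "'n cover"
    using ham_vf_eqI[of "\<lambda>x. 0" 0 0 x] by (simp add: zero_prod_def)
  with \<open>0 < e\<close> shear_displacement_zero show "\<exists>t0>0. \<forall>t. 0 < t \<longrightarrow> t \<le> t0 \<longrightarrow>
     (\<exists>g. shear_displacement g \<and> Cr_bounded r (e * t) (\<lambda>x. g x - t *\<^sub>R ham_vf (\<lambda>x. 0 :: real) x :: 'n cover))"
    by (intro exI[of _ 1]) (auto intro!: exI[of _ "\<lambda>x. 0"] Cr_bounded_const)
qed

text \<open>Rescaling time: an approximant of \<open>k\<close> at time \<open>c * t\<close> serves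
  for \<open>c * k\<close> at time \<open>t\<close>, and times must stay positive.\<close>

lemma approximable_cmult:
  assumes k: "approximable k" and c: "0 \<le> c"
  shows "approximable (\<lambda>x. c * k x)"
proof (cases "c = 0")
  case True then show ?thesis by (simp add: approximable_zero)
next
  case False
  with c have c: "0 < c" by simp
  show ?thesis
  proof (rule approximableI)
    show "bounded_smooth (\<lambda>x. c * k x)" using k by (intro bounded_smooth_mult bounded_smooth_const gen_bounded_smooth)
    fix r and e :: real assume "0 < e"
    with c have "0 < e / c" by simp
    then obtain t1 where t1: "t1 > 0" "\<And>t. 0 < t \<Longrightarrow> t \<le> t1 \<Longrightarrow>
       (\<exists>g. shear_displacement g \<and> Cr_bounded r (e / c * t) (\<lambda>x. g x - t *\<^sub>R ham_vf k x))"
      using approximableD[OF k, of "e / c" r] by blast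
    have "\<exists>g. shear_displacement g \<and> Cr_bounded r (e * t) (\<lambda>x. g x - t *\<^sub>R ham_vf (\<lambda>x. c * k x) x)"
      if t: "0 < t" "t \<le> t1 / c" for t
    proof -
      have "0 < c * t" "c * t \<le> t1" using t c by (auto simp: field_simps)
      from t1(2)[OF this] c k show ?thesis
        by (simp add: ham_vf_cmult bounded_smooth_differentiable gen_bounded_smooth mult.commute)
    qed
    with t1(1) c show "\<exists>t0>0. \<forall>t. 0 < t \<longrightarrow> t \<le> t0 \<longrightarrow>
       (\<exists>g. shear_displacement g \<and> Cr_bounded r (e * t) (\<lambda>x. g x - t *\<^sub>R ham_vf (\<lambda>x. c * k x) x))"
      by (intro exI[of _ "t1 / c"]) auto
  qed
qed

text \<open>The threshold for \<open>t\<close> may depend on \<open>l\<close>, since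
  \<open>l\<close> is fixed by \<open>r\<close> and \<open>e\<close> before \<open>t\<close>
  is.\<close>

lemma approximable_limit:
  fixes k :: "'n::finite cover \<Rightarrow> real"
  assumes k: "bounded_smooth k" and lim: "\<And>r e. 0 < e \<Longrightarrow> \<exists>l. approximable l \<and> Cr_bounded r e (\<lambda>x. k x - l x)"
  shows "approximable k"
proof (rule approximableI[OF k])
  fix r and e :: real assume e: "0 < e"
  let ?D = "2 * real DIM(real ^ 'n)"
  have "0 < e / (2 * ?D)" using e by simp
  then obtain l where l: "approximable l" "Cr_bounded (Suc r) (e / (2 * ?D)) (\<lambda>x. k x - l x)" using lim by blast
  have "Cr_bounded r (e / 2) (\<lambda>x. ham_vf k x - ham_vf l x)"
  proof -
    have "ham_vf (\<lambda>x. k x - l x) = (\<lambda>x. ham_vf k x - ham_vf l x)"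
      using ham_vf_diff[OF bounded_smooth_differentiable[OF k] bounded_smooth_differentiable[OF gen_bounded_smooth[OF l(1)]]] by blast
    then show ?thesis using Cr_bounded_hvf[OF l(2)] by simp
  qed
  then have 1: "Cr_bounded r (e / 2) (\<lambda>x. ham_vf l x - ham_vf k x)" using Cr_bounded_minus[of r "e / 2"] by fastforce
  obtain t1 where t1: "t1 > 0" "\<And>t. 0 < t \<Longrightarrow> t \<le> t1 \<Longrightarrow>
     (\<exists>g. shear_displacement g \<and> Cr_bounded r (e / 2 * t) (\<lambda>x. g x - t *\<^sub>R ham_vf l x))"
    using approximableD[OF l(1), of "e / 2" r] e by auto
  have "\<exists>g. shear_displacement g \<and> Cr_bounded r (e * t) (\<lambda>x. g x - t *\<^sub>R ham_vf k x)" if t: "0 < t" "t \<le> t1" for t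
  proof -
    obtain g where g: "shear_displacement g" "Cr_bounded r (e / 2 * t) (\<lambda>x. g x - t *\<^sub>R ham_vf l x)" using t1(2)[OF t] by blast
    have "Cr_bounded r (e / 2 * t) (\<lambda>x. t *\<^sub>R (ham_vf l x - ham_vf k x))" using t by (intro Cr_bounded_scaled 1) simp
    from Cr_bounded_add[OF g(2) this] have "Cr_bounded r (e * t) (\<lambda>x. g x - t *\<^sub>R ham_vf k x)"
      by (simp add: algebra_simps)
    with g(1) show ?thesis by blast
  qed
  with t1(1) show "\<exists>t0>0. \<forall>t. 0 < t \<longrightarrow> t \<le> t0 \<longrightarrow>
     (\<exists>g. shear_displacement g \<and> Cr_bounded r (e * t) (\<lambda>x. g x - t *\<^sub>R ham_vf k x))" by blast
qed

text \<open>Extraction of a leading coefficient: \<open>D s / s ^ j\<close> is approximable by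
  positive scaling and converges to \<open>k\<close> in every order as \<open>s\<close> tends to
  0.\<close>

lemma approximable_expansion:
  assumes k: "bounded_smooth k" and D: "\<And>s. 0 < s \<Longrightarrow> s \<le> 1 \<Longrightarrow> approximable (D s)"
    and b: "\<And>r. Cr_big_O r (Suc j) (\<lambda>s x. D s x - s ^ j * k x)"
  shows "approximable k"
proof (rule approximable_limit[OF k])
  fix r and e :: real assume e: "0 < e"
  obtain K where K: "0 \<le> K" "\<And>t. 0 \<le> t \<Longrightarrow> t \<le> 1 \<Longrightarrow> Cr_bounded r (K * t ^ Suc j) (\<lambda>x. D t x - t ^ j * k x)"
    using Cr_big_OE[OF b] by blast
  define s where "s = min 1 (e / (K + 1))"
  have s: "0 < s" "s \<le> 1" using e K(1) by (auto simp: s_def)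
  have "K * s \<le> K * (e / (K + 1))" using K(1) by (intro mult_left_mono) (auto simp: s_def)
  also have "\<dots> \<le> e" using K(1) e by (simp add: field_simps)
  finally have Ks: "K * s \<le> e" .
  have "Cr_bounded r (\<bar>- (1 / s ^ j)\<bar> * (K * s ^ Suc j)) (\<lambda>x. - (1 / s ^ j) * (D s x - s ^ j * k x))"
    using s by (intro Cr_bounded_mult_const K) auto
  then have "Cr_bounded r (K * s) (\<lambda>x. k x - 1 / s ^ j * D s x)"
    using s by (simp add: algebra_simps)
  then show "\<exists>l. approximable l \<and> Cr_bounded r e (\<lambda>x. k x - l x)"
    using approximable_cmult[OF D[OF s], of "1 / s ^ j"] Cr_bounded_mono[OF _ Ks] s(1) by auto
qed

lemma approximable_shear_family:
  assumes k: "bounded_smooth k" and g: "\<And>t. shear_displacement (g t)"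
    and b: "\<And>r. Cr_big_O r (Suc (Suc 0)) (\<lambda>t x. g t x - t *\<^sub>R ham_vf k x)"
  shows "approximable k"
proof (rule approximableI[OF k])
  fix r and e :: real assume e: "0 < e"
  obtain K where K: "0 \<le> K" "\<And>t. 0 \<le> t \<Longrightarrow> t \<le> 1 \<Longrightarrow> Cr_bounded r (K * t ^ Suc (Suc 0)) (\<lambda>x. g t x - t *\<^sub>R ham_vf k x)"
    using Cr_big_OE[OF b] by blast
  define t0 where "t0 = min 1 (e / (K + 1))"
  have t0: "0 < t0" "t0 \<le> 1" using e K(1) by (auto simp: t0_def)
  have "K * t0 \<le> K * (e / (K + 1))" using K(1) by (intro mult_left_mono) (auto simp: t0_def)
  also have "\<dots> \<le> e" using K(1) e by (simp add: field_simps)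
  finally have Kt: "K * t0 \<le> e" .
  have "Cr_bounded r (e * t) (\<lambda>x. g t x - t *\<^sub>R ham_vf k x)" if t: "0 < t" "t \<le> t0" for t
  proof (rule Cr_bounded_mono[OF K(2)])
    have "K * t \<le> e" using mult_left_mono[OF t(2) K(1)] Kt by simp
    from mult_right_mono[OF this, of t] t show "K * t ^ Suc (Suc 0) \<le> e * t" by (simp add: mult_ac)
  qed (use t t0 in auto)
  with t0(1) g show "\<exists>t0>0. \<forall>t. 0 < t \<longrightarrow> t \<le> t0 \<longrightarrow>
     (\<exists>g. shear_displacement g \<and> Cr_bounded r (e * t) (\<lambda>x. g x - t *\<^sub>R ham_vf k x))" by blast
qed

text \<open>Let T be the horizontal shear with displacement \<open>?w\<close>, and V the vertical
  shear that is the time-\<open>t\<close> map of \<open>cos (A \<bullet> q + c)\<close>. Since T is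
  symplectic, conjugating V by T gives the time-\<open>t\<close> map of that function composed with
  T, and \<open>A \<bullet> ?w p\<close> is minus the sum inside the cosine.\<close>

lemma approximable_ridge:
  fixes A :: "real ^ 'n::finite" and B :: "'i \<Rightarrow> real ^ 'n"
  assumes A: "dual_lattice A" and I: "finite I" "\<And>i. i \<in> I \<Longrightarrow> dual_lattice (B i)"
  shows "approximable (\<lambda>x. cos (A \<bullet> fst x + c - (\<Sum>i\<in>I. s i * (A \<bullet> B i) * sin (B i \<bullet> snd x + d i))))"
proof -
  let ?f = "\<lambda>x :: 'n cover. \<Sum>i\<in>I. s i * (A \<bullet> B i) * sin (B i \<bullet> snd x + d i)"
  let ?k = "\<lambda>x. cos (A \<bullet> fst x + c - ?f x)"
  let ?w = "\<lambda>p. - (\<Sum>i\<in>I. (s i * sin (B i \<bullet> p + d i)) *\<^sub>R B i)"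
  define y where "y = (\<lambda>x. sin (A \<bullet> fst x + c - ?f x))"
  \<comment> \<open>The displacement of the conjugate: \<open>p\<close> moves by
    \<open>t * y x\<close> along \<open>A\<close>, while \<open>q\<close> moves by \<open>?w\<close>
    at the old momentum and back by \<open>?w\<close> at the new one.\<close>
  define g where "g = (\<lambda>t x. (?w (snd x) + - ?w (snd x + (t * y x) *\<^sub>R A), (t * y x) *\<^sub>R A))"
  have f: "bounded_smooth ?f" by (intro bounded_smooth_sum I bounded_smooth_mult bounded_smooth_const bounded_smooth_sin_snd)
  have k: "bounded_smooth ?k" unfolding cos_diff
    by (intro bounded_smooth_add bounded_smooth_mult bounded_smooth_cos_fst bounded_smooth_sin_fst bounded_smooth_cos[OF f] bounded_smooth_sin[OF f])
  have y: "bounded_smooth y" unfolding y_def sin_diff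
    by (intro bounded_smooth_diff bounded_smooth_mult bounded_smooth_cos_fst bounded_smooth_sin_fst bounded_smooth_cos[OF f] bounded_smooth_sin[OF f])
  have Aw: "A \<bullet> (q + ?w p) + c = A \<bullet> q + c - (\<Sum>i\<in>I. s i * (A \<bullet> B i) * sin (B i \<bullet> p + d i))" for q p
    by (simp add: inner_diff_right inner_sum_right mult_ac)
  have g: "shear_displacement (g t)" for t
  proof -
    let ?T = "\<lambda>x :: 'n cover. (?w (snd x), 0 :: real ^ 'n)"
    \<comment> \<open>The inverse of the shear \<open>?T\<close>: the same potential with the
      opposite sign.\<close>
    let ?T' = "\<lambda>x :: 'n cover. (- (\<Sum>i\<in>I. (- s i * sin (B i \<bullet> snd x + d i)) *\<^sub>R B i), 0 :: real ^ 'n)"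
    let ?V = "\<lambda>x :: 'n cover. (0 :: real ^ 'n, (t * sin (A \<bullet> fst x + c)) *\<^sub>R A)"
    let ?TV = "\<lambda>x. ?T x + ?V (x + ?T x)"
    have "shear_displacement (\<lambda>x. ?TV x + ?T' (x + ?TV x))"
      by (intro shear_displacement_comp shear_displacement_horizontal shear_displacement_vertical A I)
    moreover have "(\<lambda>x. ?TV x + ?T' (x + ?TV x)) = g t"
    proof
      fix x
      have TV: "?TV x = (?w (snd x), (t * y x) *\<^sub>R A)"
        unfolding y_def by (simp only: plus_prod_def fst_conv snd_conv Aw add_0_right add_0_left)
      show "?TV x + ?T' (x + ?TV x) = g t x"
        unfolding TV g_def by (simp add: sum_negf)
    qed
    ultimately show ?thesis by simp
  qed
  have dk: "(?k has_derivative (\<lambda>h. (- y x *\<^sub>R A) \<bullet> fst h +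
      (y x *\<^sub>R (\<Sum>i\<in>I. (s i * (A \<bullet> B i) * cos (B i \<bullet> snd x + d i)) *\<^sub>R B i)) \<bullet> snd h)) (at x)" for x
    unfolding y_def
    by (rule derivative_eq_intros refl | simp)+
      (simp add: fun_eq_iff inner_sum_left algebra_simps sum_distrib_left)
  have hk: "ham_vf ?k x = (y x *\<^sub>R (\<Sum>i\<in>I. (s i * (A \<bullet> B i) * cos (B i \<bullet> snd x + d i)) *\<^sub>R B i), y x *\<^sub>R A)" for x
    using ham_vf_eqI[OF dk[of x]] by simp
  \<comment> \<open>The momentum component leaves no remainder; in the position component the
    addition theorem isolates the second order remainders of sine and cosine.\<close>
  have e: "g t x - t *\<^sub>R ham_vf ?k x =
    (\<Sum>i\<in>I. (sin (B i \<bullet> snd x + d i) * (cos (t * ((A \<bullet> B i) * y x)) - 1) +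
      cos (B i \<bullet> snd x + d i) * (sin (t * ((A \<bullet> B i) * y x)) - t * ((A \<bullet> B i) * y x))) *\<^sub>R (s i *\<^sub>R B i, 0))" for t x
  proof -
    let ?P = "\<lambda>i. s i * sin (B i \<bullet> (snd x + (t * y x) *\<^sub>R A) + d i)"
    let ?Q = "\<lambda>i. s i * sin (B i \<bullet> snd x + d i)"
    let ?R = "\<lambda>i. s i * (A \<bullet> B i) * cos (B i \<bullet> snd x + d i)"
    have "fst (g t x - t *\<^sub>R ham_vf ?k x) =
        (\<Sum>i\<in>I. ?P i *\<^sub>R B i) - (\<Sum>i\<in>I. ?Q i *\<^sub>R B i) - (t * y x) *\<^sub>R (\<Sum>i\<in>I. ?R i *\<^sub>R B i)"
      unfolding g_def hk by simp
    also have "\<dots> = (\<Sum>i\<in>I. (?P i - ?Q i - t * y x * ?R i) *\<^sub>R B i)"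
      by (simp add: scaleR_sum_right sum_subtractf scaleR_diff_left)
    also have "\<dots> = (\<Sum>i\<in>I. (sin (B i \<bullet> snd x + d i) * (cos (t * ((A \<bullet> B i) * y x)) - 1) +
      cos (B i \<bullet> snd x + d i) * (sin (t * ((A \<bullet> B i) * y x)) - t * ((A \<bullet> B i) * y x))) *\<^sub>R (s i *\<^sub>R B i))"
    proof (rule sum.cong[OF refl])
      fix i
      have *: "B i \<bullet> (snd x + (t * y x) *\<^sub>R A) + d i = (B i \<bullet> snd x + d i) + t * ((A \<bullet> B i) * y x)"
        by (simp add: inner_add_right inner_commute mult_ac)
      show "(?P i - ?Q i - t * y x * ?R i) *\<^sub>R B i =
        (sin (B i \<bullet> snd x + d i) * (cos (t * ((A \<bullet> B i) * y x)) - 1) +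
      cos (B i \<bullet> snd x + d i) * (sin (t * ((A \<bullet> B i) * y x)) - t * ((A \<bullet> B i) * y x))) *\<^sub>R (s i *\<^sub>R B i)"
        unfolding * sin_add[of "B i \<bullet> snd x + d i"] scaleR_scaleR
        by (intro arg_cong2[where f = scaleR] refl) (simp add: algebra_simps)
    qed
    finally have 1: "fst (g t x - t *\<^sub>R ham_vf ?k x) = \<dots>" .
    have 2: "snd (g t x - t *\<^sub>R ham_vf ?k x) = 0"
      unfolding g_def hk by simp
    show ?thesis
      by (rule prod_eqI) (simp_all only: 1 2 fst_sum snd_sum fst_scaleR snd_scaleR fst_conv snd_conv scaleR_zero_right sum.neutral_const)
  qed
  show ?thesis
  proof (rule approximable_shear_family[OF k g])
    fix r
    have z: "bounded_smooth (\<lambda>x. (A \<bullet> B i) * y x)" for i by (intro bounded_smooth_mult bounded_smooth_const y)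
    have S: "Cr_big_O r (0 + Suc (Suc 0)) (\<lambda>t x. sin (B i \<bullet> snd x + d i) * (cos (t * ((A \<bullet> B i) * y x)) - 1))"
      and C: "Cr_big_O r (0 + Suc (Suc 0)) (\<lambda>t x. cos (B i \<bullet> snd x + d i) *
          (sin (t * ((A \<bullet> B i) * y x)) - t * ((A \<bullet> B i) * y x)))" for i
      by (rule Cr_big_O_mult[OF Cbig_bounded_smooth[OF bounded_smooth_sin_snd] Cr_big_O_cos_minus_one[OF z]],
          rule Cr_big_O_mult[OF Cbig_bounded_smooth[OF bounded_smooth_cos_snd] Cr_big_O_sin_minus[OF z]])
    have "Cr_big_O r (Suc (Suc 0) + 0) (\<lambda>t x. (sin (B i \<bullet> snd x + d i) * (cos (t * ((A \<bullet> B i) * y x)) - 1) +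
      cos (B i \<bullet> snd x + d i) * (sin (t * ((A \<bullet> B i) * y x)) - t * ((A \<bullet> B i) * y x))) *\<^sub>R (s i *\<^sub>R B i, 0 :: real ^ 'n))" for i
      using Cr_big_O_add[OF S C] by (intro Cr_big_O_scaleR Cbig_bounded_smooth bounded_smooth_const) simp
    then show "Cr_big_O r (Suc (Suc 0)) (\<lambda>t x. g t x - t *\<^sub>R ham_vf ?k x)"
      unfolding e by (intro Cr_big_O_sum I) simp
  qed
qed

section \<open>Trigonometric Hamiltonians\<close>

lemma dual_lattice_add: "dual_lattice A \<Longrightarrow> dual_lattice B \<Longrightarrow> dual_lattice (A + B)"
  unfolding dual_lattice_def by (metis vector_add_component of_int_add distrib_left)

lemma dual_lattice_diff: "dual_lattice A \<Longrightarrow> dual_lattice B \<Longrightarrow> dual_lattice (A - B)"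
  unfolding dual_lattice_def by (metis vector_minus_component of_int_diff right_diff_distrib)

lemma dual_lattice_zero: "dual_lattice 0"
  unfolding dual_lattice_def by (auto intro: exI[of _ 0])

text \<open>The time-\<open>t\<close> map is itself a shear, so the remainder is zero; the sum over
  one index only fits the form of \<open>shear_displacement_horizontal\<close>.\<close>

lemma approximable_horizontal:
  fixes B :: "real ^ 'n::finite"
  assumes B: "dual_lattice B"
  shows "approximable (\<lambda>x. s * cos (B \<bullet> snd x + d))"
proof -
  let ?k = "\<lambda>x :: 'n cover. s * cos (B \<bullet> snd x + d)"
  let ?g = "\<lambda>t (x :: 'n cover). (- (\<Sum>i\<in>{0::nat}. (t * s * sin (B \<bullet> snd x + d)) *\<^sub>R B), 0 :: real ^ 'n)"
  have "(?k has_derivative (\<lambda>h. 0 \<bullet> fst h + (- (s * sin (B \<bullet> snd x + d)) *\<^sub>R B) \<bullet> snd h)) (at x)" for x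
    by (auto intro!: derivative_eq_intros)
  from ham_vf_eqI[OF this] have h: "ham_vf ?k x = (- (s * sin (B \<bullet> snd x + d)) *\<^sub>R B, 0)" for x
    by simp
  have e: "?g t x - t *\<^sub>R ham_vf ?k x = 0" for t x
    unfolding h by (simp add: zero_prod_def)
  show ?thesis
  proof (rule approximable_shear_family)
    show "bounded_smooth ?k" by (intro bounded_smooth_mult bounded_smooth_const bounded_smooth_cos_snd)
    show "shear_displacement (?g t)" for t
      using B by (intro shear_displacement_horizontal) auto
    show "Cr_big_O r (Suc (Suc 0)) (\<lambda>t x. ?g t x - t *\<^sub>R ham_vf ?k x)" for r
      unfolding e by (rule Cr_big_OI[of 0]) (auto intro: Cr_bounded_const)
  qed
qed

lemma approximable_vertical: "dual_lattice A \<Longrightarrow> approximable (\<lambda>x. cos (A \<bullet> fst x + c))"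
  using approximable_ridge[of A "{} :: nat set"] by simp

text \<open>Negative factors come from \<open>cos (\<theta> + pi) = - cos \<theta>\<close>, which is
  why the hypothesis ranges over all phases \<open>c\<close>.\<close>

lemma approximable_phase_scale:
  assumes "\<And>c. approximable (\<lambda>x. b * (cos (A \<bullet> fst x + c) * u x))" "b \<noteq> 0"
  shows "approximable (\<lambda>x. s * (cos (A \<bullet> fst x + c) * u x))"
proof (cases "0 \<le> s / b")
  case True
  then show ?thesis using approximable_cmult[OF assms(1)[of c] True] assms(2) by simp
next
  case False
  have g: "approximable (\<lambda>x. - (s / b) * (b * (cos (A \<bullet> fst x + (c + pi)) * u x)))"
    using False by (intro approximable_cmult assms(1)) simp
  have n: "cos (A \<bullet> fst x + (c + pi)) = - cos (A \<bullet> fst x + c)" for x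
    using cos_periodic_pi[of "A \<bullet> fst x + c"] by (simp only: add.assoc)
  have "approximable (\<lambda>x. - (s / b) * (b * (- cos (A \<bullet> fst x + c) * u x)))" using g unfolding n .
  moreover have "- (s / b) * (b * (- cos (A \<bullet> fst x + c) * u x)) = s * (cos (A \<bullet> fst x + c) * u x)" for x
    using assms(2) by simp
  ultimately show ?thesis by simp
qed

lemma bounded_smooth_ridge_arg:
  fixes B :: "'i \<Rightarrow> real ^ 'n::finite"
  assumes "finite I"
  shows "bounded_smooth (\<lambda>x :: 'n cover. \<Sum>i\<in>I. s i * (A \<bullet> B i) * sin (B i \<bullet> snd x + d i))"
  by (intro bounded_smooth_sum assms bounded_smooth_mult bounded_smooth_const bounded_smooth_sin_snd)

text \<open>With \<open>\<theta> = A \<bullet> q + c + pi / 2\<close>, the difference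
  \<open>cos (\<theta> - s * z) - cos \<theta>\<close> is \<open>s * sin \<theta> * z\<close> up to
  second order. The factor \<open>A \<bullet> B\<close> of \<open>z\<close> is divided out
  afterwards, and the shifts by \<open>pi / 2\<close> turn sines into cosines.\<close>

lemma approximable_first_order:
  fixes A B :: "real ^ 'n::finite"
  assumes A: "dual_lattice A" and B: "dual_lattice B" and AB: "A \<bullet> B \<noteq> 0"
  shows "approximable (\<lambda>x. s * (cos (A \<bullet> fst x + c) * cos (B \<bullet> snd x + d)))"
proof (rule approximable_phase_scale[OF _ AB])
  fix c
  let ?th = "\<lambda>x :: 'n cover. A \<bullet> fst x + (c + pi / 2)" and ?z = "\<lambda>x :: 'n cover. (A \<bullet> B) * sin (B \<bullet> snd x + (d + pi / 2))"
  have z: "bounded_smooth ?z" by (intro bounded_smooth_mult bounded_smooth_const bounded_smooth_sin_snd)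
  have "approximable (\<lambda>x. sin (?th x) * ?z x)"
  proof (rule approximable_expansion[where j = "Suc 0"])
    show "bounded_smooth (\<lambda>x. sin (?th x) * ?z x)" by (intro bounded_smooth_mult z bounded_smooth_sin_fst)
    show "approximable (\<lambda>x. cos (?th x - s * ?z x) + cos (A \<bullet> fst x + (c + pi / 2 + pi)))" for s
      using approximable_ridge[OF A, of "{0::nat}" "\<lambda>_. B" "c + pi / 2" "\<lambda>_. s" "\<lambda>_. d + pi / 2"] B
      by (intro approximable_add approximable_vertical A) (simp add: mult.assoc)
    have e: "cos (?th x - s * ?z x) + cos (A \<bullet> fst x + (c + pi / 2 + pi)) - s ^ Suc 0 * (sin (?th x) * ?z x)
      = cos (?th x) * (cos (s * ?z x) - 1) + sin (?th x) * (sin (s * ?z x) - s * ?z x)" for s x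
    proof -
      have "cos (A \<bullet> fst x + (c + pi / 2 + pi)) = - cos (?th x)"
        using cos_periodic_pi[of "?th x"] by (simp only: add.assoc)
      then show ?thesis unfolding cos_diff by (simp add: algebra_simps)
    qed
    show "Cr_big_O r (Suc (Suc 0)) (\<lambda>s x. cos (?th x - s * ?z x) + cos (A \<bullet> fst x + (c + pi / 2 + pi))
        - s ^ Suc 0 * (sin (?th x) * ?z x))" for r
      unfolding e
      using Cr_big_O_add[OF Cr_big_O_mult[OF Cbig_bounded_smooth[OF bounded_smooth_cos_fst] Cr_big_O_cos_minus_one[OF z]]
        Cr_big_O_mult[OF Cbig_bounded_smooth[OF bounded_smooth_sin_fst] Cr_big_O_sin_minus[OF z]]] by simp
  qed
  moreover have "sin (?th x) * ?z x = A \<bullet> B * (cos (A \<bullet> fst x + c) * cos (B \<bullet> snd x + d))" for x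
    using sin_add[of "A \<bullet> fst x + c" "pi / 2"] sin_add[of "B \<bullet> snd x + d" "pi / 2"]
    by (simp add: add.assoc)
  ultimately show "approximable (\<lambda>x. A \<bullet> B * (cos (A \<bullet> fst x + c) * cos (B \<bullet> snd x + d)))" by simp
qed

text \<open>The symmetric second difference in \<open>s\<close> equals
  \<open>2 * cos \<theta> * (cos (s * z) - 1)\<close>, where the coefficient of
  \<open>s\<^sup>2\<close> is \<open>- z\<^sup>2 * cos \<theta>\<close>.\<close>

lemma approximable_square:
  fixes A :: "real ^ 'n::finite" and B :: "'i \<Rightarrow> real ^ 'n"
  assumes A: "dual_lattice A" and I: "finite I" "\<And>i. i \<in> I \<Longrightarrow> dual_lattice (B i)"
  shows "approximable (\<lambda>x. - ((\<Sum>i\<in>I. A \<bullet> B i * sin (B i \<bullet> snd x + d i))\<^sup>2 * cos (A \<bullet> fst x + c)))"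
proof -
  let ?th = "\<lambda>x :: 'n cover. A \<bullet> fst x + c" and ?z = "\<lambda>x :: 'n cover. \<Sum>i\<in>I. A \<bullet> B i * sin (B i \<bullet> snd x + d i)"
  have z: "bounded_smooth ?z" using bounded_smooth_ridge_arg[OF I(1), of "\<lambda>_. 1"] by simp
  show ?thesis
  proof (rule approximable_expansion[where j = "Suc (Suc 0)"])
    show "bounded_smooth (\<lambda>x. - ((?z x)\<^sup>2 * cos (?th x)))"
      unfolding power2_eq_square by (intro bounded_smooth_minus bounded_smooth_mult z bounded_smooth_cos_fst)
    have R: "approximable (\<lambda>x. cos (?th x - s * ?z x))" for s
      using approximable_ridge[OF A I, where s = "\<lambda>_. s" and c = c and d = d] by (simp add: sum_distrib_left mult.assoc)
    show "approximable (\<lambda>x. cos (?th x - s * ?z x) + (cos (?th x - (- s) * ?z x) + 2 * cos (A \<bullet> fst x + (c + pi))))" for s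
      by (intro approximable_add R approximable_cmult approximable_vertical A) simp
    have e: "cos (?th x - s * ?z x) + (cos (?th x - (- s) * ?z x) + 2 * cos (A \<bullet> fst x + (c + pi))) -
        s ^ Suc (Suc 0) * (- ((?z x)\<^sup>2 * cos (?th x))) =
        (2 * cos (?th x)) * (cos (s * ?z x) - 1 + (s * ?z x)\<^sup>2 / 2)" for s x
    proof -
      have "cos (A \<bullet> fst x + (c + pi)) = - cos (?th x)"
        using cos_periodic_pi[of "?th x"] by (simp only: add.assoc)
      then show ?thesis unfolding cos_diff by (simp add: algebra_simps power2_eq_square)
    qed
    show "Cr_big_O r (Suc (Suc (Suc 0))) (\<lambda>s x. cos (?th x - s * ?z x) +
        (cos (?th x - (- s) * ?z x) + 2 * cos (A \<bullet> fst x + (c + pi))) -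
        s ^ Suc (Suc 0) * (- ((?z x)\<^sup>2 * cos (?th x))))" for r
      unfolding e
      using Cr_big_O_mult[OF Cbig_bounded_smooth[OF bounded_smooth_mult[OF bounded_smooth_const bounded_smooth_cos_fst]] Cr_big_O_cos_quadratic[OF z]] by simp
  qed
qed

text \<open>Polarization: \<open>(z1 + z2)\<^sup>2 - z1\<^sup>2 - z2\<^sup>2\<close> is the mixed
  term, and the sign of the first square is reversed by the phase \<open>pi\<close>.\<close>

lemma approximable_second_order:
  assumes A: "dual_lattice A" and B: "dual_lattice B1" "dual_lattice B2" and AB: "A \<bullet> B1 \<noteq> 0" "A \<bullet> B2 \<noteq> 0"
  shows "approximable (\<lambda>x. s * (cos (A \<bullet> fst x + c) * (sin (B1 \<bullet> snd x + d1) * sin (B2 \<bullet> snd x + d2))))"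
proof (rule approximable_phase_scale)
  show "2 * (A \<bullet> B1) * (A \<bullet> B2) \<noteq> 0" using AB by simp
  fix c
  let ?B = "\<lambda>i :: nat. if i = 0 then B1 else B2" and ?d = "\<lambda>i :: nat. if i = 0 then d1 else d2"
  have S: "approximable (\<lambda>x. - ((\<Sum>i\<in>I. A \<bullet> ?B i * sin (?B i \<bullet> snd x + ?d i))\<^sup>2 * cos (A \<bullet> fst x + c)))"
    if "finite I" for I and c
    using that B by (intro approximable_square A) auto
  have n: "cos (A \<bullet> fst x + (c + pi)) = - cos (A \<bullet> fst x + c)" for x
    using cos_periodic_pi[of "A \<bullet> fst x + c"] by (simp only: add.assoc)
  have "approximable (\<lambda>x. - ((\<Sum>i\<in>{0, 1}. A \<bullet> ?B i * sin (?B i \<bullet> snd x + ?d i))\<^sup>2 * cos (A \<bullet> fst x + (c + pi))) +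
     (- ((\<Sum>i\<in>{0}. A \<bullet> ?B i * sin (?B i \<bullet> snd x + ?d i))\<^sup>2 * cos (A \<bullet> fst x + c)) +
      - ((\<Sum>i\<in>{1}. A \<bullet> ?B i * sin (?B i \<bullet> snd x + ?d i))\<^sup>2 * cos (A \<bullet> fst x + c))))"
    by (intro approximable_add S) auto
  then show "approximable (\<lambda>x. 2 * (A \<bullet> B1) * (A \<bullet> B2) *
      (cos (A \<bullet> fst x + c) * (sin (B1 \<bullet> snd x + d1) * sin (B2 \<bullet> snd x + d2))))"
    unfolding n by (simp add: algebra_simps power2_eq_square)
qed

text \<open>If \<open>A \<bullet> B = 0\<close>, the bracket of \<open>cos (A \<bullet> q)\<close> and \<open>cos (B \<bullet> p)\<close> vanishes; the resonant product
  comes from the second order term with \<open>B = A + (B - A)\<close>.\<close>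

lemma approximable_product:
  assumes A: "dual_lattice A" "A \<noteq> 0" and B: "dual_lattice B"
  shows "approximable (\<lambda>x. s * (cos (A \<bullet> fst x + c) * cos (B \<bullet> snd x + d)))"
proof (cases "A \<bullet> B = 0")
  case False
  then show ?thesis using A B by (intro approximable_first_order)
next
  case True
  \<comment> \<open>Because \<open>A \<bullet> B = 0\<close>, the three products are
    \<open>2 * (A \<bullet> A)\<close>, \<open>A \<bullet> A\<close> and
    \<open>- (A \<bullet> A)\<close>.\<close>
  have "A \<bullet> (A + A - B) \<noteq> 0" "A \<bullet> A \<noteq> 0" "A \<bullet> (B - A) \<noteq> 0"
    using A(2) True unfolding inner_diff_right inner_add_right by auto
  then have g: "approximable (\<lambda>x. s * (cos (A \<bullet> fst x + c) * cos ((A + A - B) \<bullet> snd x + - d)) +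
      - 2 * s * (cos (A \<bullet> fst x + c) * (sin (A \<bullet> snd x + 0) * sin ((B - A) \<bullet> snd x + d))))"
    by (intro approximable_add approximable_first_order approximable_second_order dual_lattice_add dual_lattice_diff A B) auto
  \<comment> \<open>This is \<open>cos (X + Y) = cos (X - Y) - 2 * sin X * sin Y\<close> with
    \<open>X = A \<bullet> snd x\<close> and \<open>Y = (B - A) \<bullet> snd x + d\<close>.\<close>
  have e: "cos (B \<bullet> snd x + d) =
      cos ((A + A - B) \<bullet> snd x + - d) - 2 * (sin (A \<bullet> snd x + 0) * sin ((B - A) \<bullet> snd x + d))" for x
  proof -
    have 1: "B \<bullet> snd x + d = A \<bullet> snd x + ((B - A) \<bullet> snd x + d)"
      by (simp add: inner_diff_left)
    have 2: "(A + A - B) \<bullet> snd x + - d = A \<bullet> snd x - ((B - A) \<bullet> snd x + d)"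
      unfolding inner_diff_left inner_add_left by simp
    show ?thesis unfolding 1 2 cos_add cos_diff by simp
  qed
  have "(\<lambda>x. s * (cos (A \<bullet> fst x + c) * cos (B \<bullet> snd x + d))) =
    (\<lambda>x. s * (cos (A \<bullet> fst x + c) * cos ((A + A - B) \<bullet> snd x + - d)) +
      - 2 * s * (cos (A \<bullet> fst x + c) * (sin (A \<bullet> snd x + 0) * sin ((B - A) \<bullet> snd x + d))))"
    unfolding e by (intro ext) algebra
  with g show ?thesis by simp
qed

text \<open>Addition theorem, with the product of sines written as a product of cosines shifted by
  \<open>pi / 2\<close>. The case \<open>A = 0\<close> is a plain horizontal shear, since products
  are available for \<open>A \<noteq> 0\<close>.\<close>

lemma approximable_cos:
  assumes A: "dual_lattice A" and B: "dual_lattice B"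
  shows "approximable (\<lambda>x. s * cos (A \<bullet> fst x + B \<bullet> snd x + c))"
proof (cases "A = 0")
  case True
  then show ?thesis using approximable_horizontal[OF B] by simp
next
  case False
  have "approximable (\<lambda>x. s * (cos (A \<bullet> fst x + c) * cos (B \<bullet> snd x + 0)) +
      s * (cos (A \<bullet> fst x + (c + pi / 2)) * cos (B \<bullet> snd x + (- (pi / 2)))))"
    by (intro approximable_add approximable_product A B False)
  moreover have "cos (A \<bullet> fst x + B \<bullet> snd x + c) = cos (A \<bullet> fst x + c) * cos (B \<bullet> snd x + 0) +
      cos (A \<bullet> fst x + (c + pi / 2)) * cos (B \<bullet> snd x + (- (pi / 2)))" for x
  proof -
    have 1: "A \<bullet> fst x + B \<bullet> snd x + c = (A \<bullet> fst x + c) + B \<bullet> snd x" by simp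
    have 2: "cos (A \<bullet> fst x + (c + pi / 2)) = - sin (A \<bullet> fst x + c)"
      using cos_add[of "A \<bullet> fst x + c" "pi / 2"] unfolding add.assoc by (simp del: cos_add)
    have 3: "cos (B \<bullet> snd x + (- (pi / 2))) = sin (B \<bullet> snd x)"
      using cos_diff[of "B \<bullet> snd x" "pi / 2"] by simp
    show ?thesis unfolding 2 3 unfolding 1 cos_add[of "A \<bullet> fst x + c"] by simp
  qed
  ultimately show ?thesis by (simp add: distrib_left)
qed

section \<open>Density of trigonometric polynomials\<close>

text \<open>For an antiderivative \<open>g\<close>, the difference \<open>g u - g (u - 1)\<close> is
  constant, since its derivative is \<open>f u - f (u - 1) = 0\<close>. The antiderivative is taken
  on a bounded interval wide enough for all arguments that occur.\<close>

lemma integral_periodic_reflect: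
  fixes f :: "real \<Rightarrow> real"
  assumes f: "continuous_on UNIV f" and per: "\<And>u. f (u + 1) = f u"
  shows "integral {0..1} (\<lambda>y. f (a - y)) = integral {0..1} f"
proof -
  define R where "R = \<bar>a\<bar> + 3"
  obtain g where g: "\<And>x. x \<in> {- R..R} \<Longrightarrow> (g has_vector_derivative f x) (at x within {- R..R})"
    using antiderivative_continuous[OF continuous_on_subset[OF f]] by (metis subset_UNIV)
  have D: "(g has_real_derivative f x) (at x)" if "- R < x" "x < R" for x
    using g[of x] that at_within_Icc_at[of "- R" x R]
    by (simp add: has_real_derivative_iff_has_vector_derivative)
  have H: "integral {0..1} (\<lambda>y. f (u - y)) = g u - g (u - 1)" if u: "- R + 1 < u" "u < R" for u
  proof -
    have "((\<lambda>y. f (u - y)) has_integral - g (u - 1) - - g (u - 0)) {0..1}"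
    proof (rule fundamental_theorem_of_calculus)
      fix y :: real assume "y \<in> {0..1}"
      then have y: "- R < u - y" "u - y < R" using u by auto
      have "((\<lambda>y. - g (u - y)) has_real_derivative - (f (u - y) * (0 - 1))) (at y)"
        by (intro derivative_intros DERIV_chain2[where f = g and g = "\<lambda>y. u - y" and x = y, OF D[OF y]])
      then show "((\<lambda>y. - g (u - y)) has_vector_derivative f (u - y)) (at y within {0..1})"
        by (simp add: has_real_derivative_iff_has_vector_derivative has_vector_derivative_at_within)
    qed simp
    from integral_unique[OF this] show ?thesis by simp
  qed
  have "(f has_integral g 1 - g 0) {0..1}"
  proof (rule fundamental_theorem_of_calculus)
    fix y :: real assume "y \<in> {0..1}"
    then have "(g has_real_derivative f y) (at y)" by (intro D) (auto simp: R_def)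
    then show "(g has_vector_derivative f y) (at y within {0..1})"
      by (simp add: has_real_derivative_iff_has_vector_derivative has_vector_derivative_at_within)
  qed simp
  then have "integral {0..1} f = g 1 - g (1 - 1)" by (simp add: integral_unique)
  also have "\<dots> = g a - g (a - 1)"
  proof (rule DERIV_isconst3[of "- R + 1" R 1 a "\<lambda>u. g u - g (u - 1)"])
    fix u assume "u \<in> {- R + 1<..<R}"
    then have u: "- R < u" "u < R" "- R < u - 1" "u - 1 < R" by auto
    have "((\<lambda>u. g u - g (u - 1)) has_real_derivative f u - f (u - 1) * (1 - 0)) (at u)"
      by (intro derivative_intros DERIV_chain2[where f = g and g = "\<lambda>u. u - 1" and x = u, OF D[OF u(3,4)]] D[OF u(1,2)])
    with per[of "u - 1"] show "DERIV (\<lambda>u. g u - g (u - 1)) u :> 0" by simp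
  qed (auto simp: R_def)
  finally show ?thesis using H[of a] by (simp add: R_def)
qed

definition cos_power_integral :: "nat \<Rightarrow> real" where
  "cos_power_integral N = integral {0..1} (\<lambda>y. cos (pi * y) ^ (2 * N))"

text \<open>The de la Vallee-Poussin kernel, rescaled to period 1. It is a trigonometric polynomial
  because \<open>(cos (pi * y))\<^sup>2 = (1 + cos (2 * pi * y)) / 2\<close>.\<close>

definition cos_kernel :: "nat \<Rightarrow> real \<Rightarrow> real" where
  "cos_kernel N y = cos (pi * y) ^ (2 * N) / cos_power_integral N"

text \<open>The Wallis recursion, obtained by integrating the derivative of
  \<open>sin (pi * y) * cos (pi * y) ^ Suc (2 * N)\<close> over [0, 1], where the sine vanishes at
  both ends.\<close>

lemma cos_power_integral_Suc: "real (2 * N + 2) * cos_power_integral (Suc N) = real (2 * N + 1) * cos_power_integral N"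
proof -
  let ?F = "\<lambda>y. sin (pi * y) * cos (pi * y) ^ Suc (2 * N) / pi"
  let ?f = "\<lambda>y. real (2 * N + 2) * cos (pi * y) ^ (2 * Suc N) - real (2 * N + 1) * cos (pi * y) ^ (2 * N)"
  have "(?f has_integral ?F 1 - ?F 0) {0..1}"
  proof (rule fundamental_theorem_of_calculus)
    fix y :: real
    have s: "sin (pi * y) * sin (pi * y) = 1 - cos (pi * y) * cos (pi * y)"
      using sin_squared_eq[of "pi * y"] by (simp add: power2_eq_square)
    have "(?F has_real_derivative (cos (pi * y) * cos (pi * y) ^ Suc (2 * N) -
        real (2 * N + 1) * (sin (pi * y) * sin (pi * y)) * cos (pi * y) ^ (2 * N))) (at y)"
    proof -
      have S: "((\<lambda>y. sin (pi * y)) has_real_derivative cos (pi * y) * pi) (at y)"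
        and C: "((\<lambda>y. cos (pi * y)) has_real_derivative - (sin (pi * y) * pi)) (at y)"
        by (auto intro!: derivative_eq_intros)
      show ?thesis
        by (rule DERIV_cong[OF DERIV_cdivide[OF DERIV_mult[OF S DERIV_power_Suc[OF C, of "2 * N"]], of pi]])
          (simp add: field_simps)
    qed
    also have "cos (pi * y) * cos (pi * y) ^ Suc (2 * N) -
        real (2 * N + 1) * (sin (pi * y) * sin (pi * y)) * cos (pi * y) ^ (2 * N) = ?f y"
      unfolding s by (simp add: algebra_simps)
    finally show "(?F has_vector_derivative ?f y) (at y within {0..1})"
      by (simp add: has_real_derivative_iff_has_vector_derivative has_vector_derivative_at_within)
  qed simp
  then have "integral {0..1} ?f = 0" by (simp add: integral_unique)
  moreover have "integral {0..1} ?f = real (2 * N + 2) * cos_power_integral (Suc N) - real (2 * N + 1) * cos_power_integral N"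
    unfolding cos_power_integral_def
    by (subst integral_diff) (auto intro!: integrable_continuous_real continuous_intros)
  ultimately show ?thesis by simp
qed

lemma cos_power_integral_pos: "0 < cos_power_integral N"
proof (induction N)
  case 0 show ?case by (simp add: cos_power_integral_def)
next
  case (Suc N)
  have "0 < real (2 * N + 1) * cos_power_integral N" using Suc by simp
  then have "0 < real (2 * N + 2) * cos_power_integral (Suc N)" by (simp only: cos_power_integral_Suc)
  then show ?case by (simp add: zero_less_mult_iff del: of_nat_Suc)
qed

lemma cos_kernel_nonneg: "0 \<le> cos_kernel N y"
  using cos_power_integral_pos[of N] by (simp add: cos_kernel_def)

lemma continuous_cos_kernel [continuous_intros]:
  fixes h :: "'a::t2_space \<Rightarrow> real"
  shows "continuous_on S h \<Longrightarrow> continuous_on S (\<lambda>y. cos_kernel N (h y))"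
  unfolding cos_kernel_def using cos_power_integral_pos[of N] by (auto intro!: continuous_intros)

lemma integral_cos_kernel: "integral {0..1} (cos_kernel N) = 1"
proof -
  have "integral {0..1} (\<lambda>y. cos (pi * y) ^ (2 * N) / cos_power_integral N) = cos_power_integral N / cos_power_integral N"
    unfolding cos_power_integral_def by simp
  then show ?thesis using cos_power_integral_pos[of N] by (simp add: cos_kernel_def[abs_def])
qed

text \<open>A second moment of the kernel, with the sine as periodic substitute for the distance to
  the nearest integer. The Wallis recursion gives it exactly, and its decay in \<open>N\<close>
  expresses the concentration of the kernel.\<close>

lemma integral_cos_kernel_sin: "integral {0..1} (\<lambda>y. cos_kernel N y * (sin (pi * y))\<^sup>2) = 1 / real (2 * N + 2)"
proof -
  have "(\<lambda>y. cos_kernel N y * (sin (pi * y))\<^sup>2) =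
      (\<lambda>y. cos (pi * y) ^ (2 * N) / cos_power_integral N - cos (pi * y) ^ (2 * Suc N) / cos_power_integral N)"
  proof
    fix y
    have "cos (pi * y) ^ (2 * Suc N) = cos (pi * y) ^ (2 * N) * (cos (pi * y))\<^sup>2"
      by (simp add: power2_eq_square mult_ac)
    then show "cos_kernel N y * (sin (pi * y))\<^sup>2 =
        cos (pi * y) ^ (2 * N) / cos_power_integral N - cos (pi * y) ^ (2 * Suc N) / cos_power_integral N"
      unfolding cos_kernel_def sin_squared_eq by (simp only:) (simp add: right_diff_distrib diff_divide_distrib)
  qed
  then have "integral {0..1} (\<lambda>y. cos_kernel N y * (sin (pi * y))\<^sup>2) = cos_power_integral N / cos_power_integral N - cos_power_integral (Suc N) / cos_power_integral N"
    unfolding cos_power_integral_def using cos_power_integral_pos[of N, unfolded cos_power_integral_def]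
    by (simp only:, subst integral_diff)
      (auto intro!: integrable_continuous_real continuous_intros)
  also have "cos_power_integral (Suc N) = real (2 * N + 1) / real (2 * N + 2) * cos_power_integral N"
    using cos_power_integral_Suc[of N] by (simp add: field_simps)
  finally have "integral {0..1} (\<lambda>y. cos_kernel N y * (sin (pi * y))\<^sup>2) = 1 - real (2 * N + 1) / real (2 * N + 2)"
    using cos_power_integral_pos[of N] by simp
  also have "\<dots> = 1 / real (2 * N + 2)" by (simp add: field_simps)
  finally show ?thesis .
qed

text \<open>Lets the sine dominate the distance to the nearest integer. With
  \<open>u = pi * y \<le> 2\<close> the cubic term takes at most two thirds of \<open>u\<close>, and
  the remaining third is at least \<open>y\<close> because \<open>pi > 3\<close>.\<close>

lemma le_sin_pi: "y \<le> sin (pi * y)" if "0 \<le> y" "y \<le> 1 / 2" for y :: real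
proof -
  let ?u = "pi * y"
  have "?u \<le> 4 * (1 / 2)" using that pi_less_4 by (intro mult_mono) auto
  then have u: "0 \<le> ?u" "?u \<le> 2" using that by auto
  have "(\<Sum>m<3. sin_coeff m * ?u ^ m) = ?u" by (simp add: numeral_3_eq_3 sin_coeff_def)
  then have "\<bar>sin ?u - ?u\<bar> \<le> ?u ^ 3 / 6" using Maclaurin_sin_bound[of ?u 3] u by (simp add: fact_numeral)
  then have "?u - ?u ^ 3 / 6 \<le> sin ?u" by linarith
  moreover have "?u ^ 3 / 6 \<le> 2 / 3 * ?u"
  proof -
    have "?u * ?u \<le> 2 * 2" using u by (intro mult_mono) auto
    then have "?u * ?u * ?u \<le> 4 * ?u" using u by (intro mult_right_mono) auto
    then show ?thesis unfolding power3_eq_cube by linarith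
  qed
  moreover have "y \<le> ?u / 3" using mult_right_mono[of 3 pi y] pi_gt3 that by simp
  ultimately show ?thesis by linarith
qed

section \<open>Convolution with the kernel in one coordinate\<close>

definition avg :: "'a::euclidean_space \<Rightarrow> nat \<Rightarrow> ('a \<Rightarrow> real) \<Rightarrow> 'a \<Rightarrow> real" where
  "avg e N k x = integral {0..1} (\<lambda>y. cos_kernel N y * k (x - y *\<^sub>R e))"

lemma bounded_smooth_continuous: "bounded_smooth k \<Longrightarrow> continuous_on UNIV k"
  by (simp add: bounded_smooth_differentiable continuous_at_imp_continuous_on differentiable_imp_continuous_within)

lemma continuous_on_comp_UNIV:
  "continuous_on UNIV k \<Longrightarrow> continuous_on S h \<Longrightarrow> continuous_on S (\<lambda>x. k (h x))"
  using continuous_on_compose2[of UNIV k S h] by auto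

lemma continuous_on_line:
  fixes k :: "'a::real_normed_vector \<Rightarrow> real"
  shows "continuous_on UNIV k \<Longrightarrow> continuous_on S (\<lambda>y. k (x - y *\<^sub>R e))"
  by (erule continuous_on_comp_UNIV) (intro continuous_intros)

lemma avg_integrable:
  fixes k :: "'a::euclidean_space \<Rightarrow> real"
  shows "continuous_on UNIV k \<Longrightarrow> (\<lambda>y. cos_kernel N y * k (x - y *\<^sub>R e)) integrable_on {0..1}"
  by (intro integrable_continuous_real continuous_on_mult continuous_cos_kernel continuous_on_id continuous_on_line[of k])

lemma norm_integral_cos_kernel_le:
  assumes "continuous_on {0..1} f" "\<And>y. y \<in> {0..1} \<Longrightarrow> \<bar>f y\<bar> \<le> M"
  shows "\<bar>integral {0..1} (\<lambda>y. cos_kernel N y * f y)\<bar> \<le> M"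
proof -
  have "norm (integral {0..1} (\<lambda>y. cos_kernel N y * f y)) \<le> integral {0..1} (\<lambda>y. cos_kernel N y * M)"
    using assms cos_kernel_nonneg
    by (intro integral_norm_bound_integral integrable_continuous_real continuous_intros)
      (auto simp: abs_mult intro!: mult_left_mono)
  then show ?thesis by (simp add: integral_cos_kernel)
qed

text \<open>Differentiation under the integral sign; the derivative is packaged through
  \<open>blinfun_inner_left\<close>, as the Leibniz rule speaks of bounded linear functions.\<close>

lemma has_derivative_avg:
  assumes k: "bounded_smooth k"
  shows "((avg e N k) has_derivative (\<lambda>h. \<Sum>b\<in>Basis. (h \<bullet> b) * avg e N (pd b k) x)) (at x)"
proof -
  let ?D = "\<lambda>x t. \<Sum>b\<in>Basis. (cos_kernel N t * pd b k (x - t *\<^sub>R e)) *\<^sub>R blinfun_inner_left b"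
  have c: "continuous_on UNIV (pd b k)" if "b \<in> Basis" for b
    using k that by (intro bounded_smooth_continuous bounded_smooth_pd)
  have ap: "blinfun_apply (?D x t) h = (\<Sum>b\<in>Basis. (h \<bullet> b) * (cos_kernel N t * pd b k (x - t *\<^sub>R e)))" for x t h
    by (simp add: blinfun.sum_left blinfun.scaleR_left blinfun_inner_left.rep_eq mult_ac)
  have "((\<lambda>x. integral (cbox 0 1) (\<lambda>t. cos_kernel N t * k (x - t *\<^sub>R e))) has_derivative
      integral (cbox 0 1) (?D x)) (at x within UNIV)"
  proof (rule leibniz_rule)
    fix x t
    have "((\<lambda>x. k (x - t *\<^sub>R e)) has_derivative (\<lambda>h. \<Sum>b\<in>Basis. (h \<bullet> b) *\<^sub>R pd b k (x - t *\<^sub>R e))) (at x)"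
      by (rule has_derivative_compose[OF _ has_derivative_pd[OF bounded_smooth_differentiable[OF k]]])
        (auto intro!: derivative_eq_intros)
    then have "((\<lambda>x. cos_kernel N t * k (x - t *\<^sub>R e)) has_derivative
        (\<lambda>h. cos_kernel N t * (\<Sum>b\<in>Basis. (h \<bullet> b) *\<^sub>R pd b k (x - t *\<^sub>R e)))) (at x)"
      by (rule has_derivative_mult_right)
    moreover have "(\<lambda>h. cos_kernel N t * (\<Sum>b\<in>Basis. (h \<bullet> b) *\<^sub>R pd b k (x - t *\<^sub>R e))) = blinfun_apply (?D x t)"
      by (simp add: fun_eq_iff ap sum_distrib_left mult_ac)
    ultimately show "((\<lambda>x. cos_kernel N t * k (x - t *\<^sub>R e)) has_derivative blinfun_apply (?D x t)) (at x within UNIV)"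
      by simp
  next
    show "(\<lambda>t. cos_kernel N t * k (x - t *\<^sub>R e)) integrable_on cbox 0 1" for x
      using avg_integrable[OF bounded_smooth_continuous[OF k]] by simp
    show "continuous_on (UNIV \<times> cbox 0 1) (\<lambda>(x, t). ?D x t)"
      unfolding case_prod_unfold
      by (intro continuous_intros continuous_on_comp_UNIV[OF c]) auto
  qed auto
  moreover have i: "integral (cbox 0 1) (?D x) h = (\<Sum>b\<in>Basis. (h \<bullet> b) * avg e N (pd b k) x)" for h
  proof -
    have i: "?D x integrable_on cbox 0 1"
      by (intro integrable_continuous continuous_intros continuous_on_comp_UNIV[OF c]) auto
    have "integral (cbox 0 1) (?D x) h = integral {0..1} (\<lambda>t. \<Sum>b\<in>Basis. (h \<bullet> b) * (cos_kernel N t * pd b k (x - t *\<^sub>R e)))"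
      using blinfun_apply_integral[OF i, of h] by (simp add: ap)
    also have "\<dots> = (\<Sum>b\<in>Basis. (h \<bullet> b) * avg e N (pd b k) x)"
      unfolding avg_def
      by (subst integral_sum) (auto intro!: integrable_on_mult_right avg_integrable c)
    finally show ?thesis .
  qed
  moreover have "avg e N k = (\<lambda>x. integral (cbox 0 1) (\<lambda>t. cos_kernel N t * k (x - t *\<^sub>R e)))"
    by (simp add: avg_def fun_eq_iff)
  moreover have "blinfun_apply (integral (cbox 0 1) (?D x)) = (\<lambda>h. \<Sum>b\<in>Basis. (h \<bullet> b) * avg e N (pd b k) x)"
    using i by (intro ext)
  ultimately show ?thesis by simp
qed

lemma avg_differentiable: "bounded_smooth k \<Longrightarrow> avg e N k differentiable (at x)"
  using has_derivative_avg by (rule differentiableI)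

text \<open>As averaging commutes with partial derivatives, estimates in every order reduce to order
  zero.\<close>

lemma pd_avg:
  assumes "bounded_smooth k" "b \<in> Basis"
  shows "pd b (avg e N k) = avg e N (pd b k)"
proof
  fix x
  have "pd b (avg e N k) x = (\<Sum>c\<in>Basis. (b \<bullet> c) * avg e N (pd c k) x)"
    by (rule pd_eqI[OF has_derivative_avg[OF assms(1)]])
  also have "\<dots> = avg e N (pd b k) x"
    using assms(2) by (simp add: inner_Basis if_distrib if_distribR cong: if_cong)
  finally show "pd b (avg e N k) x = avg e N (pd b k) x" .
qed

lemma Cr_bounded_avg: "bounded_smooth k \<Longrightarrow> Cr_bounded r M k \<Longrightarrow> Cr_bounded r M (avg e N k)"
proof (induction r arbitrary: k)
  case 0
  then have "\<bar>avg e N k x\<bar> \<le> M" for x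
    unfolding avg_def
    by (intro norm_integral_cos_kernel_le continuous_on_line bounded_smooth_continuous) auto
  then show ?case by simp
next
  case (Suc r)
  have "\<bar>avg e N k x\<bar> \<le> M" for x
    unfolding avg_def using Suc.prems Cr_bounded_norm[OF Suc.prems(2)]
    by (intro norm_integral_cos_kernel_le continuous_on_line bounded_smooth_continuous) auto
  with Suc show ?case
    by (intro Cr_bounded_SucI) (auto simp: pd_avg intro: avg_differentiable bounded_smooth_pd Cr_bounded_pd)
qed

lemma bounded_smooth_avg: "bounded_smooth k \<Longrightarrow> bounded_smooth (avg e N k)"
  unfolding bounded_smooth_def using Cr_bounded_avg[of k] by (metis bounded_smooth_def)

lemma pd_periodic:
  assumes "\<And>x. k (x + e) = k x" "\<And>x. k differentiable (at x)"
  shows "pd b k (x + e) = pd b k x"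
proof -
  have "((\<lambda>x. k (x + e)) has_derivative (\<lambda>h. pd h k (x + e))) (at x)"
    by (rule has_derivative_compose[OF _ has_derivative_pd'[OF assms(2)]]) (auto intro!: derivative_eq_intros)
  from pd_eqI[OF this, of b] show ?thesis using assms(1) by simp
qed

text \<open>The Lipschitz bound leaves the first moment of the kernel, whereas the second is the one
  computed; \<open>s \<le> eta + s\<^sup>2 / eta\<close> trades one for the other, with
  \<open>eta\<close> free to be chosen.\<close>

lemma avg_approx_pointwise:
  assumes k: "continuous_on UNIV k" and lip: "\<And>x y. \<bar>k x - k y\<bar> \<le> L * norm (x - y)" and L: "0 \<le> L"
    and per: "\<And>x. k (x + e) = k x" and e: "norm e = 1" and eta: "0 < eta"
  shows "\<bar>avg e N k x - k x\<bar> \<le> L * (eta + 1 / (eta * real (2 * N + 2)))"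
proof -
  have d: "\<bar>k (x - y *\<^sub>R e) - k x\<bar> \<le> L * (eta + (sin (pi * y))\<^sup>2 / eta)" if y: "y \<in> {0..1}" for y
  proof -
    have "\<bar>k (x - y *\<^sub>R e) - k x\<bar> \<le> L * sin (pi * y)"
    proof (cases "y \<le> 1 / 2")
      case True
      have "\<bar>k (x - y *\<^sub>R e) - k x\<bar> \<le> L * y"
        using lip[of "x - y *\<^sub>R e" x] y e by simp
      also have "\<dots> \<le> L * sin (pi * y)" using True y L by (intro mult_left_mono le_sin_pi) auto
      finally show ?thesis .
    next
      \<comment> \<open>Beyond one half, the period \<open>e\<close> allows the distance to be
        measured from the other end of the interval.\<close>
      case False
      have "k (x - y *\<^sub>R e) = k (x + (1 - y) *\<^sub>R e)"
        using per[of "x - y *\<^sub>R e"] by (simp add: algebra_simps)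
      then have "\<bar>k (x - y *\<^sub>R e) - k x\<bar> \<le> L * (1 - y)"
        using lip[of "x + (1 - y) *\<^sub>R e" x] y e by simp
      also have "\<dots> \<le> L * sin (pi * (1 - y))" using False y L by (intro mult_left_mono le_sin_pi) auto
      also have "sin (pi * (1 - y)) = sin (pi * y)" by (simp add: right_diff_distrib sin_diff)
      finally show ?thesis .
    qed
    also have "\<dots> \<le> L * (eta + (sin (pi * y))\<^sup>2 / eta)"
    proof (intro mult_left_mono L)
      let ?s = "sin (pi * y)"
      have "2 * ?s * eta \<le> ?s\<^sup>2 + eta\<^sup>2" using sum_squares_bound[of ?s eta] by simp
      moreover have "0 \<le> ?s" using y by (intro sin_ge_zero) auto
      then have "0 \<le> ?s * eta" using eta by simp
      ultimately have "?s * eta \<le> eta\<^sup>2 + ?s\<^sup>2" by linarith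
      then show "?s \<le> eta + ?s\<^sup>2 / eta" using eta by (simp add: field_simps power2_eq_square)
    qed
    finally show ?thesis .
  qed
  have ck: "continuous_on S (\<lambda>y. k (x - y *\<^sub>R e))" for S
    by (intro continuous_on_comp_UNIV[OF k] continuous_intros)
  have "avg e N k x - k x = integral {0..1} (\<lambda>y. cos_kernel N y * k (x - y *\<^sub>R e)) - integral {0..1} (\<lambda>y. cos_kernel N y * k x)"
    by (simp add: avg_def integral_cos_kernel)
  also have "\<dots> = integral {0..1} (\<lambda>y. cos_kernel N y * (k (x - y *\<^sub>R e) - k x))"
    by (subst integral_diff[symmetric])
      (auto intro!: integrable_continuous_real continuous_intros ck simp: algebra_simps)
  finally have "\<bar>avg e N k x - k x\<bar> = norm \<dots>" by simp
  also have "\<dots> \<le> integral {0..1} (\<lambda>y. L * eta * cos_kernel N y + L / eta * (cos_kernel N y * (sin (pi * y))\<^sup>2))"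
  proof (rule integral_norm_bound_integral)
    fix y :: real assume y: "y \<in> {0..1}"
    have "norm (cos_kernel N y * (k (x - y *\<^sub>R e) - k x)) = cos_kernel N y * \<bar>k (x - y *\<^sub>R e) - k x\<bar>"
      using cos_kernel_nonneg by (simp add: abs_mult)
    also have "\<dots> \<le> cos_kernel N y * (L * (eta + (sin (pi * y))\<^sup>2 / eta))"
      using d[OF y] cos_kernel_nonneg by (intro mult_left_mono) auto
    finally show "norm (cos_kernel N y * (k (x - y *\<^sub>R e) - k x)) \<le>
        L * eta * cos_kernel N y + L / eta * (cos_kernel N y * (sin (pi * y))\<^sup>2)"
      by (simp add: algebra_simps)
  qed (use eta in \<open>auto intro!: integrable_continuous_real continuous_intros ck\<close>)
  also have "\<dots> = L * eta * 1 + L / eta * (1 / real (2 * N + 2))"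
    by (subst integral_add)
      (use eta in \<open>auto intro!: integrable_continuous_real continuous_intros simp: integral_cos_kernel_sin integral_cos_kernel\<close>)
  finally show ?thesis by (simp add: algebra_simps)
qed

lemma Cr_bounded_avg_diff:
  fixes k :: "'a::euclidean_space \<Rightarrow> real"
  assumes e: "e \<in> Basis" and eta: "0 < eta"
  shows "bounded_smooth k \<Longrightarrow> (\<And>x. k (x + e) = k x) \<Longrightarrow> Cr_bounded (Suc r) M k \<Longrightarrow>
    Cr_bounded r (real DIM('a) * M * (eta + 1 / (eta * real (2 * N + 2)))) (\<lambda>x. avg e N k x - k x)"
proof (induction r arbitrary: k)
  case 0
  have "\<bar>avg e N k x - k x\<bar> \<le> real DIM('a) * M * (eta + 1 / (eta * real (2 * N + 2)))" for x
    using 0 Cr_bounded_lipschitz[OF "0.prems"(3)] Cr_bounded_nonneg[OF "0.prems"(3)] e eta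
    by (intro avg_approx_pointwise bounded_smooth_continuous) auto
  then show ?case by simp
next
  case (Suc r)
  have 1: "Cr_bounded (Suc 0) M k" using Suc.prems(3) by (rule Cr_bounded_le) simp
  have "\<bar>avg e N k x - k x\<bar> \<le> real DIM('a) * M * (eta + 1 / (eta * real (2 * N + 2)))" for x
    using Suc.prems Cr_bounded_lipschitz[OF 1] Cr_bounded_nonneg[OF 1] e eta
    by (intro avg_approx_pointwise bounded_smooth_continuous) auto
  moreover have "pd b (\<lambda>x. avg e N k x - k x) = (\<lambda>x. avg e N (pd b k) x - pd b k x)" if "b \<in> Basis" for b
    using that Suc.prems by (simp add: pd_diff_fun avg_differentiable bounded_smooth_differentiable pd_avg)
  moreover have "Cr_bounded r (real DIM('a) * M * (eta + 1 / (eta * real (2 * N + 2)))) (\<lambda>x. avg e N (pd b k) x - pd b k x)"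
    if "b \<in> Basis" for b
    using that Suc.prems by (intro Suc.IH bounded_smooth_pd pd_periodic bounded_smooth_differentiable Cr_bounded_pd) auto
  ultimately show ?case
    using Suc.prems by (intro Cr_bounded_SucI differentiable_diff avg_differentiable bounded_smooth_differentiable) auto
qed

lemma avg_approx:
  fixes k :: "'a::euclidean_space \<Rightarrow> real"
  assumes k: "bounded_smooth k" "\<And>x. k (x + e) = k x" and e: "e \<in> Basis" and "0 < d"
  shows "\<exists>N. Cr_bounded r d (\<lambda>x. avg e N k x - k x)"
proof -
  obtain M where M: "Cr_bounded (Suc r) M k" using k unfolding bounded_smooth_def by blast
  define D where "D = real DIM('a) * M + 1"
  have D: "0 < D" "real DIM('a) * M \<le> D" using Cr_bounded_nonneg[OF M] by (auto simp: D_def add_nonneg_pos)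
  define eta where "eta = d / (2 * D)"
  have eta: "0 < eta" using \<open>0 < d\<close> D by (simp add: eta_def)
  \<comment> \<open>This choice of \<open>N\<close> makes
    \<open>1 / (eta * real (2 * N + 2))\<close> at most \<open>eta\<close>, so both parts of the
    error are equally small.\<close>
  obtain N :: nat where N: "1 / (eta * eta) < real N" using reals_Archimedean2 by blast
  have "1 / (eta * real (2 * N + 2)) \<le> eta"
  proof -
    have "1 < real N * (eta * eta)" using N eta by (simp add: field_simps)
    also have "\<dots> \<le> real (2 * N + 2) * (eta * eta)" using eta by (intro mult_right_mono) auto
    finally have "1 < eta * (eta * real (2 * N + 2))" by (simp only: mult_ac)
    moreover have "0 < eta * real (2 * N + 2)" using eta by simp
    ultimately show ?thesis using pos_divide_le_eq[of "eta * real (2 * N + 2)" 1 eta] by linarith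
  qed
  then have "real DIM('a) * M * (eta + 1 / (eta * real (2 * N + 2))) \<le> D * (eta + eta)"
    using D eta by (intro mult_mono) auto
  also have "\<dots> = d" using D by (simp add: eta_def)
  finally show ?thesis using Cr_bounded_mono[OF Cr_bounded_avg_diff[OF e eta k M]] by blast
qed

text \<open>Trigonometric polynomials in the coordinates \<open>D\<close> whose coefficients depend on the other
  coordinates only; for \<open>D = Basis\<close> the coefficients are constants.\<close>

inductive trig :: "'a::euclidean_space set \<Rightarrow> ('a \<Rightarrow> real) \<Rightarrow> bool" for D where
  base: "continuous_on UNIV k \<Longrightarrow> (\<And>x b. b \<in> Basis \<Longrightarrow> k (x + b) = k x) \<Longrightarrow>
    (\<And>x b s. b \<in> D \<Longrightarrow> k (x + s *\<^sub>R b) = k x) \<Longrightarrow> trig D k"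
| add: "trig D k \<Longrightarrow> trig D l \<Longrightarrow> trig D (\<lambda>x. k x + l x)"
| cos: "trig D k \<Longrightarrow> d \<in> D \<Longrightarrow> trig D (\<lambda>x. cos (2 * pi * (x \<bullet> d) + c) * k x)"

lemma trig_continuous: "trig D k \<Longrightarrow> continuous_on UNIV k"
  by (induction rule: trig.induct) (auto intro!: continuous_intros)

text \<open>Expanding one factor of the power multiplies the weight by
  \<open>cos (2 * pi * z)\<close> or \<open>sin (2 * pi * z)\<close>, so the induction needs an
  arbitrary weight \<open>\<beta>\<close>. At power zero the integral no longer depends on the
  coordinate along \<open>e\<close>, which makes it an admissible coefficient.\<close>

lemma trig_power_integral:
  fixes k :: "'a::euclidean_space \<Rightarrow> real"
  assumes k: "continuous_on UNIV k" "\<And>x b. b \<in> Basis \<Longrightarrow> k (x + b) = k x"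
    "\<And>x b s. b \<in> D \<Longrightarrow> k (x + s *\<^sub>R b) = k x"
    and e: "e \<in> Basis" "e \<notin> D" "D \<subseteq> Basis"
  shows "continuous_on UNIV \<beta> \<Longrightarrow> trig (insert e D) (\<lambda>x. integral {0..1} (\<lambda>z.
    \<beta> z * ((1 + cos (2 * pi * (x \<bullet> e) - 2 * pi * z)) / 2) ^ N * k (x - (x \<bullet> e) *\<^sub>R e + z *\<^sub>R e)))"
proof (induction N arbitrary: \<beta>)
  case 0
  have ee: "e \<bullet> e = 1" using e by simp
  let ?K = "\<lambda>x. integral {0..1} (\<lambda>z. \<beta> z * k (x - (x \<bullet> e) *\<^sub>R e + z *\<^sub>R e))"
  have "trig (insert e D) ?K"
  proof (rule trig.base)
    have "continuous_on UNIV (\<lambda>x. integral (cbox 0 1) (\<lambda>z. \<beta> z * k (x - (x \<bullet> e) *\<^sub>R e + z *\<^sub>R e)))"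
      using 0 by (intro integral_continuous_on_param)
        (auto simp: case_prod_unfold intro!: continuous_intros continuous_on_comp_UNIV[OF k(1)] continuous_on_comp_UNIV[OF 0])
    then show "continuous_on UNIV ?K" by simp
    show "?K (x + b) = ?K x" if b: "b \<in> Basis" for x b
    proof (cases "b = e")
      case True
      then have eq: "x + b - ((x + b) \<bullet> e) *\<^sub>R e = x - (x \<bullet> e) *\<^sub>R e"
        using ee by (simp add: inner_add_left scaleR_add_left)
      show ?thesis by (simp only: eq)
    next
      case False
      then have "b \<bullet> e = 0" using b e by (simp add: inner_Basis)
      then have eq: "x + b - ((x + b) \<bullet> e) *\<^sub>R e + z *\<^sub>R e = (x - (x \<bullet> e) *\<^sub>R e + z *\<^sub>R e) + b" for z
        by (simp add: inner_add_left)
      show ?thesis by (simp only: eq k(2)[OF b])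
    qed
    show "?K (x + s *\<^sub>R b) = ?K x" if b: "b \<in> insert e D" for x b s
    proof (cases "b = e")
      case True
      then have eq: "x + s *\<^sub>R b - ((x + s *\<^sub>R b) \<bullet> e) *\<^sub>R e = x - (x \<bullet> e) *\<^sub>R e"
        using ee by (simp add: inner_add_left scaleR_add_left)
      show ?thesis by (simp only: eq)
    next
      case False
      then have b: "b \<in> D" using b by simp
      then have "b \<bullet> e = 0" using False e by (auto simp: inner_Basis subset_iff)
      then have eq: "x + s *\<^sub>R b - ((x + s *\<^sub>R b) \<bullet> e) *\<^sub>R e + z *\<^sub>R e = (x - (x \<bullet> e) *\<^sub>R e + z *\<^sub>R e) + s *\<^sub>R b" for z
        by (simp add: inner_add_left)
      show ?thesis by (simp only: eq k(3)[OF b])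
    qed
  qed
  then show ?case by simp
next
  case (Suc N)
  let ?P = "\<lambda>x z. ((1 + cos (2 * pi * (x \<bullet> e) - 2 * pi * z)) / 2) ^ N * k (x - (x \<bullet> e) *\<^sub>R e + z *\<^sub>R e)"
  let ?T = "\<lambda>\<beta> x. integral {0..1} (\<lambda>z. \<beta> z * ((1 + cos (2 * pi * (x \<bullet> e) - 2 * pi * z)) / 2) ^ N *
     k (x - (x \<bullet> e) *\<^sub>R e + z *\<^sub>R e))"
  let ?b1 = "\<lambda>z. \<beta> z / 2" and ?b2 = "\<lambda>z. \<beta> z * cos (2 * pi * z) / 2" and ?b3 = "\<lambda>z. \<beta> z * sin (2 * pi * z) / 2"
  have c: "continuous_on UNIV ?b1" "continuous_on UNIV ?b2" "continuous_on UNIV ?b3"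
    using Suc.prems by (intro continuous_intros; simp)+
  \<comment> \<open>The sine is written as a cosine with phase \<open>- (pi / 2)\<close> to match
    the rule \<open>trig.cos\<close>.\<close>
  have t: "trig (insert e D) (\<lambda>x. ?T ?b1 x +
      (cos (2 * pi * (x \<bullet> e) + 0) * ?T ?b2 x + cos (2 * pi * (x \<bullet> e) + - (pi / 2)) * ?T ?b3 x))"
    by (intro trig.add trig.cos Suc.IH c) auto
  have int: "(\<lambda>z. b z * ?P x z) integrable_on {0..1}" if "continuous_on UNIV b" for b x
    by (intro integrable_continuous_real continuous_intros continuous_on_comp_UNIV[OF k(1)] continuous_on_subset[OF that]) auto
  have eq: "integral {0..1} (\<lambda>z. \<beta> z * ((1 + cos (2 * pi * (x \<bullet> e) - 2 * pi * z)) / 2) ^ Suc N *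
      k (x - (x \<bullet> e) *\<^sub>R e + z *\<^sub>R e)) =
    ?T ?b1 x + (cos (2 * pi * (x \<bullet> e) + 0) * ?T ?b2 x + cos (2 * pi * (x \<bullet> e) + - (pi / 2)) * ?T ?b3 x)" for x
  proof -
    let ?C = "cos (2 * pi * (x \<bullet> e))" and ?S = "sin (2 * pi * (x \<bullet> e))"
    have "integral {0..1} (\<lambda>z. \<beta> z * ((1 + cos (2 * pi * (x \<bullet> e) - 2 * pi * z)) / 2) ^ Suc N *
        k (x - (x \<bullet> e) *\<^sub>R e + z *\<^sub>R e)) =
      integral {0..1} (\<lambda>z. ?b1 z * ?P x z + (?C * (?b2 z * ?P x z) + ?S * (?b3 z * ?P x z)))"
      unfolding power_Suc
      by (intro arg_cong[where f = "integral {0..1}"] ext) (simp only: cos_diff[of "2 * pi * (x \<bullet> e)"], algebra)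
    also have "\<dots> = integral {0..1} (\<lambda>z. ?b1 z * ?P x z) + (?C * integral {0..1} (\<lambda>z. ?b2 z * ?P x z) +
        ?S * integral {0..1} (\<lambda>z. ?b3 z * ?P x z))"
      using int[OF c(1), of x] int[OF c(2), of x] int[OF c(3), of x]
      by (simp add: integral_add integrable_add integrable_on_mult_right)
    also have "?S = cos (2 * pi * (x \<bullet> e) + - (pi / 2))" using cos_diff[of "2 * pi * (x \<bullet> e)" "pi / 2"] by simp
    finally show ?thesis by (simp add: mult.assoc)
  qed
  show ?case unfolding eq by (rule t)
qed

text \<open>The substitution \<open>z = x \<bullet> e - y\<close> moves \<open>x\<close> into the
  kernel, and the double angle formula turns the kernel into a power of
  \<open>(1 + cos (2 * pi * (x \<bullet> e) - 2 * pi * z)) / 2\<close>.\<close>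

lemma trig_avg_base:
  fixes k :: "'a::euclidean_space \<Rightarrow> real"
  assumes k: "continuous_on UNIV k" "\<And>x b. b \<in> Basis \<Longrightarrow> k (x + b) = k x"
    "\<And>x b s. b \<in> D \<Longrightarrow> k (x + s *\<^sub>R b) = k x"
    and e: "e \<in> Basis" "e \<notin> D" "D \<subseteq> Basis"
  shows "trig (insert e D) (avg e N k)"
proof -
  have "avg e N k x = integral {0..1} (\<lambda>z. (1 / cos_power_integral N) *
      ((1 + cos (2 * pi * (x \<bullet> e) - 2 * pi * z)) / 2) ^ N * k (x - (x \<bullet> e) *\<^sub>R e + z *\<^sub>R e))" for x
  proof -
    let ?a = "x \<bullet> e"
    let ?f = "\<lambda>z. cos_kernel N (?a - z) * k (x - ?a *\<^sub>R e + z *\<^sub>R e)"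
    have kk: "cos_kernel N (?a - z) = (1 / cos_power_integral N) * ((1 + cos (2 * pi * ?a - 2 * pi * z)) / 2) ^ N" for z
    proof -
      have "cos (2 * (pi * (?a - z))) = 2 * (cos (pi * (?a - z)))\<^sup>2 - 1" by (rule cos_double_cos)
      moreover have "2 * (pi * (?a - z)) = 2 * pi * ?a - 2 * pi * z" by (simp add: algebra_simps)
      ultimately have c2: "(cos (pi * (?a - z)))\<^sup>2 = (1 + cos (2 * pi * ?a - 2 * pi * z)) / 2" by simp
      show ?thesis unfolding cos_kernel_def power_mult c2 by simp
    qed
    have "avg e N k x = integral {0..1} (\<lambda>y. ?f (?a - y))"
      unfolding avg_def by (simp add: algebra_simps)
    also have "\<dots> = integral {0..1} ?f"
    proof (rule integral_periodic_reflect)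
      show "continuous_on UNIV ?f"
        by (intro continuous_intros continuous_on_comp_UNIV[OF k(1)])
      \<comment> \<open>The cosine changes sign under a shift by one; the even power removes the
        sign.\<close>
      have "cos_kernel N (?a - (u + 1)) = cos_kernel N (?a - u)" for u
      proof -
        have "cos (pi * (?a - (u + 1))) = - cos (pi * (?a - u))"
          using cos_periodic_pi[of "pi * (?a - (u + 1))"] by (simp add: algebra_simps)
        then show ?thesis by (simp add: cos_kernel_def power_mult)
      qed
      moreover have "k (x - ?a *\<^sub>R e + (u + 1) *\<^sub>R e) = k (x - ?a *\<^sub>R e + u *\<^sub>R e)" for u
        using k(2)[OF e(1), of "x - ?a *\<^sub>R e + u *\<^sub>R e"] by (simp add: algebra_simps)
      ultimately show "?f (u + 1) = ?f u" for u by simp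
    qed
    finally show ?thesis unfolding kk .
  qed
  then have "avg e N k = (\<lambda>x. integral {0..1} (\<lambda>z. (1 / cos_power_integral N) *
      ((1 + cos (2 * pi * (x \<bullet> e) - 2 * pi * z)) / 2) ^ N * k (x - (x \<bullet> e) *\<^sub>R e + z *\<^sub>R e)))"
    by (rule ext)
  then show ?thesis
    using trig_power_integral[OF k e continuous_on_const, of "1 / cos_power_integral N" N] by (simp only:)
qed

text \<open>Averaging along \<open>e\<close> does not see cosines in the coordinates of
  \<open>D\<close>; it acts on the coefficients only.\<close>

lemma trig_insert: "trig D k \<Longrightarrow> e \<in> Basis \<Longrightarrow> e \<notin> D \<Longrightarrow> D \<subseteq> Basis \<Longrightarrow> trig (insert e D) (avg e N k)"
proof (induction rule: trig.induct)
  case (base k)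
  then show ?case by (intro trig_avg_base)
next
  case (add k l)
  have "avg e N (\<lambda>x. k x + l x) = (\<lambda>x. avg e N k x + avg e N l x)"
    using avg_integrable[OF trig_continuous[OF add.hyps(1)]] avg_integrable[OF trig_continuous[OF add.hyps(2)]]
    by (simp add: avg_def fun_eq_iff distrib_left integral_add)
  with add show ?case by (simp add: trig.add)
next
  case (cos k d c)
  have "e \<bullet> d = 0" using cos by (auto simp: inner_Basis subset_iff)
  then have "avg e N (\<lambda>x. cos (2 * pi * (x \<bullet> d) + c) * k x) = (\<lambda>x. cos (2 * pi * (x \<bullet> d) + c) * avg e N k x)"
    by (simp add: avg_def fun_eq_iff inner_diff_left mult.left_commute[of "cos_kernel _ _"])
  with cos show ?case by (simp add: trig.cos)
qed

text \<open>Coordinates are averaged one after the other, each with its own \<open>N\<close>, half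
  of the tolerance being passed on to the earlier ones. Periodicity is carried along because the
  next average relies on it.\<close>

lemma trig_dense:
  fixes k :: "'a::euclidean_space \<Rightarrow> real"
  assumes k: "bounded_smooth k" "\<And>x b. b \<in> Basis \<Longrightarrow> k (x + b) = k x" and "0 < d"
  shows "\<exists>l. trig Basis l \<and> bounded_smooth l \<and> Cr_bounded r d (\<lambda>x. l x - k x)"
proof -
  have "\<exists>l. trig D l \<and> bounded_smooth l \<and> (\<forall>x. \<forall>b\<in>Basis. l (x + b) = l x) \<and> Cr_bounded r d (\<lambda>x. l x - k x)"
    if "finite D" "D \<subseteq> Basis" "0 < d" for D d
    using that
  proof (induction D arbitrary: d rule: finite_induct)
    case empty
    have "trig {} k" using k by (intro trig.base bounded_smooth_continuous) auto
    with k empty show ?case by (intro exI[of _ k]) (auto intro: Cr_bounded_const)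
  next
    case (insert e D)
    then have "D \<subseteq> Basis" "0 < d / 2" by auto
    from insert.IH[OF this] obtain l where l: "trig D l" "bounded_smooth l" "\<And>x b. b \<in> Basis \<Longrightarrow> l (x + b) = l x" "Cr_bounded r (d / 2) (\<lambda>x. l x - k x)"
      by blast
    obtain N where N: "Cr_bounded r (d / 2) (\<lambda>x. avg e N l x - l x)"
      using avg_approx[OF l(2), of e "d / 2" r] l(3) insert.prems by auto
    have "Cr_bounded r d (\<lambda>x. avg e N l x - k x)" using Cr_bounded_add[OF N l(4)] by simp
    moreover have "avg e N l (x + b) = avg e N l x" if "b \<in> Basis" for x b
    proof -
      have "l (x + b - y *\<^sub>R e) = l (x - y *\<^sub>R e)" for y
        using l(3)[OF that, of "x - y *\<^sub>R e"] by (simp add: algebra_simps)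
      then show ?thesis by (simp add: avg_def)
    qed
    moreover have "trig (insert e D) (avg e N l)"
      using insert.prems insert.hyps by (intro trig_insert l(1)) auto
    ultimately show ?case
      using bounded_smooth_avg[OF l(2), of e N] by (intro exI[of _ "avg e N l"]) auto
  qed
  from this[OF finite_Basis order_refl assms(3)] show ?thesis by blast
qed

section \<open>Density of the shear group\<close>

lemma periodic_int:
  fixes k :: "'a::real_vector \<Rightarrow> 'b"
  assumes "\<And>x. k (x + b) = k x"
  shows "k (x + of_int n *\<^sub>R b) = k x"
proof -
  have nat: "k (x + of_nat m *\<^sub>R b) = k x" for m x
  proof (induction m)
    case (Suc m)
    have eq: "x + of_nat (Suc m) *\<^sub>R b = (x + of_nat m *\<^sub>R b) + b" by (simp add: algebra_simps)
    show ?case by (simp only: eq assms Suc)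
  qed simp
  show ?thesis
  proof (cases "0 \<le> n")
    case True
    then show ?thesis using nat[of x "nat n"] by simp
  next
    case False
    then have eq: "(x + of_int n *\<^sub>R b) + of_nat (nat (- n)) *\<^sub>R b = x"
      by (simp add: add.assoc scaleR_add_left[symmetric])
    show ?thesis using nat[of "x + of_int n *\<^sub>R b" "nat (- n)"] unfolding eq by simp
  qed
qed

text \<open>Integer translations bring every point into the unit cube, which is compact.\<close>

lemma periodic_bounded:
  fixes k :: "'a::euclidean_space \<Rightarrow> 'b::real_normed_vector"
  assumes k: "continuous_on UNIV k" and per: "\<And>x b. b \<in> Basis \<Longrightarrow> k (x + b) = k x"
  shows "\<exists>M. \<forall>x. norm (k x) \<le> M"
proof -
  have sum: "k (x + (\<Sum>b\<in>D. of_int (n b) *\<^sub>R b)) = k x" if "finite D" "D \<subseteq> Basis" for D n x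
    using that
  proof (induction D rule: finite_induct)
    case (insert b D)
    have eq: "x + (\<Sum>b\<in>insert b D. of_int (n b) *\<^sub>R b) = (x + (\<Sum>b\<in>D. of_int (n b) *\<^sub>R b)) + of_int (n b) *\<^sub>R b"
      using insert.hyps by (simp add: algebra_simps)
    have k: "k (z + of_int (n b) *\<^sub>R b) = k z" for z
      using insert.prems by (intro periodic_int per) simp
    show ?case unfolding eq k using insert by simp
  qed simp
  have "compact (k ` cbox 0 One)"
    using k by (intro compact_continuous_image) (auto intro: continuous_on_subset)
  then obtain M where M: "\<And>y. y \<in> cbox 0 One \<Longrightarrow> norm (k y) \<le> M"
    by (meson bounded_iff compact_imp_bounded image_eqI)
  have "norm (k x) \<le> M" for x
  proof -
    let ?y = "x + (\<Sum>b\<in>Basis. of_int (- \<lfloor>x \<bullet> b\<rfloor>) *\<^sub>R b)"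
    have "?y \<bullet> b = frac (x \<bullet> b)" if "b \<in> Basis" for b
      using that by (simp add: inner_add_left inner_sum_left frac_def inner_Basis if_distrib cong: if_cong)
    then have "?y \<in> cbox 0 One" by (auto simp: mem_box less_imp_le[OF frac_lt_1])
    then show ?thesis using M[of ?y] sum[of Basis x "\<lambda>b. - \<lfloor>x \<bullet> b\<rfloor>"] by simp
  qed
  then show ?thesis by blast
qed

lemma smooth_continuous: "smooth k \<Longrightarrow> continuous_on UNIV k"
  by (simp add: smooth_differentiable continuous_at_imp_continuous_on differentiable_imp_continuous_within)

lemma Cr_bounded_Suc_ex:
  fixes f :: "'a::euclidean_space \<Rightarrow> 'b::real_normed_vector"
  assumes "\<exists>M. \<forall>x. norm (f x) \<le> M" "\<And>x. f differentiable (at x)"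
    "\<And>b. b \<in> Basis \<Longrightarrow> \<exists>M. Cr_bounded r M (pd b f)"
  shows "\<exists>M. Cr_bounded (Suc r) M f"
proof -
  obtain M where M: "\<And>x. norm (f x) \<le> M" using assms(1) by blast
  obtain N where N: "\<And>b. b \<in> Basis \<Longrightarrow> Cr_bounded r (N b) (pd b f)" using assms(3) by metis
  let ?K = "M + (\<Sum>b\<in>Basis. N b)"
  have pos: "0 \<le> M" using order_trans[OF norm_ge_zero M] .
  have N0: "0 \<le> N b" if "b \<in> Basis" for b using Cr_bounded_nonneg[OF N[OF that]] .
  have "N b \<le> ?K" if "b \<in> Basis" for b
    using member_le_sum[of b Basis N] that N0 pos by force
  moreover have "norm (f x) \<le> ?K" for x
    using M[of x] sum_nonneg[of Basis N] N0 by force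
  ultimately show ?thesis
    using N assms(2) by (intro exI[of _ ?K] Cr_bounded_SucI) (auto intro: Cr_bounded_mono)
qed

lemma smooth_periodic_bounded_smooth:
  fixes k :: "'a::euclidean_space \<Rightarrow> 'b::real_normed_vector"
  assumes "smooth k" "\<And>x b. b \<in> Basis \<Longrightarrow> k (x + b) = k x"
  shows "bounded_smooth k"
proof -
  have "\<exists>M. Cr_bounded r M k" for r
    using assms
  proof (induction r arbitrary: k)
    case 0
    then show ?case using periodic_bounded[OF smooth_continuous[OF "0.prems"(1)] "0.prems"(2)] by simp
  next
    case (Suc r)
    have "\<exists>M. Cr_bounded r M (pd b k)" if "b \<in> Basis" for b
      using that Suc.prems by (intro Suc.IH smooth_pd pd_periodic smooth_differentiable) auto
    then show ?case
      using periodic_bounded[OF smooth_continuous[OF Suc.prems(1)] Suc.prems(2)] smooth_differentiable[OF Suc.prems(1)]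
      by (intro Cr_bounded_Suc_ex) auto
  qed
  then show ?thesis unfolding bounded_smooth_def ..
qed

lemma dual_lattice_axis: "b \<in> Basis \<Longrightarrow> dual_lattice ((2 * pi) *\<^sub>R b)"
  unfolding dual_lattice_def Basis_vec_def by (auto simp: axis_def intro: exI[of _ 1] exI[of _ 0])

text \<open>The additional cosine factor makes the induction close: the rule \<open>trig.cos\<close>
  multiplies it by another cosine, and the product is a sum of two cosines whose frequencies lie in
  the lattice again.\<close>

lemma trig_approximable:
  fixes l :: "'n::finite cover \<Rightarrow> real"
  assumes "trig Basis l" "dual_lattice A" "dual_lattice B"
  shows "approximable (\<lambda>x. s * cos (A \<bullet> fst x + B \<bullet> snd x + c) * l x)"
  using assms
proof (induction arbitrary: A B c s rule: trig.induct)
  case (base k)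
  have "k x = k 0" for x
  proof -
    have "k (\<Sum>b\<in>D. (x \<bullet> b) *\<^sub>R b) = k 0" if "finite D" "D \<subseteq> Basis" for D
      using that
    proof (induction D rule: finite_induct)
      case (insert b D)
      then show ?case using base.hyps(3)[of b "\<Sum>b\<in>D. (x \<bullet> b) *\<^sub>R b" "x \<bullet> b"] by (simp add: add.commute)
    qed simp
    from this[OF finite_Basis order_refl] show ?thesis by (simp add: euclidean_representation)
  qed
  then have "(\<lambda>x. s * cos (A \<bullet> fst x + B \<bullet> snd x + c) * k x) =
      (\<lambda>x. (s * k 0) * cos (A \<bullet> fst x + B \<bullet> snd x + c))" by (auto simp: fun_eq_iff)
  then show ?case using approximable_cos[OF base.prems, of "s * k 0" c] by simp
next
  case (add k l)
  have "approximable (\<lambda>x. s * cos (A \<bullet> fst x + B \<bullet> snd x + c) * k x + s * cos (A \<bullet> fst x + B \<bullet> snd x + c) * l x)"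
    by (intro approximable_add add.IH add.prems)
  then show ?case by (simp add: distrib_left)
next
  case (cos k d c')
  obtain a b where ab: "dual_lattice a" "dual_lattice b" "\<And>x. 2 * pi * (x \<bullet> d) = a \<bullet> fst x + b \<bullet> snd x"
  proof -
    have "d \<in> (\<lambda>u. (u, 0)) ` Basis \<union> (\<lambda>u. (0, u)) ` Basis"
      using cos.hyps(2) by (simp add: Basis_prod_def)
    then show thesis
    proof
      assume "d \<in> (\<lambda>u. (u, 0)) ` Basis"
      then obtain u where "u \<in> Basis" "d = (u, 0)" by blast
      then show thesis using that[of "(2 * pi) *\<^sub>R u" 0] dual_lattice_axis[of u] dual_lattice_zero
        by (simp add: inner_prod_def inner_commute)
    next
      assume "d \<in> (\<lambda>u. (0, u)) ` Basis"
      then obtain u where "u \<in> Basis" "d = (0, u)" by blast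
      then show thesis using that[of 0 "(2 * pi) *\<^sub>R u"] dual_lattice_axis[of u] dual_lattice_zero
        by (simp add: inner_prod_def inner_commute)
    qed
  qed
  have "approximable (\<lambda>x. (s / 2) * cos ((A - a) \<bullet> fst x + (B - b) \<bullet> snd x + (c - c')) * k x +
      (s / 2) * cos ((A + a) \<bullet> fst x + (B + b) \<bullet> snd x + (c + c')) * k x)"
    using ab cos.prems by (intro approximable_add cos.IH dual_lattice_add dual_lattice_diff)
  moreover have "(s / 2) * cos ((A - a) \<bullet> fst x + (B - b) \<bullet> snd x + (c - c')) * k x +
      (s / 2) * cos ((A + a) \<bullet> fst x + (B + b) \<bullet> snd x + (c + c')) * k x =
      s * cos (A \<bullet> fst x + B \<bullet> snd x + c) * (cos (2 * pi * (x \<bullet> d) + c') * k x)" for x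
  proof -
    let ?X = "A \<bullet> fst x + B \<bullet> snd x + c" and ?Y = "2 * pi * (x \<bullet> d) + c'"
    have 1: "(A - a) \<bullet> fst x + (B - b) \<bullet> snd x + (c - c') = ?X - ?Y"
      and 2: "(A + a) \<bullet> fst x + (B + b) \<bullet> snd x + (c + c') = ?X + ?Y"
      unfolding ab(3) inner_diff_left inner_add_left by simp_all
    show ?thesis unfolding 1 2 cos_add[of ?X ?Y] cos_diff[of ?X ?Y] by (simp add: field_simps)
  qed
  ultimately show ?case by simp
qed

lemma approximable_periodic:
  fixes k :: "'n::finite cover \<Rightarrow> real"
  assumes k: "bounded_smooth k" "\<And>x b. b \<in> Basis \<Longrightarrow> k (x + b) = k x"
  shows "approximable k"
proof (rule approximable_limit[OF k(1)])
  fix r and e :: real assume "0 < e"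
  then obtain l where l: "trig Basis l" "Cr_bounded r e (\<lambda>x. l x - k x)" using trig_dense[OF k] by blast
  have "approximable l" using trig_approximable[OF l(1) dual_lattice_zero dual_lattice_zero, of 1 0] by simp
  moreover have "Cr_bounded r e (\<lambda>x. k x - l x)" using Cr_bounded_minus[OF l(2)] by simp
  ultimately show "\<exists>l. approximable l \<and> Cr_bounded r e (\<lambda>x. k x - l x)" by blast
qed

section \<open>Continuity in time and compactness of the time interval\<close>

definition smooth_family :: "(real \<Rightarrow> 'a::euclidean_space \<Rightarrow> 'b::real_normed_vector) \<Rightarrow> bool" where
  "smooth_family F \<longleftrightarrow> (\<forall>t\<ge>0. smooth (F t)) \<and>
     (\<forall>vs. set vs \<subseteq> Basis \<longrightarrow> (\<forall>t0\<ge>0.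
        uniform_limit UNIV (\<lambda>t. iter_deriv vs (F t)) (iter_deriv vs (F t0)) (at t0 within {0..})))"

text \<open>\<open>continuous_family\<close> is tied to functions on \<open>V\<close>; its
  counterpart on the cover is stable under partial derivatives, as the induction on the order
  requires.\<close>

lemma smooth_family_pd:
  assumes "smooth_family F" "b \<in> Basis"
  shows "smooth_family (\<lambda>t. pd b (F t))"
  using assms unfolding smooth_family_def
  by (auto intro: smooth_pd simp: iter_deriv_snoc[symmetric])

lemma smooth_family_Cr_bounded:
  "smooth_family F \<Longrightarrow> 0 \<le> t0 \<Longrightarrow> 0 < e \<Longrightarrow> \<forall>\<^sub>F t in at t0 within {0..}. Cr_bounded r e (\<lambda>x. F t x - F t0 x)"
proof (induction r arbitrary: F)
  case 0
  then have "uniform_limit UNIV (\<lambda>t. iter_deriv [] (F t)) (iter_deriv [] (F t0)) (at t0 within {0..})"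
    unfolding smooth_family_def by (metis empty_set empty_subsetI)
  from uniform_limitD[OF this "0.prems"(3)] show ?case
    by (rule eventually_mono) (auto simp: dist_norm less_imp_le)
next
  case (Suc r)
  have 0: "\<forall>\<^sub>F t in at t0 within {0..}. \<forall>x. norm (F t x - F t0 x) \<le> e"
  proof -
    have "uniform_limit UNIV (\<lambda>t. iter_deriv [] (F t)) (iter_deriv [] (F t0)) (at t0 within {0..})"
      using Suc.prems unfolding smooth_family_def by (metis empty_set empty_subsetI)
    from uniform_limitD[OF this Suc.prems(3)] show ?thesis
      by (rule eventually_mono) (auto simp: dist_norm less_imp_le)
  qed
  have 1: "\<forall>\<^sub>F t in at t0 within {0..}. \<forall>b\<in>Basis. Cr_bounded r e (\<lambda>x. pd b (F t) x - pd b (F t0) x)"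
    by (intro eventually_ball_finite ballI Suc.IH smooth_family_pd Suc.prems) auto
  \<comment> \<open>Smoothness of \<open>F t\<close> is known for nonnegative times, and the filter
    within \<open>{0..}\<close> provides them.\<close>
  have 2: "\<forall>\<^sub>F t in at t0 within {0..}. 0 \<le> t"
    by (auto simp: eventually_at intro: exI[of _ 1])
  have d: "F t differentiable (at x)" if "0 \<le> t" for t x
    using Suc.prems(1) that unfolding smooth_family_def by (auto intro: smooth_differentiable)
  from 0 1 2 show ?case
  proof eventually_elim
    case (elim t)
    have "pd b (\<lambda>x. F t x - F t0 x) = (\<lambda>x. pd b (F t) x - pd b (F t0) x)" for b
      using d elim Suc.prems(2) by (simp add: pd_diff_fun)
    with elim show ?case
      using d Suc.prems(2) by (intro Cr_bounded_SucI differentiable_diff) auto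
  qed
qed

lemma smooth_family_Cb':
  assumes "smooth_family F" "0 \<le> t0" "0 < e"
  shows "\<exists>d>0. \<forall>t\<ge>0. \<bar>t - t0\<bar> < d \<longrightarrow> Cr_bounded r e (\<lambda>x. F t x - F t0 x)"
proof -
  obtain d where d: "d > 0" "\<And>t. t \<in> {0..} \<Longrightarrow> t \<noteq> t0 \<Longrightarrow> dist t t0 < d \<Longrightarrow> Cr_bounded r e (\<lambda>x. F t x - F t0 x)"
    using smooth_family_Cr_bounded[OF assms, of r] unfolding eventually_at by blast
  have "Cr_bounded r e (\<lambda>x. F t x - F t0 x)" if "0 \<le> t" "\<bar>t - t0\<bar> < d" for t
  proof (cases "t = t0")
    case True then show ?thesis using assms(3) by (auto intro: Cr_bounded_const)
  next
    case False then show ?thesis using d(2)[of t] that by (simp add: dist_real_def)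
  qed
  with d(1) show ?thesis by blast
qed

text \<open>Compactness of [0, 1], used twice: a bisection argument glues local bounds, and a
  Lebesgue number for the cover by balls on which the field varies by at most \<open>e / 2\<close>
  gives uniform continuity.\<close>

lemma field_familyI:
  fixes X :: "real \<Rightarrow> 'a::euclidean_space \<Rightarrow> 'a"
  assumes b: "\<And>r t. 0 \<le> t \<Longrightarrow> t \<le> 1 \<Longrightarrow> \<exists>M. Cr_bounded r M (X t)"
    and c: "\<And>r e s. 0 < e \<Longrightarrow> 0 \<le> s \<Longrightarrow> s \<le> 1 \<Longrightarrow>
      \<exists>d>0. \<forall>t. 0 \<le> t \<longrightarrow> t \<le> 1 \<longrightarrow> \<bar>t - s\<bar> < d \<longrightarrow> Cr_bounded r e (\<lambda>x. X t x - X s x)"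
  shows "field_family X"
proof
  fix r
  have "0 \<le> (0::real) \<and> (1::real) \<le> 1 \<longrightarrow> (\<exists>M. \<forall>t\<in>{0..1}. Cr_bounded r M (X t))"
  proof (rule Bolzano[of 0 1 "\<lambda>a b. 0 \<le> a \<and> b \<le> 1 \<longrightarrow> (\<exists>M. \<forall>t\<in>{a..b}. Cr_bounded r M (X t))"], goal_cases)
    case (2 u v w)
    show ?case
    proof
      assume uw: "0 \<le> u \<and> w \<le> 1"
      then obtain M N where "\<And>t. t \<in> {u..v} \<Longrightarrow> Cr_bounded r M (X t)" "\<And>t. t \<in> {v..w} \<Longrightarrow> Cr_bounded r N (X t)"
        using 2 by (metis order_trans)
      note MN = this
      have "Cr_bounded r (max M N) (X t)" if "t \<in> {u..w}" for t
      proof (cases "t \<le> v")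
        case True
        then show ?thesis using that by (intro Cr_bounded_mono[OF MN(1)]) auto
      next
        case False
        then show ?thesis using that by (intro Cr_bounded_mono[OF MN(2)]) auto
      qed
      then show "\<exists>M. \<forall>t\<in>{u..w}. Cr_bounded r M (X t)" by blast
    qed
  next
    case (3 s)
    obtain d where d: "d > 0" "\<And>t. 0 \<le> t \<Longrightarrow> t \<le> 1 \<Longrightarrow> \<bar>t - s\<bar> < d \<Longrightarrow> Cr_bounded r 1 (\<lambda>x. X t x - X s x)"
      using c[of 1 s r] 3 by auto
    obtain M where M: "Cr_bounded r M (X s)" using b 3 by blast
    have "Cr_bounded r (1 + M) (X t)" if "0 \<le> t" "t \<le> 1" "\<bar>t - s\<bar> < d" for t
      using Cr_bounded_add[OF d(2)[OF that] M] by simp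
    then show ?case
      by (intro exI[of _ d] conjI d(1) allI impI exI[of _ "1 + M"] ballI) auto
  qed simp
  then show "\<exists>M. \<forall>t\<in>{0..1}. Cr_bounded r M (X t)" by simp
next
  fix r and e :: real assume e: "0 < e"
  let ?G = "{ball s d | s d. 0 \<le> s \<and> s \<le> 1 \<and> d > 0 \<and>
      (\<forall>t. 0 \<le> t \<longrightarrow> t \<le> 1 \<longrightarrow> \<bar>t - s\<bar> < d \<longrightarrow> Cr_bounded r (e / 2) (\<lambda>x. X t x - X s x))}"
  have cov: "{0..1} \<subseteq> \<Union> ?G"
  proof
    fix s :: real assume "s \<in> {0..1}"
    then have s: "0 \<le> s" "s \<le> 1" by auto
    obtain d where d: "d > 0" "\<forall>t. 0 \<le> t \<longrightarrow> t \<le> 1 \<longrightarrow> \<bar>t - s\<bar> < d \<longrightarrow> Cr_bounded r (e / 2) (\<lambda>x. X t x - X s x)"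
      using c[OF _ s, of "e / 2" r] e by auto
    with s have "ball s d \<in> ?G" by blast
    moreover have "s \<in> ball s d" using d by simp
    ultimately show "s \<in> \<Union> ?G" by blast
  qed
  have "\<exists>d>0. \<forall>s\<in>{0..1}. \<exists>G\<in>?G. ball s d \<subseteq> G"
    by (rule Heine_Borel_lemma[OF compact_Icc cov]) auto
  then obtain d where d: "d > 0" "\<And>s. s \<in> {0..1} \<Longrightarrow> \<exists>G\<in>?G. ball s d \<subseteq> G" by blast
  have "Cr_bounded r e (\<lambda>x. X s x - X t x)" if st: "s \<in> {0..1}" "t \<in> {0..1}" "\<bar>s - t\<bar> < d" for s t
  proof -
    obtain s0 d0 where g: "ball s d \<subseteq> ball s0 d0"
      "\<And>t. 0 \<le> t \<Longrightarrow> t \<le> 1 \<Longrightarrow> \<bar>t - s0\<bar> < d0 \<Longrightarrow> Cr_bounded r (e / 2) (\<lambda>x. X t x - X s0 x)"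
      using d(2)[OF st(1)] by blast
    have "s \<in> ball s d" "t \<in> ball s d" using d st by (auto simp: dist_real_def)
    then have "s \<in> ball s0 d0" "t \<in> ball s0 d0" using g(1) by blast+
    then have "\<bar>s - s0\<bar> < d0" "\<bar>t - s0\<bar> < d0" by (simp_all add: dist_real_def abs_minus_commute)
    then have "Cr_bounded r (e / 2 + e / 2) (\<lambda>x. (X s x - X s0 x) - (X t x - X s0 x))"
      using st by (intro Cr_bounded_diff g) auto
    then show ?thesis by simp
  qed
  with d(1) show "\<exists>d>0. \<forall>s\<in>{0..1}. \<forall>t\<in>{0..1}. \<bar>s - t\<bar> < d \<longrightarrow> Cr_bounded r e (\<lambda>x. X s x - X t x)"
    by blast
qed

text \<open>The threshold for \<open>s\<close> depends a priori on the time \<open>t\<close>. An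
  approximant at one time, taken with half the tolerance, also serves at nearby times, so bisection
  yields one threshold for all of [0, 1].\<close>

lemma approximable_uniform:
  fixes k :: "real \<Rightarrow> 'n::finite cover \<Rightarrow> real"
  assumes g: "\<And>t. 0 \<le> t \<Longrightarrow> t \<le> 1 \<Longrightarrow> approximable (k t)"
    and c: "\<And>r e s. 0 < e \<Longrightarrow> 0 \<le> s \<Longrightarrow> s \<le> 1 \<Longrightarrow>
      \<exists>d>0. \<forall>t. 0 \<le> t \<longrightarrow> t \<le> 1 \<longrightarrow> \<bar>t - s\<bar> < d \<longrightarrow> Cr_bounded r e (\<lambda>x. ham_vf (k t) x - ham_vf (k s) x)"
    and e: "0 < e"
  shows "\<exists>t0>0. \<forall>t\<in>{0..1}. \<forall>s. 0 < s \<longrightarrow> s \<le> t0 \<longrightarrow>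
      (\<exists>g. shear_displacement g \<and> Cr_bounded r (e * s) (\<lambda>x. g x - s *\<^sub>R ham_vf (k t) x))"
proof -
  let ?Q = "\<lambda>t0 t. \<forall>s. 0 < s \<longrightarrow> s \<le> t0 \<longrightarrow> (\<exists>g. shear_displacement g \<and> Cr_bounded r (e * s) (\<lambda>x. g x - s *\<^sub>R ham_vf (k t) x))"
  have "0 \<le> (0::real) \<and> (1::real) \<le> 1 \<longrightarrow> (\<exists>t0>0. \<forall>t\<in>{0..1}. ?Q t0 t)"
  proof (rule Bolzano[of 0 1 "\<lambda>a b. 0 \<le> a \<and> b \<le> 1 \<longrightarrow> (\<exists>t0>0. \<forall>t\<in>{a..b}. ?Q t0 t)"], goal_cases)
    case (2 u v w)
    show ?case
    proof
      assume uw: "0 \<le> u \<and> w \<le> 1"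
      then have "0 \<le> u \<and> v \<le> 1" "0 \<le> v \<and> w \<le> 1" using 2 by auto
      with 2(1,2) have "\<exists>t0>0. \<forall>t\<in>{u..v}. ?Q t0 t" "\<exists>t0>0. \<forall>t\<in>{v..w}. ?Q t0 t" by blast+
      then obtain a b where a: "a > 0" "\<forall>t\<in>{u..v}. ?Q a t" and b: "b > 0" "\<forall>t\<in>{v..w}. ?Q b t" by blast
      have "?Q (min a b) t" if t: "t \<in> {u..w}" for t
      proof (cases "t \<le> v")
        case True
        then have "?Q a t" using a(2) t by simp
        then show ?thesis by simp
      next
        case False
        then have "?Q b t" using b(2) t by simp
        then show ?thesis by simp
      qed
      then show "\<exists>t0>0. \<forall>t\<in>{u..w}. ?Q t0 t" using a(1) b(1) by (intro exI[of _ "min a b"]) simp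
    qed
  next
    case (3 x)
    have e2: "0 < e / 2" using e by simp
    obtain d where d: "d > 0" "\<And>t. 0 \<le> t \<Longrightarrow> t \<le> 1 \<Longrightarrow> \<bar>t - x\<bar> < d \<Longrightarrow>
        Cr_bounded r (e / 2) (\<lambda>y. ham_vf (k t) y - ham_vf (k x) y)"
      using c[OF e2 3, of r] by blast
    obtain t0 where t0: "t0 > 0" "\<And>s. 0 < s \<Longrightarrow> s \<le> t0 \<Longrightarrow>
        \<exists>g. shear_displacement g \<and> Cr_bounded r (e / 2 * s) (\<lambda>y. g y - s *\<^sub>R ham_vf (k x) y)"
      using approximableD[OF g[OF 3] e2, of r] by blast
    have "?Q t0 t" if t: "0 \<le> t" "t \<le> 1" "\<bar>t - x\<bar> < d" for t
    proof (intro allI impI)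
      fix s assume s: "0 < s" "s \<le> t0"
      obtain g where g: "shear_displacement g" "Cr_bounded r (e / 2 * s) (\<lambda>y. g y - s *\<^sub>R ham_vf (k x) y)" using t0(2)[OF s] by blast
      have "Cr_bounded r (e / 2 * s) (\<lambda>y. s *\<^sub>R (ham_vf (k t) y - ham_vf (k x) y))"
        using s by (intro Cr_bounded_scaled d(2) t) simp
      from Cr_bounded_diff[OF g(2) this] have "Cr_bounded r (e * s) (\<lambda>y. g y - s *\<^sub>R ham_vf (k t) y)"
        by (simp add: algebra_simps)
      with g(1) show "\<exists>g. shear_displacement g \<and> Cr_bounded r (e * s) (\<lambda>x. g x - s *\<^sub>R ham_vf (k t) x)" by blast
    qed
    then show ?case
      by (intro exI[of _ d] conjI d(1) allI impI exI[of _ t0] t0(1) ballI) auto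
  qed simp
  then show ?thesis by simp
qed

lemma smoothI_pd:
  assumes "\<And>x. f differentiable (at x)" "\<And>b. b \<in> Basis \<Longrightarrow> smooth (pd b f)"
  shows "smooth f"
  unfolding smooth_def
proof (intro allI impI)
  fix vs :: "'a list" and x assume vs: "set vs \<subseteq> Basis"
  show "iter_deriv vs f differentiable (at x)"
  proof (cases vs rule: rev_cases)
    case (snoc ws b)
    with vs assms(2)[of b] show ?thesis by (auto simp: iter_deriv_snoc smooth_def)
  qed (simp add: assms(1))
qed

lemma smooth_const: "smooth (\<lambda>x. c)"
  by (intro bounded_smooth_smooth bounded_smooth_const)

lemma smooth_id: "smooth (\<lambda>x. x)"
proof (rule smoothI_pd)
  have "pd b (\<lambda>x. x) = (\<lambda>x. b)" for b :: 'a
    by (intro ext pd_eqI[of _ "\<lambda>h. h"]) simp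
  then show "smooth (pd b (\<lambda>x. x))" for b :: 'a by (simp add: smooth_const)
qed simp

lemma iter_deriv_add:
  assumes "smooth f" "smooth g" "set vs \<subseteq> Basis"
  shows "iter_deriv vs (\<lambda>x. f x + g x) = (\<lambda>x. iter_deriv vs f x + iter_deriv vs g x)"
  using assms(3)
proof (induction vs)
  case (Cons v vs)
  then have "iter_deriv vs f differentiable (at x)" "iter_deriv vs g differentiable (at x)" for x
    using assms(1,2) unfolding smooth_def by auto
  note d = this
  have IH: "iter_deriv vs (\<lambda>x. f x + g x) = (\<lambda>x. iter_deriv vs f x + iter_deriv vs g x)"
    using Cons by simp
  show ?case unfolding iter_deriv_Cons_pd IH by (intro ext pd_add d)
qed simp

lemma smooth_add:
  assumes "smooth f" "smooth g"
  shows "smooth (\<lambda>x. f x + g x)"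
  using assms unfolding smooth_def by (auto simp: iter_deriv_add[OF assms] intro!: differentiable_add)

section \<open>Hamiltonian fields and flows on the cover\<close>

lemma ham_field_eq_ham_vf:
  assumes "smooth_fun h"
  shows "ham_field h = ham_vf (h \<circ> to_phase)"
proof
  fix x :: "'a cover"
  obtain q p where x: "x = (q, p)" by (cases x)
  have d: "(h \<circ> to_phase) differentiable (at (q, p))"
    using assms unfolding smooth_fun_def by (rule smooth_differentiable)
  have P: "((\<lambda>p'. (q, p')) has_derivative (\<lambda>h. (0, h))) (at p)"
    and Q: "((\<lambda>q'. (q', p)) has_derivative (\<lambda>h. (h, 0))) (at q)"
    by (auto intro!: derivative_eq_intros)
  have 1: "((\<lambda>p'. h (to_phase (q, p'))) has_derivative (\<lambda>b. pd (0, b) (h \<circ> to_phase) (q, p))) (at p)"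
    using has_derivative_compose[OF P has_derivative_pd'[OF d]] by simp
  have 2: "((\<lambda>q'. h (to_phase (q', p))) has_derivative (\<lambda>b. pd (b, 0) (h \<circ> to_phase) (q, p))) (at q)"
    using has_derivative_compose[OF Q has_derivative_pd'[OF d]] by simp
  show "ham_field h x = ham_vf (h \<circ> to_phase) x"
    unfolding x ham_field_def ham_vf_def gradient_def
    by (simp add: frechet_derivative_at[OF 1, symmetric] frechet_derivative_at[OF 2, symmetric])
qed

lemma to_phase_periodic:
  fixes b :: "'n::finite cover"
  assumes "b \<in> Basis"
  shows "to_phase (x + b) = to_phase x"
proof -
  have "to_torus (y + c) = to_torus y" if "c \<in> Basis \<or> c = 0" for y c :: "real ^ 'n"
    using that unfolding to_torus_eq_iff Basis_vec_def by (auto simp: axis_def)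
  then show ?thesis using assms unfolding to_phase_eq_iff Basis_prod_def by auto
qed

lemma ham_vf_shift:
  assumes "\<And>x. k (x + v) = k x" "\<And>x. k differentiable (at x)"
  shows "ham_vf k (x + v) = ham_vf k x"
  unfolding ham_vf_def by (simp add: pd_periodic[OF assms])

lemma to_phase_shift:
  fixes a b :: "'c::finite cover"
  assumes "to_phase a = to_phase b"
  shows "to_phase (y + (a - b)) = to_phase y"
proof -
  have t: "to_torus (y + (a - b)) = to_torus y" if "to_torus a = to_torus b" for y a b :: "real ^ 'c"
    using that unfolding to_torus_eq_iff by simp
  show ?thesis using assms t[of "fst a" "fst b" "fst y"] t[of "snd a" "snd b" "snd y"]
    unfolding to_phase_eq_iff by simp
qed

lemma Ham_infinity_approx:
  fixes f :: "'n::finite phase \<Rightarrow> 'n phase"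
  assumes "f \<in> Ham_infinity"
  shows "\<exists>w. bounded_smooth w \<and> is_lift (\<lambda>x. x + w x) f \<and>
    (\<forall>r. \<forall>e>0. \<exists>g. shear_displacement g \<and> Cr_bounded r e (\<lambda>x. g x - w x))"
proof -
  obtain H where H: "continuous_family H" "ham_flow H 0 1 f"
    using assms unfolding Ham_infinity_def by blast
  let ?k = "\<lambda>t. H t \<circ> to_phase"
  have fam: "smooth_family ?k"
    using H(1) unfolding continuous_family_def smooth_family_def smooth_fun_def by blast
  have sm: "smooth (?k t)" if "0 \<le> t" for t using fam that unfolding smooth_family_def by blast
  have bounded_smooth: "bounded_smooth (?k t)" if "0 \<le> t" for t
    by (intro smooth_periodic_bounded_smooth sm that) (simp add: to_phase_periodic)
  have approximable: "approximable (?k t)" if "0 \<le> t" for t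
    by (intro approximable_periodic bounded_smooth that) (simp add: to_phase_periodic)
  have cont: "\<exists>d>0. \<forall>t. 0 \<le> t \<longrightarrow> t \<le> 1 \<longrightarrow> \<bar>t - s\<bar> < d \<longrightarrow> Cr_bounded r e (\<lambda>x. ham_vf (?k t) x - ham_vf (?k s) x)"
    if e: "0 < e" and s: "0 \<le> s" for r e s
  proof -
    let ?D = "2 * real DIM(real ^ 'n)"
    have "0 < e / ?D" using e by simp
    from smooth_family_Cb'[OF fam s this, of "Suc r"] obtain d where d: "d > 0"
      "\<And>t. 0 \<le> t \<Longrightarrow> \<bar>t - s\<bar> < d \<Longrightarrow> Cr_bounded (Suc r) (e / ?D) (\<lambda>x. ?k t x - ?k s x)" by blast
    have "Cr_bounded r e (\<lambda>x. ham_vf (?k t) x - ham_vf (?k s) x)" if t: "0 \<le> t" "\<bar>t - s\<bar> < d" for t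
    proof -
      have "ham_vf (\<lambda>x. ?k t x - ?k s x) = (\<lambda>x. ham_vf (?k t) x - ham_vf (?k s) x)"
        using ham_vf_diff[OF smooth_differentiable[OF sm[OF t(1)]] smooth_differentiable[OF sm[OF s]]] by blast
      then show ?thesis using Cr_bounded_hvf[OF d(2)[OF t]] by simp
    qed
    with d(1) show ?thesis by blast
  qed
  interpret field_family "\<lambda>t. ham_vf (?k t)"
  proof (rule field_familyI)
    show "\<exists>M. Cr_bounded r M (ham_vf (?k t))" if "0 \<le> t" for r t using bounded_smooth_hvf[OF bounded_smooth[OF that]] unfolding bounded_smooth_def by blast
  qed (use cont in blast)
  have "is_lift (\<lambda>x. x + flow x) f"
    unfolding is_lift_def
  proof
    fix x
    obtain c where c: "ham_solution H 0 1 c" "to_phase (c 0) = to_phase x" "to_phase (c 1) = f (to_phase x)"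
      using H(2) unfolding ham_flow_def by blast
    \<comment> \<open>The given curve starts at some lift of the point; translation by the period
      \<open>v\<close> moves it to the lift \<open>x\<close>.\<close>
    define v where "v = x - c 0"
    have v: "to_phase (y + v) = to_phase y" for y
      unfolding v_def using to_phase_shift[OF c(2)[symmetric]] .
    have "c 1 + v = (c 0 + v) + flow (c 0 + v)"
    proof (rule flow_solution[where c = "\<lambda>u. c u + v"])
      fix u :: real assume u: "u \<in> {0..1}"
      then have u0: "0 \<le> u" by simp
      have "(c has_vector_derivative ham_field (H u) (c u)) (at u within {0..1})"
        using c(1) u unfolding ham_solution_def by blast
      moreover have "ham_field (H u) (c u) = ham_vf (?k u) (c u)"
        using ham_field_eq_ham_vf[of "H u"] sm[OF u0] by (simp add: smooth_fun_def)
      moreover have "ham_vf (?k u) (c u + v) = ham_vf (?k u) (c u)"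
        by (intro ham_vf_shift smooth_differentiable sm u0) (simp add: v)
      ultimately show "((\<lambda>u. c u + v) has_vector_derivative ham_vf (?k u) (c u + v)) (at u within {0..1})"
        by (auto intro: derivative_eq_intros)
    qed
    then have "c 1 + v = x + flow x" by (simp add: v_def)
    then show "f (to_phase x) = to_phase (x + flow x)" using v[of "c 1"] c(3) by simp
  qed
  moreover have "bounded_smooth flow" unfolding bounded_smooth_def using flow_bounded by blast
  moreover have "\<exists>g. shear_displacement g \<and> Cr_bounded r e (\<lambda>x. g x - flow x)" if "0 < e" for r e
  proof -
    have "\<exists>u n. (\<forall>k<n. shear_displacement (u k)) \<and> Cr_bounded r e (\<lambda>x. displacement_prod u n x - flow x)"
      by (rule flow_approx[OF approximable_uniform that]) (use approximable cont in blast)+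
    then obtain u n where u: "\<And>k. k < n \<Longrightarrow> shear_displacement (u k)" "Cr_bounded r e (\<lambda>x. displacement_prod u n x - flow x)" by blast
    have "shear_displacement (displacement_prod u k)" if "k \<le> n" for k
      using that
    proof (induction k)
      case 0 show ?case by (simp add: shear_displacement_zero)
    next
      case (Suc k)
      then show ?case unfolding displacement_prod.simps by (intro shear_displacement_comp u(1)) auto
    qed
    with u(2) show ?thesis by blast
  qed
  ultimately show ?thesis by blast
qed

lemma Cr_close_displacement:
  assumes w: "bounded_smooth w" "is_lift (\<lambda>x. x + w x) f" and g: "bounded_smooth g" "is_lift (\<lambda>x. x + g x) f'"
    and c: "Cr_bounded r d (\<lambda>x. g x - w x)" "d < e"
  shows "Cr_close r e f f'"
  unfolding Cr_close_def
proof (intro exI conjI allI impI)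
  show "smooth (\<lambda>x. x + w x)" "smooth (\<lambda>x. x + g x)"
    using w g by (intro smooth_add smooth_id bounded_smooth_smooth; simp)+
  fix vs :: "'a cover list" and x assume vs: "set vs \<subseteq> Basis \<and> length vs \<le> r"
  have sm: "smooth w" "smooth (\<lambda>x. g x - w x)" using w g by (intro bounded_smooth_smooth bounded_smooth_diff; simp)+
  have "iter_deriv vs (\<lambda>x. (x + w x) + (g x - w x)) x = iter_deriv vs (\<lambda>x. x + w x) x + iter_deriv vs (\<lambda>x. g x - w x) x"
    using vs by (subst iter_deriv_add) (auto intro: sm smooth_add smooth_id)
  then have "norm (iter_deriv vs (\<lambda>x. x + g x) x - iter_deriv vs (\<lambda>x. x + w x) x) = norm (iter_deriv vs (\<lambda>x. g x - w x) x)"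
    by simp
  also have "\<dots> \<le> d" using vs by (intro Cr_bounded_iter_deriv[OF c(1)]) auto
  finally show "norm (iter_deriv vs (\<lambda>x. x + g x) x - iter_deriv vs (\<lambda>x. x + w x) x) < e" using c(2) by simp
qed (use w g in auto)

lemma Ham_infinity_subset_closure:
  "(Ham_infinity :: ('n::finite phase \<Rightarrow> 'n phase) set) \<subseteq> C_infinity_topology closure_of shear_group"
proof
  fix f :: "'n phase \<Rightarrow> 'n phase" assume "f \<in> Ham_infinity"
  from Ham_infinity_approx[OF this] obtain w where w: "bounded_smooth w" "is_lift (\<lambda>x. x + w x) f"
    "\<And>r e. 0 < e \<Longrightarrow> \<exists>g. shear_displacement g \<and> Cr_bounded r e (\<lambda>x. g x - w x)" by blast
  have sm: "smooth_map h" if "bounded_smooth g" "is_lift (\<lambda>x. x + g x) h" for g and h :: "'n phase \<Rightarrow> 'n phase"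
    unfolding smooth_map_def using that smooth_add[OF smooth_id bounded_smooth_smooth[OF that(1)]] by blast
  show "f \<in> C_infinity_topology closure_of shear_group"
    unfolding in_closure_of topspace_C_infinity_topology openin_C_infinity_topology
  proof (intro conjI allI impI)
    show "f \<in> {f. smooth_map f}" using sm[OF w(1,2)] by simp
    fix U assume U: "f \<in> U \<and> C_infinity_open U"
    then obtain r e where e: "e > 0" "\<And>g. smooth_map g \<Longrightarrow> Cr_close r e f g \<Longrightarrow> g \<in> U"
      unfolding C_infinity_open_def by blast
    then obtain g where g: "shear_displacement g" "Cr_bounded r (e / 2) (\<lambda>x. g x - w x)"
      using w(3)[of "e / 2" r] by auto
    then obtain f' where f': "f' \<in> shear_group" "is_lift (\<lambda>x. x + g x) f'" "bounded_smooth g"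
      unfolding shear_displacement_def by blast
    have "Cr_close r e f f'"
      using e(1) by (intro Cr_close_displacement[OF w(1,2) f'(3,2) g(2)]) simp
    then show "\<exists>y. y \<in> shear_group \<and> y \<in> U"
      using e(2) sm[OF f'(3,2)] f'(1) by blast
  qed
qed

section \<open>Shear maps are Hamiltonian\<close>

lemma smooth_cmult:
  assumes "smooth f"
  shows "smooth (\<lambda>x. c * f x :: real)"
    and "set vs \<subseteq> Basis \<Longrightarrow> iter_deriv vs (\<lambda>x. c * f x) = (\<lambda>x. c * iter_deriv vs f x)"
proof -
  have e: "iter_deriv vs (\<lambda>x. c * f x) = (\<lambda>x. c * iter_deriv vs f x)" if "set vs \<subseteq> Basis" for vs
    using that
  proof (induction vs)
    case (Cons v vs)
    then have d: "iter_deriv vs f differentiable (at x)" for x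
      using assms unfolding smooth_def by auto
    have IH: "iter_deriv vs (\<lambda>x. c * f x) = (\<lambda>x. c * iter_deriv vs f x)" using Cons by simp
    show ?case unfolding iter_deriv_Cons_pd IH
      by (intro ext pd_linear[OF d bounded_linear_mult_right])
  qed simp
  then show "set vs \<subseteq> Basis \<Longrightarrow> iter_deriv vs (\<lambda>x. c * f x) = (\<lambda>x. c * iter_deriv vs f x)" .
  show "smooth (\<lambda>x. c * f x)"
    using assms unfolding smooth_def by (auto simp: e intro!: differentiable_mult)
qed

text \<open>\<open>smooth\<close> tests basis directions only, hence the condition that
  \<open>L\<close> sends a basis vector to a basis vector or to zero, as the two projections of the
  cover do.\<close>

lemma smooth_linear_comp:
  fixes g :: "'b::euclidean_space \<Rightarrow> 'c::real_normed_vector" and L :: "'a::euclidean_space \<Rightarrow> 'b"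
  assumes L: "bounded_linear L" "\<And>b. b \<in> Basis \<Longrightarrow> L b = 0 \<or> L b \<in> Basis" and g: "smooth g"
  shows "smooth (\<lambda>x. g (L x))"
proof -
  have "iter_deriv vs (\<lambda>x. g (L x)) differentiable (at x)" if "set vs \<subseteq> Basis" "smooth g" for vs x and g :: "'b \<Rightarrow> 'c"
    using that
  proof (induction vs arbitrary: g rule: rev_induct)
    case Nil
    have "((\<lambda>x. g (L x)) has_derivative (\<lambda>h. pd (L h) g (L x))) (at x)"
      by (rule has_derivative_compose[OF bounded_linear_imp_has_derivative[OF L(1)]
          has_derivative_pd'[OF smooth_differentiable[OF Nil(2)]]])
    then show ?case by (auto intro: differentiableI)
  next
    case (snoc b vs)
    have d: "((\<lambda>x. g (L x)) has_derivative (\<lambda>h. pd (L h) g (L x))) (at x)" for x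
      by (rule has_derivative_compose[OF bounded_linear_imp_has_derivative[OF L(1)]
          has_derivative_pd'[OF smooth_differentiable[OF snoc.prems(2)]]])
    have p: "pd b (\<lambda>x. g (L x)) = (\<lambda>x. pd (L b) g (L x))"
      using pd_eqI[OF d] by (rule ext)
    have b: "b \<in> Basis" "set vs \<subseteq> Basis" using snoc.prems(1) by auto
    show ?case
    proof (cases "L b = 0")
      case True
      have "pd 0 g = (\<lambda>x. 0)"
        using linear_0[OF has_derivative_linear[OF has_derivative_pd'[OF smooth_differentiable[OF snoc.prems(2)]]]]
        by (intro ext)
      then have "pd (L b) g = (\<lambda>x. 0)" using True by simp
      then show ?thesis
        unfolding iter_deriv_snoc p using snoc.IH[OF b(2) smooth_const[of 0]] by simp
    next
      case False
      then have "smooth (pd (L b) g)" using L(2)[OF b(1)] snoc.prems(2) smooth_pd by blast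
      then show ?thesis unfolding iter_deriv_snoc p by (rule snoc.IH[OF b(2)])
    qed
  qed
  with g show ?thesis unfolding smooth_def by blast
qed

lemma smooth_fst_snd:
  fixes g :: "real ^ 'n::finite \<Rightarrow> real"
  assumes "smooth g"
  shows "smooth (\<lambda>x :: 'n cover. g (fst x))" "smooth (\<lambda>x :: 'n cover. g (snd x))"
  using assms
  by (intro smooth_linear_comp[OF bounded_linear_fst] smooth_linear_comp[OF bounded_linear_snd]; auto simp: Basis_prod_def)+

lemma continuous_family_const:
  assumes "smooth_fun h"
  shows "continuous_family (\<lambda>t. h)"
  using assms unfolding continuous_family_def by (simp add: uniform_limit_const)

text \<open>The filter at \<open>\<theta> t0\<close> omits the point itself, which
  \<open>\<theta> t\<close> may hit for \<open>t \<noteq> t0\<close>; there the distance is zero, so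
  the statement extends to \<open>nhds\<close>.\<close>

lemma uniform_limit_reparam:
  fixes G :: "real \<Rightarrow> 'a \<Rightarrow> 'b::metric_space"
  assumes G: "\<And>s. 0 \<le> s \<Longrightarrow> uniform_limit UNIV G (G s) (at s within {0..})"
    and \<theta>: "continuous_on UNIV \<theta>" "\<And>t. 0 \<le> \<theta> t"
  shows "uniform_limit UNIV (\<lambda>t. G (\<theta> t)) (G (\<theta> t0)) (at t0 within {0..})"
proof (rule uniform_limitI)
  fix e :: real assume e: "0 < e"
  have "\<forall>\<^sub>F s in at (\<theta> t0) within {0..}. \<forall>x\<in>UNIV. dist (G s x) (G (\<theta> t0) x) < e"
    using G[OF \<theta>(2)] e by (rule uniform_limitD)
  then have "\<forall>\<^sub>F s in nhds (\<theta> t0). s \<in> {0..} \<longrightarrow> (\<forall>x\<in>UNIV. dist (G s x) (G (\<theta> t0) x) < e)"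
    unfolding eventually_at_filter by (rule eventually_mono) (use e in auto)
  moreover have "(\<theta> \<longlongrightarrow> \<theta> t0) (at t0 within {0..})"
    using \<theta>(1) by (meson UNIV_I continuous_on_def tendsto_within_subset top_greatest)
  ultimately have "\<forall>\<^sub>F t in at t0 within {0..}. \<theta> t \<in> {0..} \<longrightarrow> (\<forall>x\<in>UNIV. dist (G (\<theta> t) x) (G (\<theta> t0) x) < e)"
    by (rule eventually_compose_filterlim)
  then show "\<forall>\<^sub>F t in at t0 within {0..}. \<forall>x\<in>UNIV. dist (G (\<theta> t) x) (G (\<theta> t0) x) < e"
    by (rule eventually_mono) (use \<theta>(2) in auto)
qed

text \<open>Supplies the boundedness under which a product of uniform limits converges
  uniformly.\<close>

lemma iter_deriv_bounded:
  fixes h :: "'n::finite phase \<Rightarrow> real"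
  assumes "smooth_fun h" "set vs \<subseteq> Basis"
  shows "bounded (range (iter_deriv vs (h \<circ> to_phase)))"
proof -
  have "bounded_smooth (h \<circ> to_phase)"
    using assms(1) unfolding smooth_fun_def by (intro smooth_periodic_bounded_smooth) (simp_all add: to_phase_periodic)
  then obtain M where "Cr_bounded (length vs) M (h \<circ> to_phase)" unfolding bounded_smooth_def by blast
  from Cr_bounded_iter_deriv[OF this order_refl assms(2)] show ?thesis
    unfolding bounded_iff by (intro exI[of _ M]) auto
qed

lemma continuous_family_reparam:
  fixes H :: "real \<Rightarrow> 'n::finite phase \<Rightarrow> real"
  assumes H: "continuous_family H" and a: "continuous_on UNIV a"
    and \<theta>: "continuous_on UNIV \<theta>" "\<And>t. 0 \<le> \<theta> t"
  shows "continuous_family (\<lambda>t z. a t * H (\<theta> t) z)"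
proof -
  have sm: "smooth (H (\<theta> t) \<circ> to_phase)" for t
    using H \<theta>(2) unfolding continuous_family_def smooth_fun_def by blast
  have e: "(\<lambda>z. a t * H (\<theta> t) z) \<circ> to_phase = (\<lambda>x. a t * (H (\<theta> t) \<circ> to_phase) x)" for t
    by auto
  have "uniform_limit UNIV (\<lambda>t. iter_deriv vs ((\<lambda>z. a t * H (\<theta> t) z) \<circ> to_phase))
      (iter_deriv vs ((\<lambda>z. a t0 * H (\<theta> t0) z) \<circ> to_phase)) (at t0 within {0..})"
    if vs: "set vs \<subseteq> Basis" for vs t0
  proof -
    have "uniform_limit UNIV (\<lambda>s. iter_deriv vs (H s \<circ> to_phase)) (iter_deriv vs (H s0 \<circ> to_phase)) (at s0 within {0..})"
      if "0 \<le> s0" for s0 using H vs that unfolding continuous_family_def by blast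
    from uniform_limit_reparam[OF this \<theta>]
    have 1: "uniform_limit UNIV (\<lambda>t. iter_deriv vs (H (\<theta> t) \<circ> to_phase)) (iter_deriv vs (H (\<theta> t0) \<circ> to_phase)) (at t0 within {0..})" .
    have "(a \<longlongrightarrow> a t0) (at t0 within {0..})"
      using a by (meson UNIV_I continuous_on_def tendsto_within_subset top_greatest)
    then have 2: "uniform_limit UNIV (\<lambda>t (x :: 'n cover). a t) (\<lambda>x. a t0) (at t0 within {0..})"
      by (auto simp: uniform_limit_iff tendsto_iff)
    have "bounded (range (iter_deriv vs (H (\<theta> t0) \<circ> to_phase)))"
      using sm vs by (intro iter_deriv_bounded) (simp_all add: smooth_fun_def)
    then have "uniform_limit UNIV (\<lambda>t x. a t * iter_deriv vs (H (\<theta> t) \<circ> to_phase) x)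
        (\<lambda>x. a t0 * iter_deriv vs (H (\<theta> t0) \<circ> to_phase) x) (at t0 within {0..})"
      by (intro uniform_lim_mult[OF 2 1]) auto
    then show ?thesis unfolding e smooth_cmult(2)[OF sm vs] .
  qed
  moreover have "smooth_fun (\<lambda>z. a t * H (\<theta> t) z)" for t
    unfolding smooth_fun_def e by (rule smooth_cmult(1)[OF sm])
  ultimately show ?thesis unfolding continuous_family_def by blast
qed

lemma continuous_family_add:
  fixes H K :: "real \<Rightarrow> 'n::finite phase \<Rightarrow> real"
  assumes H: "continuous_family H" and K: "continuous_family K"
  shows "continuous_family (\<lambda>t z. H t z + K t z)"
proof -
  have sm: "smooth (H t \<circ> to_phase)" "smooth (K t \<circ> to_phase)" if "0 \<le> t" for t
    using H K that unfolding continuous_family_def smooth_fun_def by blast+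
  have e: "(\<lambda>z. H t z + K t z) \<circ> to_phase = (\<lambda>x. (H t \<circ> to_phase) x + (K t \<circ> to_phase) x)" for t
    by auto
  have "uniform_limit UNIV (\<lambda>t. iter_deriv vs ((\<lambda>z. H t z + K t z) \<circ> to_phase))
      (iter_deriv vs ((\<lambda>z. H t0 z + K t0 z) \<circ> to_phase)) (at t0 within {0..})"
    if vs: "set vs \<subseteq> Basis" and t0: "0 \<le> t0" for vs t0
  proof -
    have ul: "uniform_limit UNIV (\<lambda>t x. iter_deriv vs (H t \<circ> to_phase) x + iter_deriv vs (K t \<circ> to_phase) x)
      (\<lambda>x. iter_deriv vs (H t0 \<circ> to_phase) x + iter_deriv vs (K t0 \<circ> to_phase) x) (at t0 within {0..})"
      using H K vs t0 unfolding continuous_family_def by (intro uniform_limit_add) blast+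
    have eq: "iter_deriv vs ((\<lambda>z. H t z + K t z) \<circ> to_phase) =
        (\<lambda>x. iter_deriv vs (H t \<circ> to_phase) x + iter_deriv vs (K t \<circ> to_phase) x)" if "0 \<le> t" for t
      unfolding e by (rule iter_deriv_add[OF sm[OF that] vs])
    have ev: "\<forall>\<^sub>F t in at t0 within {0..}. \<forall>x\<in>UNIV.
        iter_deriv vs (H t \<circ> to_phase) x + iter_deriv vs (K t \<circ> to_phase) x =
        iter_deriv vs ((\<lambda>z. H t z + K t z) \<circ> to_phase) x"
      unfolding eventually_at_filter by (rule always_eventually) (auto simp: eq)
    show ?thesis
      by (rule iffD1[OF uniform_limit_cong, OF ev _ ul]) (simp add: eq[OF t0])
  qed
  moreover have "smooth_fun (\<lambda>z. H t z + K t z)" if "0 \<le> t" for t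
    unfolding smooth_fun_def e by (rule smooth_add[OF sm[OF that]])
  ultimately show ?thesis unfolding continuous_family_def by blast
qed

lemma gradient_const: "gradient (\<lambda>x. c) x = 0"
  by (rule gradient_eqI) simp

text \<open>The Hamiltonian \<open>- s * v\<close> depends on \<open>q\<close> only, so
  \<open>q\<close> is constant and \<open>p\<close> moves with constant speed. The factor
  \<open>s\<close> covers a shear (\<open>s = -1\<close>) and its inverse
  (\<open>s = 1\<close>).\<close>

lemma vertical_in_Ham:
  fixes f :: "'n::finite phase \<Rightarrow> 'n phase"
  assumes v: "real_analytic (v \<circ> to_torus)"
    and f: "is_lift (\<lambda>(q, p). (q, p + s *\<^sub>R gradient (v \<circ> to_torus) q)) f"
  shows "f \<in> Ham_infinity"
proof -
  let ?g = "gradient (v \<circ> to_torus)"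
  let ?h = "\<lambda>z :: 'n phase. - s * v (fst z)"
  have sv: "smooth (v \<circ> to_torus)" using v by (rule real_analytic_smooth)
  have grad: "gradient (\<lambda>q. - (s * v (to_torus q))) q = - s *\<^sub>R ?g q" for q
  proof -
    have d: "((v \<circ> to_torus) has_derivative (\<lambda>h. pd h (v \<circ> to_torus) q)) (at q)"
      using sv by (intro has_derivative_pd' smooth_differentiable)
    have d': "((\<lambda>q. - (s * v (to_torus q))) has_derivative (\<lambda>h. - s * pd h (v \<circ> to_torus) q)) (at q)"
      using has_derivative_mult_right[OF d, of "- s"] by (simp add: o_def)
    show ?thesis
      unfolding gradient_def frechet_derivative_at[OF d, symmetric] frechet_derivative_at[OF d', symmetric]
      by (simp add: scaleR_sum_right)
  qed
  have "smooth_fun ?h"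
  proof -
    have "?h \<circ> to_phase = (\<lambda>x. - s * (v \<circ> to_torus) (fst x))"
      by (auto simp: fun_eq_iff to_phase_def)
    then show ?thesis unfolding smooth_fun_def by (simp only:) (intro smooth_cmult(1) smooth_fst_snd(1) sv)
  qed
  then have "continuous_family (\<lambda>t. ?h)" by (rule continuous_family_const)
  moreover have "ham_flow (\<lambda>t. ?h) 0 1 f"
    unfolding ham_flow_def
  proof
    fix x :: "'n phase"
    obtain q p where x: "x = to_phase (q, p)" using to_phase_rep[of x] by metis
    let ?c = "\<lambda>u. (q, p + u *\<^sub>R (s *\<^sub>R ?g q))"
    have "ham_solution (\<lambda>t. ?h) 0 1 ?c"
      unfolding ham_solution_def
    proof
      fix u :: real assume "u \<in> {0..1}"
      have "ham_field ?h (?c u) = (0, s *\<^sub>R ?g q)"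
        by (simp add: ham_field_def to_phase_def gradient_const grad)
      moreover have "(?c has_vector_derivative (0, 0 + 1 *\<^sub>R (s *\<^sub>R ?g q))) (at u within {0..1})"
        by (intro has_vector_derivative_Pair derivative_intros) (auto intro!: derivative_eq_intros)
      ultimately show "(?c has_vector_derivative ham_field ?h (?c u)) (at u within {0..1})" by simp
    qed
    moreover have "f x = to_phase (?c 1)" using f unfolding is_lift_def x by simp
    ultimately show "\<exists>c. ham_solution (\<lambda>t. ?h) 0 1 c \<and> to_phase (c 0) = x \<and> to_phase (c 1) = f x"
      using x by (intro exI[of _ ?c]) simp
  qed
  ultimately show ?thesis unfolding Ham_infinity_def by blast
qed

lemma horizontal_in_Ham:
  fixes f :: "'n::finite phase \<Rightarrow> 'n phase"
  assumes v: "real_analytic (v \<circ> to_torus)"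
    and f: "is_lift (\<lambda>(q, p). (q + s *\<^sub>R gradient (v \<circ> to_torus) p, p)) f"
  shows "f \<in> Ham_infinity"
proof -
  let ?g = "gradient (v \<circ> to_torus)"
  let ?h = "\<lambda>z :: 'n phase. s * v (snd z)"
  have sv: "smooth (v \<circ> to_torus)" using v by (rule real_analytic_smooth)
  have grad: "gradient (\<lambda>q. s * v (to_torus q)) q = s *\<^sub>R ?g q" for q
  proof -
    have d: "((v \<circ> to_torus) has_derivative (\<lambda>h. pd h (v \<circ> to_torus) q)) (at q)"
      using sv by (intro has_derivative_pd' smooth_differentiable)
    have d': "((\<lambda>q. s * v (to_torus q)) has_derivative (\<lambda>h. s * pd h (v \<circ> to_torus) q)) (at q)"
      using has_derivative_mult_right[OF d, of s] by (simp add: o_def)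
    show ?thesis
      unfolding gradient_def frechet_derivative_at[OF d, symmetric] frechet_derivative_at[OF d', symmetric]
      by (simp add: scaleR_sum_right)
  qed
  have "smooth_fun ?h"
  proof -
    have "?h \<circ> to_phase = (\<lambda>x. s * (v \<circ> to_torus) (snd x))"
      by (auto simp: fun_eq_iff to_phase_def)
    then show ?thesis unfolding smooth_fun_def by (simp only:) (intro smooth_cmult(1) smooth_fst_snd(2) sv)
  qed
  then have "continuous_family (\<lambda>t. ?h)" by (rule continuous_family_const)
  moreover have "ham_flow (\<lambda>t. ?h) 0 1 f"
    unfolding ham_flow_def
  proof
    fix x :: "'n phase"
    obtain q p where x: "x = to_phase (q, p)" using to_phase_rep[of x] by metis
    let ?c = "\<lambda>u. (q + u *\<^sub>R (s *\<^sub>R ?g p), p)"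
    have "ham_solution (\<lambda>t. ?h) 0 1 ?c"
      unfolding ham_solution_def
    proof
      fix u :: real assume "u \<in> {0..1}"
      have "ham_field ?h (?c u) = (s *\<^sub>R ?g p, 0)"
        by (simp add: ham_field_def to_phase_def gradient_const grad)
      moreover have "(?c has_vector_derivative (0 + 1 *\<^sub>R (s *\<^sub>R ?g p), 0)) (at u within {0..1})"
        by (intro has_vector_derivative_Pair derivative_intros) (auto intro!: derivative_eq_intros)
      ultimately show "(?c has_vector_derivative ham_field ?h (?c u)) (at u within {0..1})" by simp
    qed
    moreover have "f x = to_phase (?c 1)" using f unfolding is_lift_def x by simp
    ultimately show "\<exists>c. ham_solution (\<lambda>t. ?h) 0 1 c \<and> to_phase (c 0) = x \<and> to_phase (c 1) = f x"
      using x by (intro exI[of _ ?c]) simp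
  qed
  ultimately show ?thesis unfolding Ham_infinity_def by blast
qed

lemma ham_field_shift:
  assumes "smooth_fun h" "\<And>y. to_phase (y + v) = to_phase y"
  shows "ham_field h (y + v) = ham_field h y"
  unfolding ham_field_eq_ham_vf[OF assms(1)]
  using assms by (intro ham_vf_shift) (simp_all add: smooth_fun_def smooth_differentiable)

text \<open>Solutions may be translated by periods, so a solution can start at any lift;
  concatenation needs the second curve to begin where the first one ends.\<close>

lemma ham_flow_from:
  assumes H: "continuous_family H" "ham_flow H 0 1 f" and y: "to_phase y = x"
  shows "\<exists>c. ham_solution H 0 1 c \<and> c 0 = y \<and> to_phase (c 1) = f x"
proof -
  obtain c where c: "ham_solution H 0 1 c" "to_phase (c 0) = x" "to_phase (c 1) = f x"
    using H(2) unfolding ham_flow_def by blast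
  have v: "to_phase (z + (y - c 0)) = to_phase z" for z
    using to_phase_shift[of y "c 0"] y c(2) by simp
  have "ham_solution H 0 1 (\<lambda>u. c u + (y - c 0))"
    unfolding ham_solution_def
  proof
    fix u :: real assume u: "u \<in> {0..1}"
    then have "(c has_vector_derivative ham_field (H u) (c u)) (at u within {0..1})"
      using c(1) unfolding ham_solution_def by blast
    moreover have "ham_field (H u) (c u + (y - c 0)) = ham_field (H u) (c u)"
      using H(1) u unfolding continuous_family_def by (intro ham_field_shift v) auto
    ultimately show "((\<lambda>u. c u + (y - c 0)) has_vector_derivative ham_field (H u) (c u + (y - c 0))) (at u within {0..1})"
      by (auto intro: derivative_eq_intros)
  qed
  then show ?thesis using v c(3) by (intro exI[of _ "\<lambda>u. c u + (y - c 0)"]) simp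
qed

lemma ham_field_comb:
  assumes "smooth_fun h" "smooth_fun k"
  shows "ham_field (\<lambda>z. a * h z + b * k z) x = a *\<^sub>R ham_field h x + b *\<^sub>R ham_field k x"
proof -
  have s: "smooth (h \<circ> to_phase)" "smooth (k \<circ> to_phase)" using assms unfolding smooth_fun_def .
  have e: "(\<lambda>z. a * h z + b * k z) \<circ> to_phase = (\<lambda>x. a * (h \<circ> to_phase) x + b * (k \<circ> to_phase) x)" by auto
  have sc: "smooth_fun (\<lambda>z. a * h z + b * k z)"
    unfolding smooth_fun_def e by (intro smooth_add smooth_cmult(1) s)
  show ?thesis
    unfolding ham_field_eq_ham_vf[OF assms(1)] ham_field_eq_ham_vf[OF assms(2)] ham_field_eq_ham_vf[OF sc] e
    unfolding ham_vf_add[OF smooth_differentiable[OF smooth_cmult(1)[OF s(1)]]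
        smooth_differentiable[OF smooth_cmult(1)[OF s(2)]]]
      ham_vf_cmult[OF smooth_differentiable[OF s(1)]] ham_vf_cmult[OF smooth_differentiable[OF s(2)]] ..
qed

text \<open>The two flows are run one after the other with the clocks \<open>sin\<^sup>2 (\<pi> t)\<close> and
  \<open>cos\<^sup>2 (\<pi> t)\<close>, whose speed vanishes at \<open>t = 0, 1/2, 1\<close>, so that the concatenated Hamiltonian
  is continuous in time.\<close>

lemma Ham_infinity_comp:
  fixes f g :: "'n::finite phase \<Rightarrow> 'n phase"
  assumes f: "f \<in> Ham_infinity" and g: "g \<in> Ham_infinity"
  shows "f \<circ> g \<in> Ham_infinity"
proof -
  obtain H where H: "continuous_family H" "ham_flow H 0 1 g" using g unfolding Ham_infinity_def by blast
  obtain K where K: "continuous_family K" "ham_flow K 0 1 f" using f unfolding Ham_infinity_def by blast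
  \<comment> \<open>\<open>a\<close> and \<open>b\<close> are the positive parts of the derivatives
    of \<open>S\<close> and \<open>C\<close>. In the first half of [0, 1] only \<open>H\<close>
    acts, while \<open>S\<close> runs from 0 to 1; in the second half only \<open>K\<close> acts,
    while \<open>C\<close> does.\<close>
  define a where "a = (\<lambda>t. max 0 (pi * sin (2 * pi * t)))"
  define b where "b = (\<lambda>t. max 0 (- (pi * sin (2 * pi * t))))"
  define S where "S = (\<lambda>t. (sin (pi * t))\<^sup>2)"
  define C where "C = (\<lambda>t. (cos (pi * t))\<^sup>2)"
  have SC: "0 \<le> S t" "0 \<le> C t" "S t \<le> 1" "C t \<le> 1" for t
    by (simp_all add: S_def C_def abs_square_le_1)
  let ?L = "\<lambda>t z. a t * H (S t) z + b t * K (C t) z"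
  have smH: "smooth_fun (H (S t))" and smK: "smooth_fun (K (C t))" for t
    using H(1) K(1) SC unfolding continuous_family_def by blast+
  have L: "continuous_family ?L"
    unfolding a_def b_def S_def C_def
    by (intro continuous_family_add continuous_family_reparam H K continuous_intros) auto
  have DS: "(S has_real_derivative pi * sin (2 * pi * t)) (at t within T)"
    and DC: "(C has_real_derivative - (pi * sin (2 * pi * t))) (at t within T)" for t T
    unfolding S_def C_def using sin_double[of "pi * t"]
    by (auto intro!: derivative_eq_intros simp: mult_ac)
  have "ham_flow ?L 0 1 (f \<circ> g)"
    unfolding ham_flow_def
  proof
    fix x :: "'n phase"
    obtain y where y: "to_phase y = x" using to_phase_rep by blast
    obtain c1 where c1: "ham_solution H 0 1 c1" "c1 0 = y" "to_phase (c1 1) = g x"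
      using ham_flow_from[OF H y] by blast
    \<comment> \<open>The second curve starts at the endpoint of the first one in the cover, not
      merely over the same point of \<open>V\<close>.\<close>
    obtain c2 where c2: "ham_solution K 0 1 c2" "c2 0 = c1 1" "to_phase (c2 1) = f (g x)"
      using ham_flow_from[OF K c1(3)] by blast
    have A: "((\<lambda>t. c1 (S t)) has_vector_derivative (pi * sin (2 * pi * t)) *\<^sub>R ham_field (H (S t)) (c1 (S t))) (at t within T)" for t T
    proof -
      \<comment> \<open>At the ends of [0, 1] a solution has one-sided derivatives, so the chain
        rule is applied within the image of \<open>T\<close> under the clock.\<close>
      have "(c1 has_vector_derivative ham_field (H (S t)) (c1 (S t))) (at (S t) within S ` T)"
      proof (rule has_vector_derivative_within_subset)
        show "(c1 has_vector_derivative ham_field (H (S t)) (c1 (S t))) (at (S t) within {0..1})"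
          using c1(1) SC[of t] unfolding ham_solution_def by (elim ballE) auto
        show "S ` T \<subseteq> {0..1}" using SC by auto
      qed
      from vector_diff_chain_within[OF DS[unfolded has_real_derivative_iff_has_vector_derivative] this]
      show ?thesis by (simp add: o_def)
    qed
    have B: "((\<lambda>t. c2 (C t)) has_vector_derivative (- (pi * sin (2 * pi * t))) *\<^sub>R ham_field (K (C t)) (c2 (C t))) (at t within T)" for t T
    proof -
      have "(c2 has_vector_derivative ham_field (K (C t)) (c2 (C t))) (at (C t) within C ` T)"
      proof (rule has_vector_derivative_within_subset)
        show "(c2 has_vector_derivative ham_field (K (C t)) (c2 (C t))) (at (C t) within {0..1})"
          using c2(1) SC[of t] unfolding ham_solution_def by (elim ballE) auto
        show "C ` T \<subseteq> {0..1}" using SC by auto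
      qed
      from vector_diff_chain_within[OF DC[unfolded has_real_derivative_iff_has_vector_derivative] this]
      show ?thesis by (simp add: o_def)
    qed
    let ?c = "\<lambda>t. if t \<in> {0..1/2} then c1 (S t) else c2 (C t)"
    have half: "S (1 / 2) = 1" "C (1 / 2) = 0" by (simp_all add: S_def C_def)
    have "ham_solution ?L 0 1 ?c"
      unfolding ham_solution_def
    proof
      fix t :: real assume t: "t \<in> {0..1}"
      have "(?c has_vector_derivative (if t \<in> {0..1/2} then (pi * sin (2 * pi * t)) *\<^sub>R ham_field (H (S t)) (c1 (S t))
          else (- (pi * sin (2 * pi * t))) *\<^sub>R ham_field (K (C t)) (c2 (C t)))) (at t within {0..1})"
      proof (rule has_vector_derivative_If_within_closures[where T = "{1/2..1}"])
        show "c1 (S t) = c2 (C t)" "(pi * sin (2 * pi * t)) *\<^sub>R ham_field (H (S t)) (c1 (S t)) =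
          (- (pi * sin (2 * pi * t))) *\<^sub>R ham_field (K (C t)) (c2 (C t))"
          if "t \<in> closure {0..1/2}" "t \<in> closure {1/2..1}"
        proof -
          have t: "t = 1 / 2" using that by auto
          show "c1 (S t) = c2 (C t)" unfolding t half using c2(2) by simp
          have "sin (2 * pi * t) = 0" unfolding t by simp
          then show "(pi * sin (2 * pi * t)) *\<^sub>R ham_field (H (S t)) (c1 (S t)) =
            (- (pi * sin (2 * pi * t))) *\<^sub>R ham_field (K (C t)) (c2 (C t))" by simp
        qed
      qed (use t A B in auto)
      moreover have "(if t \<in> {0..1/2} then (pi * sin (2 * pi * t)) *\<^sub>R ham_field (H (S t)) (c1 (S t))
          else (- (pi * sin (2 * pi * t))) *\<^sub>R ham_field (K (C t)) (c2 (C t))) = ham_field (?L t) (?c t)"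
      proof (cases "t \<le> 1 / 2")
        case True
        then have "0 \<le> sin (2 * pi * t)" using t by (intro sin_ge_zero) auto
        then have "a t = pi * sin (2 * pi * t)" "b t = 0" by (auto simp: a_def b_def)
        then show ?thesis unfolding ham_field_comb[OF smH smK] using True t by simp
      next
        case False
        have "0 \<le> sin (2 * pi * t - pi)" using t False by (intro sin_ge_zero) auto
        then have "sin (2 * pi * t) \<le> 0" by (simp add: sin_diff)
        then have "b t = - (pi * sin (2 * pi * t))" "a t = 0" by (auto simp: a_def b_def mult_le_0_iff)
        then show ?thesis unfolding ham_field_comb[OF smH smK] using False t by simp
      qed
      ultimately show "(?c has_vector_derivative ham_field (?L t) (?c t)) (at t within {0..1})" by simp
    qed
    moreover have "to_phase (?c 0) = x" "to_phase (?c 1) = (f \<circ> g) x"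
      using y c1(2) c2(3) by (simp_all add: S_def C_def)
    ultimately show "\<exists>c. ham_solution ?L 0 1 c \<and> to_phase (c 0) = x \<and> to_phase (c 1) = (f \<circ> g) x" by blast
  qed
  with L show ?thesis unfolding Ham_infinity_def by blast
qed

lemma Ham_infinity_id: "id \<in> (Ham_infinity :: ('n::finite phase \<Rightarrow> 'n phase) set)"
proof (rule vertical_in_Ham[where v = "\<lambda>_. 0" and s = 0])
  show "real_analytic ((\<lambda>_ :: 'n torus. 0) \<circ> to_torus)" by (simp add: o_def real_analytic_zero)
  show "is_lift (\<lambda>(q, p). (q, p + 0 *\<^sub>R gradient ((\<lambda>_ :: 'n torus. 0) \<circ> to_torus) q)) id"
    using is_lift_id by (simp add: case_prod_unfold)
qed

text \<open>A generated group contains the inverses of its generators, so these have to be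
  Hamiltonian as well; the inverse of a shear is the shear with the opposite displacement.\<close>

lemma shears_in_Ham:
  fixes f :: "'n::finite phase \<Rightarrow> 'n phase"
  assumes "f \<in> vertical_shears \<union> horizontal_shears"
  shows "f \<in> Ham_infinity" "inv_into UNIV f \<in> Ham_infinity"
proof -
  have "f \<in> Ham_infinity \<and> inv_into UNIV f \<in> Ham_infinity"
    using assms
  proof
    assume "f \<in> vertical_shears"
    then obtain v :: "'n torus \<Rightarrow> real" where v: "real_analytic (v \<circ> to_torus)"
      and f: "is_lift (\<lambda>(q, p). (q, p - gradient (v \<circ> to_torus) q)) f"
      unfolding vertical_shears_def by blast
    obtain g where g: "is_lift (\<lambda>(q, p). (q, p + gradient (v \<circ> to_torus) q)) g" "f \<circ> g = id" "g \<circ> f = id"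
      using vertical_lift_inverse[OF f] gradient_periodic by blast
    have "inv_into UNIV f = g" using g(2,3) by (metis inv_unique_comp)
    moreover have "f \<in> Ham_infinity" using vertical_in_Ham[OF v, of "-1" f] f by simp
    moreover have "g \<in> Ham_infinity" using vertical_in_Ham[OF v, of 1 g] g(1) by simp
    ultimately show ?thesis by simp
  next
    assume "f \<in> horizontal_shears"
    then obtain v :: "'n torus \<Rightarrow> real" where v: "real_analytic (v \<circ> to_torus)"
      and f: "is_lift (\<lambda>(q, p). (q + gradient (v \<circ> to_torus) p, p)) f"
      unfolding horizontal_shears_def by blast
    obtain g where g: "is_lift (\<lambda>(q, p). (q - gradient (v \<circ> to_torus) p, p)) g" "f \<circ> g = id" "g \<circ> f = id"
      using horizontal_lift_inverse[OF f] gradient_periodic by blast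
    have "inv_into UNIV f = g" using g(2,3) by (metis inv_unique_comp)
    moreover have "f \<in> Ham_infinity" using horizontal_in_Ham[OF v, of 1 f] f by simp
    moreover have "g \<in> Ham_infinity" using horizontal_in_Ham[OF v, of "-1" g] g(1) by simp
    ultimately show ?thesis by simp
  qed
  then show "f \<in> Ham_infinity" "inv_into UNIV f \<in> Ham_infinity" by auto
qed

text \<open>Induction over words in the generators: the letters are time-one maps, and products are
  handled by concatenation of flows.\<close>

lemma shear_group_subset_Ham_infinity:
  "(shear_group :: ('n::finite phase \<Rightarrow> 'n phase) set) \<subseteq> Ham_infinity"
proof
  fix f :: "'n phase \<Rightarrow> 'n phase" assume "f \<in> shear_group"
  then show "f \<in> Ham_infinity"
    unfolding shear_group_def
  proof (induction rule: generate.induct)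
    case one
    then show ?case using Ham_infinity_id by (simp add: BijGroup_def id_def restrict_def)
  next
    case (incl h)
    then show ?case by (rule shears_in_Ham)
  next
    case (inv h)
    then have "h \<in> Bij UNIV" using shears_Bij by blast
    then have "m_inv (BijGroup UNIV) h = inv_into UNIV h" by (simp add: inv_BijGroup restrict_def)
    then show ?case using shears_in_Ham(2)[OF inv] by simp
  next
    case (eng h1 h2)
    have "h1 \<in> Bij UNIV" "h2 \<in> Bij UNIV"
      using eng.hyps shear_group_Bij unfolding shear_group_def by blast+
    then have eq: "h1 \<otimes>\<^bsub>BijGroup UNIV\<^esub> h2 = h1 \<circ> h2"
      by (auto simp: BijGroup_def compose_def fun_eq_iff)
    show ?case unfolding eq by (rule Ham_infinity_comp[OF eng.IH])
  qed
qed

theorem corollary1p1: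
  shows "(shear_group :: ('n::finite phase \<Rightarrow> 'n phase) set) \<subseteq> Ham_infinity \<and>
         (Ham_infinity :: ('n phase \<Rightarrow> 'n phase) set) \<subseteq> C_infinity_topology closure_of shear_group"
  using shear_group_subset_Ham_infinity Ham_infinity_subset_closure by blast

end
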